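(* Let $(\mathsf{X},\mathsf{d})$ be a proper metric space (every closed ball is compact). For each $n\in\mathbb{N}\cup\{\infty\}$ let $X_n$ be a nonempty compact subset of $\mathsf{X}$, equipped with the intrinsic (length) metric $d_n$ induced from $\mathsf{d}$, and assume that $(X_n,d_n)$ is a complete geodesic space. Let $H_n:(0,\infty)\times X_n\times\mathbb{R}\times\mathbb{R}_+\to\mathbb{R}$ for $n\in\mathbb{N}\cup\{\infty\}$. For $x\in X_\infty$ let $S(x)$ be the set of sequences $(x_n)_{n\in\mathbb{N}}$ with $x_n\in X_n$ for all $n$ and $\mathsf{d}(x_n,x)\to 0$. Assume: (1) $\max\{\sup_{x\in X_n}\mathsf{d}(X_\infty,x),\ \sup_{x\in X_\infty}\mathsf{d}(X_n,x)\}\to 0$ as $n\to\infty$, where $\mathsf{d}(A,x)=\inf_{a\in A}\mathsf{d}(a,x)$; (2) for all $a_\infty,b_\infty\in X_\infty$, $(a_n)\in S(a_\infty)$ and $(b_n)\in S(b_\infty)$ one has $d_n(a_n,b_n)\to d_\infty(a_\infty,b_\infty)$; (3) for all $t_n\to t_\infty$ in $(0,\infty)$, $x_\infty\in X_\infty$, $(x_n)\in S(x_\infty)$, $u_n\to u_\infty$ in $\mathbb{R}$ and $p_n\to p_\infty$ in $\mathbb{R}_+$ one has $H_n(t_n,x_n,u_n,p_n)\to H_\infty(t_\infty,x_\infty,u_\infty,p_\infty)$. Then the following hold. (a) Suppose that for each $n\in\mathbb{N}$, $u^n:(0,\infty)\times X_n\to\mathbb{R}$ is a metric viscosity subsolution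 of $\partial_t u^n+H_n(t,x,u^n,|\nabla_{d_n}u^n|)=0$ on $(0,\infty)\times X_n$. If the upper semilimit $$\overline{u}^\infty(t,x):=\sup_{t_n\to t,\ (x_n)\in S(x)}\limsup_{n\to\infty}u^n(t_n,x_n),\qquad (t,x)\in(0,\infty)\times X_\infty,$$ is real-valued and upper semicontinuous on $(0,\infty)\times(X_\infty,d_\infty)$, then $\overline{u}^\infty$ is a metric viscosity subsolution of $\partial_t u+H_\infty(t,x,u,|\nabla_{d_\infty}u|)=0$ on $(0,\infty)\times X_\infty$. (b) Suppose that for each $n\in\mathbb{N}$, $u^n:(0,\infty)\times X_n\to\mathbb{R}$ is a metric viscosity supersolution of $\partial_t u^n+H_n(t,x,u^n,|\nabla_{d_n}u^n|)=0$ on $(0,\infty)\times X_n$. If the lower semilimit $$\underline{u}^\infty(t,x):=\inf_{t_n\to t,\ (x_n)\in S(x)}\liminf_{n\to\infty}u^n(t_n,x_n),\qquad (t,x)\in(0,\infty)\times X_\infty,$$ is real-valued and lower semicontinuous on $(0,\infty)\times(X_\infty,d_\infty)$, then $\underline{u}^\infty$ is a metric viscosity supersolution of $\partial_t u+H_\infty(t,x,u,|\nabla_{d_\infty}u|)=0$ on $(0,\infty)\times X_\infty$.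
   Context: $\mathbb{R}_+=[0,\infty)$. In the semilimits, $(t_n)$ ranges over sequences in $(0,\infty)$ converging to $t$. Let $(X,d)$ be a complete geodesic space and $H:(0,\infty)\times X\times\mathbb{R}\times\mathbb{R}_+\to\mathbb{R}$. Topological notions on $(0,\infty)\times X$ (local maxima, semicontinuity, envelopes, local Lipschitz continuity) are with respect to the product of the usual topology and $d$. Slopes (in the space variable). For a locally Lipschitz $u:(0,\infty)\times X\to\mathbb{R}$, $$|\nabla_d u|(t,x)=\limsup_{y\to x}\frac{|u(t,y)-u(t,x)|}{d(x,y)},\qquad |\nabla_d^{\pm}u|(t,x)=\limsup_{y\to x}\frac{[u(t,y)-u(t,x)]_\pm}{d(x,y)},$$ with $[a]_\pm=\max\{\pm a,0\}$ (and value $0$ if $x$ is isolated in $X$). Such a $u$ is $C^{1,+}$ (resp. $C^{1,-}$) in the space variable if $|\nabla_d u|$ is continuous on $(0,\infty)\times X$ and $|\nabla_d^{+}u|=|\nabla_d u|$ (resp. $|\nabla_d^{-}u|=|\nabla_d u|$) everywhere. Test functions. $\psi=\psi_1+\psi_2$ is a test function for subsolutions (resp. supersolutions) if $\psi_1,\psi_2:(0,\infty)\times X\to\mathbb{R}$ are locally Lipschitz and $C^1$ in time (the derivatives $\partial_t\psi_1,\partial_t\psi_2$ exist and are continuous on $(0,\infty)\times X$), and $\psi_1$ is $C^{1,-}$ (resp. $C^{1,+}$) in the space variable. Envelopes and modified Hamiltonians. $u^*$, $u_*$ are the upper and lower semicontinuous envelopes of $u$ on $(0,\infty)\times X$; $|\nabla_d\psi|^*$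 is the upper semicontinuous envelope of $|\nabla_d\psi|$ on $(0,\infty)\times X$. For subsolutions $u^*$ is understood to be real-valued, for supersolutions $u_*$ is. For $a\ge0$, $H_a(t,x,u,p)=\inf\{H(t,x,u,p'):p'\ge0,|p'-p|\le a\}$ and $H^a(t,x,u,p)=\sup\{H(t,x,u,p'):p'\ge0,|p'-p|\le a\}$. Metric viscosity solutions of $\partial_t u+H(t,x,u,|\nabla_d u|)=0$ on $(0,\infty)\times X$. $u:(0,\infty)\times X\to\mathbb{R}$ is a metric viscosity subsolution if, for every test function $\psi=\psi_1+\psi_2$ for subsolutions such that $u^*-\psi$ attains a local maximum at $\hat z=(\hat t,\hat x)$, one has $\partial_t\psi(\hat z)+H_{|\nabla_d\psi_2|^*(\hat z)}(\hat z,u^*(\hat z),|\nabla_d\psi_1|(\hat z))\le0$. It is a metric viscosity supersolution if, for every test function $\psi=\psi_1+\psi_2$ for supersolutions such that $u_*-\psi$ attains a local minimum at $\hat z$, one has $\partial_t\psi(\hat z)+H^{|\nabla_d\psi_2|^*(\hat z)}(\hat z,u_*(\hat z),|\nabla_d\psi_1|(\hat z))\ge0$. *)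

theory Defs
  imports "HOL-Analysis.Analysis" "HOL-Library.Extended_Nat"
begin

section \<open>Intrinsic metrics and geodesic spaces\<close>

definition curve_length :: "(real \<Rightarrow> 'a::metric_space) \<Rightarrow> ereal" where
  "curve_length \<gamma> =
     (SUP (k, s) \<in> {(k::nat, s::nat \<Rightarrow> real). s 0 = 0 \<and> s k = 1 \<and> (\<forall>i<k. s i \<le> s (Suc i))}.
        ereal (\<Sum>i<k. dist (\<gamma> (s i)) (\<gamma> (s (Suc i)))))"

definition length_dist :: "'a::metric_space set \<Rightarrow> 'a \<Rightarrow> 'a \<Rightarrow> ereal" where
  "length_dist A x y =
     (INF \<gamma> \<in> {\<gamma>. path \<gamma> \<and> path_image \<gamma> \<subseteq> A \<and> pathstart \<gamma> = x \<and> pathfinish \<gamma> = y}. curve_length \<gamma>)"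

text \<open>Real-valued version; meaningful when \<^const>\<open>length_dist\<close> is finite on \<open>A\<close>.\<close>

definition intrinsic_metric :: "'a::metric_space set \<Rightarrow> 'a \<Rightarrow> 'a \<Rightarrow> real" where
  "intrinsic_metric A x y = real_of_ereal (length_dist A x y)"

definition complete_geodesic_space :: "'a set \<Rightarrow> ('a \<Rightarrow> 'a \<Rightarrow> real) \<Rightarrow> bool" where
  "complete_geodesic_space M d \<longleftrightarrow>
     Metric_space M d \<and> Metric_space.mcomplete M d \<and>
     (\<forall>x\<in>M. \<forall>y\<in>M. \<exists>\<gamma>::real \<Rightarrow> 'a. \<gamma> 0 = x \<and> \<gamma> (d x y) = y \<and> \<gamma> ` {0..d x y} \<subseteq> M \<and>
        (\<forall>r\<in>{0..d x y}. \<forall>s\<in>{0..d x y}. d (\<gamma> r) (\<gamma> s) = \<bar>r - s\<bar>))"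

section \<open>Functions on \<open>(0,\<infinity>) \<times> M\<close>\<close>

text \<open>Functions on \<open>(0,\<infinity>) \<times> M\<close> are total functions on pairs; every notion below only
  uses their values on \<open>(0,\<infinity>) \<times> M\<close>.\<close>

definition spacetime :: "'a set \<Rightarrow> ('a \<Rightarrow> 'a \<Rightarrow> real) \<Rightarrow> (real \<times> 'a) topology" where
  "spacetime M d = prod_topology (top_of_set {0<..}) (Metric_space.mtopology M d)"

definition locally_lipschitz :: "'a set \<Rightarrow> ('a \<Rightarrow> 'a \<Rightarrow> real) \<Rightarrow> (real \<times> 'a \<Rightarrow> real) \<Rightarrow> bool" where
  "locally_lipschitz M d u \<longleftrightarrow>
     (\<forall>z\<in>{0<..} \<times> M. \<exists>U L. openin (spacetime M d) U \<and> z \<in> U \<and>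
        (\<forall>(t, x)\<in>U. \<forall>(s, y)\<in>U. \<bar>u (t, x) - u (s, y)\<bar> \<le> L * (\<bar>t - s\<bar> + d x y)))"

text \<open>The upper limit runs over \<open>y \<rightarrow> x\<close> with \<open>y \<noteq> x\<close>; it is finite for locally Lipschitz \<open>u\<close>.\<close>

definition slope_with ::
  "(real \<Rightarrow> real) \<Rightarrow> 'a set \<Rightarrow> ('a \<Rightarrow> 'a \<Rightarrow> real) \<Rightarrow> (real \<times> 'a \<Rightarrow> real) \<Rightarrow> real \<times> 'a \<Rightarrow> real" where
  "slope_with \<phi> M d u = (\<lambda>(t, x).
     if openin (Metric_space.mtopology M d) {x} then 0
     else real_of_ereal (Limsup (atin (Metric_space.mtopology M d) x)
            (\<lambda>y. ereal (\<phi> (u (t, y) - u (t, x)) / d x y))))"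

definition slope ::
  "'a set \<Rightarrow> ('a \<Rightarrow> 'a \<Rightarrow> real) \<Rightarrow> (real \<times> 'a \<Rightarrow> real) \<Rightarrow> real \<times> 'a \<Rightarrow> real" where
  "slope = slope_with (\<lambda>a. \<bar>a\<bar>)"

definition slope_plus ::
  "'a set \<Rightarrow> ('a \<Rightarrow> 'a \<Rightarrow> real) \<Rightarrow> (real \<times> 'a \<Rightarrow> real) \<Rightarrow> real \<times> 'a \<Rightarrow> real" where
  "slope_plus = slope_with (\<lambda>a. max a 0)"

definition slope_minus ::
  "'a set \<Rightarrow> ('a \<Rightarrow> 'a \<Rightarrow> real) \<Rightarrow> (real \<times> 'a \<Rightarrow> real) \<Rightarrow> real \<times> 'a \<Rightarrow> real" where
  "slope_minus = slope_with (\<lambda>a. max (- a) 0)"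

definition C1_plus :: "'a set \<Rightarrow> ('a \<Rightarrow> 'a \<Rightarrow> real) \<Rightarrow> (real \<times> 'a \<Rightarrow> real) \<Rightarrow> bool" where
  "C1_plus M d u \<longleftrightarrow> locally_lipschitz M d u \<and>
     continuous_map (spacetime M d) euclideanreal (slope M d u) \<and>
     (\<forall>z\<in>{0<..} \<times> M. slope_plus M d u z = slope M d u z)"

definition C1_minus :: "'a set \<Rightarrow> ('a \<Rightarrow> 'a \<Rightarrow> real) \<Rightarrow> (real \<times> 'a \<Rightarrow> real) \<Rightarrow> bool" where
  "C1_minus M d u \<longleftrightarrow> locally_lipschitz M d u \<and>
     continuous_map (spacetime M d) euclideanreal (slope M d u) \<and>
     (\<forall>z\<in>{0<..} \<times> M. slope_minus M d u z = slope M d u z)"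

definition time_deriv :: "(real \<times> 'a \<Rightarrow> real) \<Rightarrow> real \<times> 'a \<Rightarrow> real" where
  "time_deriv u = (\<lambda>(t, x). deriv (\<lambda>s. u (s, x)) t)"

definition C1_in_time :: "'a set \<Rightarrow> ('a \<Rightarrow> 'a \<Rightarrow> real) \<Rightarrow> (real \<times> 'a \<Rightarrow> real) \<Rightarrow> bool" where
  "C1_in_time M d u \<longleftrightarrow>
     (\<forall>t>0. \<forall>x\<in>M. (\<lambda>s. u (s, x)) field_differentiable (at t)) \<and>
     continuous_map (spacetime M d) euclideanreal (time_deriv u)"

text \<open>A test function \<open>\<psi> = \<psi>\<^sub>1 + \<psi>\<^sub>2\<close> is handled through its decomposition \<open>(\<psi>\<^sub>1, \<psi>\<^sub>2)\<close>, on which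
  the viscosity inequalities depend.\<close>

definition sub_test ::
  "'a set \<Rightarrow> ('a \<Rightarrow> 'a \<Rightarrow> real) \<Rightarrow> (real \<times> 'a \<Rightarrow> real) \<Rightarrow> (real \<times> 'a \<Rightarrow> real) \<Rightarrow> bool" where
  "sub_test M d \<psi>1 \<psi>2 \<longleftrightarrow> locally_lipschitz M d \<psi>1 \<and> locally_lipschitz M d \<psi>2 \<and>
     C1_in_time M d \<psi>1 \<and> C1_in_time M d \<psi>2 \<and> C1_minus M d \<psi>1"

definition super_test ::
  "'a set \<Rightarrow> ('a \<Rightarrow> 'a \<Rightarrow> real) \<Rightarrow> (real \<times> 'a \<Rightarrow> real) \<Rightarrow> (real \<times> 'a \<Rightarrow> real) \<Rightarrow> bool" where
  "super_test M d \<psi>1 \<psi>2 \<longleftrightarrow> locally_lipschitz M d \<psi>1 \<and> locally_lipschitz M d \<psi>2 \<and>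
     C1_in_time M d \<psi>1 \<and> C1_in_time M d \<psi>2 \<and> C1_plus M d \<psi>1"

section \<open>Semicontinuity and local extrema\<close>

definition usc :: "'b topology \<Rightarrow> ('b \<Rightarrow> real) \<Rightarrow> bool" where
  "usc T f \<longleftrightarrow> (\<forall>a. openin T {z \<in> topspace T. f z < a})"

definition lsc :: "'b topology \<Rightarrow> ('b \<Rightarrow> real) \<Rightarrow> bool" where
  "lsc T f \<longleftrightarrow> (\<forall>a. openin T {z \<in> topspace T. a < f z})"

text \<open>The filter \<^const>\<open>nhdsin\<close> is not punctured, so the value at the point itself counts.\<close>

definition usc_env :: "'b topology \<Rightarrow> ('b \<Rightarrow> real) \<Rightarrow> 'b \<Rightarrow> ereal" where
  "usc_env T f z = Limsup (nhdsin T z) (\<lambda>w. ereal (f w))"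

definition lsc_env :: "'b topology \<Rightarrow> ('b \<Rightarrow> real) \<Rightarrow> 'b \<Rightarrow> ereal" where
  "lsc_env T f z = Liminf (nhdsin T z) (\<lambda>w. ereal (f w))"

definition local_max_at :: "'b topology \<Rightarrow> ('b \<Rightarrow> real) \<Rightarrow> 'b \<Rightarrow> bool" where
  "local_max_at T f z \<longleftrightarrow> (\<exists>U. openin T U \<and> z \<in> U \<and> (\<forall>w\<in>U. f w \<le> f z))"

definition local_min_at :: "'b topology \<Rightarrow> ('b \<Rightarrow> real) \<Rightarrow> 'b \<Rightarrow> bool" where
  "local_min_at T f z \<longleftrightarrow> (\<exists>U. openin T U \<and> z \<in> U \<and> (\<forall>w\<in>U. f z \<le> f w))"

section \<open>Metric viscosity solutions\<close>

text \<open>No regularity of \<open>H\<close> is assumed, so the modified Hamiltonians may take infinite values.\<close>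

definition H_lower ::
  "(real \<Rightarrow> 'a \<Rightarrow> real \<Rightarrow> real \<Rightarrow> real) \<Rightarrow> real \<Rightarrow> real \<Rightarrow> 'a \<Rightarrow> real \<Rightarrow> real \<Rightarrow> ereal" where
  "H_lower H a t x r p = (INF p' \<in> {p'. 0 \<le> p' \<and> \<bar>p' - p\<bar> \<le> a}. ereal (H t x r p'))"

definition H_upper ::
  "(real \<Rightarrow> 'a \<Rightarrow> real \<Rightarrow> real \<Rightarrow> real) \<Rightarrow> real \<Rightarrow> real \<Rightarrow> 'a \<Rightarrow> real \<Rightarrow> real \<Rightarrow> ereal" where
  "H_upper H a t x r p = (SUP p' \<in> {p'. 0 \<le> p' \<and> \<bar>p' - p\<bar> \<le> a}. ereal (H t x r p'))"

text \<open>The envelopes of \<open>u\<close> are required to be real-valued; the envelope of the slope of \<open>\<psi>\<^sub>2\<close>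
  is finite because \<open>\<psi>\<^sub>2\<close> is locally Lipschitz.\<close>

definition metric_viscosity_subsolution ::
  "'a set \<Rightarrow> ('a \<Rightarrow> 'a \<Rightarrow> real) \<Rightarrow> (real \<Rightarrow> 'a \<Rightarrow> real \<Rightarrow> real \<Rightarrow> real) \<Rightarrow> (real \<times> 'a \<Rightarrow> real) \<Rightarrow> bool" where
  "metric_viscosity_subsolution M d H u \<longleftrightarrow>
     (\<forall>z\<in>{0<..} \<times> M. \<bar>usc_env (spacetime M d) u z\<bar> \<noteq> \<infinity>) \<and>
     (\<forall>\<psi>1 \<psi>2. sub_test M d \<psi>1 \<psi>2 \<longrightarrow>
       (\<forall>t>0. \<forall>x\<in>M.
          local_max_at (spacetime M d)
            (\<lambda>z. real_of_ereal (usc_env (spacetime M d) u z) - (\<psi>1 z + \<psi>2 z)) (t, x) \<longrightarrow>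
          ereal (time_deriv (\<lambda>z. \<psi>1 z + \<psi>2 z) (t, x)) +
            H_lower H (real_of_ereal (usc_env (spacetime M d) (slope M d \<psi>2) (t, x)))
              t x (real_of_ereal (usc_env (spacetime M d) u (t, x))) (slope M d \<psi>1 (t, x)) \<le> 0))"

definition metric_viscosity_supersolution ::
  "'a set \<Rightarrow> ('a \<Rightarrow> 'a \<Rightarrow> real) \<Rightarrow> (real \<Rightarrow> 'a \<Rightarrow> real \<Rightarrow> real \<Rightarrow> real) \<Rightarrow> (real \<times> 'a \<Rightarrow> real) \<Rightarrow> bool" where
  "metric_viscosity_supersolution M d H u \<longleftrightarrow>
     (\<forall>z\<in>{0<..} \<times> M. \<bar>lsc_env (spacetime M d) u z\<bar> \<noteq> \<infinity>) \<and>
     (\<forall>\<psi>1 \<psi>2. super_test M d \<psi>1 \<psi>2 \<longrightarrow>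
       (\<forall>t>0. \<forall>x\<in>M.
          local_min_at (spacetime M d)
            (\<lambda>z. real_of_ereal (lsc_env (spacetime M d) u z) - (\<psi>1 z + \<psi>2 z)) (t, x) \<longrightarrow>
          ereal (time_deriv (\<lambda>z. \<psi>1 z + \<psi>2 z) (t, x)) +
            H_upper H (real_of_ereal (usc_env (spacetime M d) (slope M d \<psi>2) (t, x)))
              t x (real_of_ereal (lsc_env (spacetime M d) u (t, x))) (slope M d \<psi>1 (t, x)) \<ge> 0))"

section \<open>Semilimits along converging spaces\<close>

definition approx_seqs :: "(enat \<Rightarrow> 'a::metric_space set) \<Rightarrow> 'a \<Rightarrow> (nat \<Rightarrow> 'a) set" where
  "approx_seqs X x = {xs. (\<forall>n. xs n \<in> X (enat n)) \<and> xs \<longlonglongrightarrow> x}"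

definition time_seqs :: "real \<Rightarrow> (nat \<Rightarrow> real) set" where
  "time_seqs t = {ts. (\<forall>n. 0 < ts n) \<and> ts \<longlonglongrightarrow> t}"

definition upper_semilimit ::
  "(enat \<Rightarrow> 'a::metric_space set) \<Rightarrow> (nat \<Rightarrow> real \<times> 'a \<Rightarrow> real) \<Rightarrow> real \<times> 'a \<Rightarrow> ereal" where
  "upper_semilimit X u = (\<lambda>(t, x).
     SUP (ts, xs) \<in> time_seqs t \<times> approx_seqs X x. limsup (\<lambda>n. ereal (u n (ts n, xs n))))"

definition lower_semilimit ::
  "(enat \<Rightarrow> 'a::metric_space set) \<Rightarrow> (nat \<Rightarrow> real \<times> 'a \<Rightarrow> real) \<Rightarrow> real \<times> 'a \<Rightarrow> ereal" where
  "lower_semilimit X u = (\<lambda>(t, x).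
     INF (ts, xs) \<in> time_seqs t \<times> approx_seqs X x. liminf (\<lambda>n. ereal (u n (ts n, xs n))))"

end

theory Submission
  imports Defs
begin

text \<open>
  Test functions on \<open>X\<^sub>\<infinity>\<close> cannot be transplanted to \<open>X\<^sub>n\<close>, but distance functions can. Suppose
  \<open>u - \<psi>\<^sub>1 - \<psi>\<^sub>2\<close> has a local maximum at \<open>(t\<^sub>0, x\<^sub>0)\<close>, and let \<open>p\<close> be the slope of \<open>\<psi>\<^sub>1\<close> and
  \<open>a\<close> the envelope of the slope of \<open>\<psi>\<^sub>2\<close> there. Integrating slopes along geodesics, \<open>\<psi>\<^sub>2\<close> lies below
  a cone of opening \<open>a + \<epsilon>\<close> at \<open>x\<^sub>0\<close>, and \<open>\<psi>\<^sub>1\<close> lies below \<open>(p + \<epsilon>) d(x, y)\<close> up to a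
  constant, where \<open>y\<close> is a point at small distance \<open>r\<close> from \<open>x\<^sub>0\<close> that almost realises the descending
  slope; at \<open>x\<^sub>0\<close> the loss is only of order \<open>\<epsilon> r\<close>. Replacing \<open>d(x, y)\<close> by
  \<open>d(x, y)\<^sup>2 / (2 r) + r / 2\<close>, which is larger by AM-GM and equal at \<open>x\<^sub>0\<close>, gives a
  \<open>C\<^sup>1\<^sup>,\<^sup>-\<close> function. With penalties of size \<open>\<delta>\<close>, where \<open>\<epsilon> = \<delta>\<^sup>2 / 32\<close>, the resulting paraboloid
  touches \<open>u\<close> near \<open>(t\<^sub>0, x\<^sub>0)\<close>, and so does its analogue built from \<open>d\<^sub>n\<close> for \<open>u\<^sup>n\<close>. Since
  \<open>(X\<^sub>n, d\<^sub>n)\<close> need not be compact, the maximum on \<open>X\<^sub>n\<close> is produced by Ekeland's principle, whose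
  perturbation \<open>\<delta> d\<^sub>n(\<cdot>, x')\<close> is absorbed in \<open>\<psi>\<^sub>2\<close>. Letting \<open>\<delta> \<rightarrow> 0\<close> along a diagonal sequence
  gives the inequality on \<open>X\<^sub>\<infinity>\<close>. Supersolutions are negatives of subsolutions for
  \<open>- H(t, x, - r, p)\<close>.
\<close>

section \<open>Slopes and envelopes in a metric space\<close>

context Metric_space
begin

section \<open>Neighbourhoods in space-time and punctured neighbourhoods in space\<close>

lemma topspace_spacetime [simp]: "topspace (spacetime M d) = {0<..} \<times> M"
  by (simp add: spacetime_def)

text \<open>A product of a time neighbourhood and a ball contains a cylinder with one common radius,
  the smaller of the two. Envelopes, continuity and local maxima are later unfolded through this
  single radius.\<close>

lemma openin_spacetime:
  "openin (spacetime M d) U \<longleftrightarrow> U \<subseteq> {0<..} \<times> M \<and>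
     (\<forall>t x. (t, x) \<in> U \<longrightarrow>
        (\<exists>r>0. \<forall>s>0. \<forall>y\<in>M. \<bar>s - t\<bar> < r \<longrightarrow> d x y < r \<longrightarrow> (s, y) \<in> U))" (is "?L \<longleftrightarrow> ?R")
proof
  assume L: ?L
  have "\<exists>r>0. \<forall>s>0. \<forall>y\<in>M. \<bar>s - t\<bar> < r \<longrightarrow> d x y < r \<longrightarrow> (s, y) \<in> U"
    if tx: "(t, x) \<in> U" for t x
  proof -
    have "\<exists>A B. openin (top_of_set {0<..}) A \<and> openin mtopology B \<and> t \<in> A \<and> x \<in> B \<and> A \<times> B \<subseteq> U"
      using L[unfolded spacetime_def openin_prod_topology_alt, THEN spec, THEN spec, THEN mp, OF tx] .
    then obtain A B where AB: "openin (top_of_set {0<..}) A" "openin mtopology B" "t \<in> A" "x \<in> B"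
      "A \<times> B \<subseteq> U"
      by (elim exE conjE)
    from AB(1,3) obtain r1 where r1: "r1 > 0" "\<And>s. s > 0 \<Longrightarrow> \<bar>s - t\<bar> < r1 \<Longrightarrow> s \<in> A"
      by (auto simp: openin_euclidean_subtopology_iff dist_real_def)
    from AB(2,4) obtain r2 where r2: "r2 > 0" "mball x r2 \<subseteq> B" "B \<subseteq> M"
      by (auto simp: openin_mtopology)
    have "(s, y) \<in> U" if "s > 0" "y \<in> M" "\<bar>s - t\<bar> < min r1 r2" "d x y < min r1 r2" for s y
    proof -
      have "s \<in> A" using r1 that by auto
      have "y \<in> mball x r2" using that subsetD[OF r2(3) AB(4)] by simp
      then have "y \<in> B" using r2(2) by (rule subsetD[rotated])
      with \<open>s \<in> A\<close> show ?thesis using AB(5) by auto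
    qed
    then show ?thesis using r1(1) r2(1) by (intro exI[of _ "min r1 r2"]) auto
  qed
  moreover have "U \<subseteq> {0<..} \<times> M" using openin_subset[OF L] by simp
  ultimately show ?R by blast
next
  assume R: ?R
  show ?L unfolding spacetime_def openin_prod_topology_alt
  proof (intro allI impI)
    fix t x assume tx: "(t, x) \<in> U"
    then obtain r where r: "r > 0"
      "\<And>s y. s>0 \<Longrightarrow> y\<in>M \<Longrightarrow> \<bar>s - t\<bar> < r \<Longrightarrow> d x y < r \<Longrightarrow> (s, y) \<in> U" using R by metis
    have *: "t > 0" "x \<in> M" using R tx by auto
    have "openin (top_of_set {0<..}) ({0<..} \<inter> ball t r)"
      by (simp add: openin_open_Int)
    moreover have "({0<..} \<inter> ball t r) \<times> mball x r \<subseteq> U"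
      using r(2) by (auto simp: dist_real_def abs_minus_commute)
    ultimately show "\<exists>A B. openin (top_of_set {0<..}) A \<and> openin mtopology B \<and> t \<in> A \<and> x \<in> B \<and> A \<times> B \<subseteq> U"
      using * r(1) by (intro exI[of _ "{0<..} \<inter> ball t r"] exI[of _ "mball x r"]) auto
  qed
qed

lemma openin_spacetime_cylinder:
  assumes "x0 \<in> M"
  shows "openin (spacetime M d) {(s, y). 0 < s \<and> y \<in> M \<and> \<bar>s - t0\<bar> < r \<and> d x0 y < r}"
  unfolding openin_spacetime
proof (intro conjI allI impI)
  fix t x assume "(t, x) \<in> {(s, y). 0 < s \<and> y \<in> M \<and> \<bar>s - t0\<bar> < r \<and> d x0 y < r}"
  then have tx: "0 < t" "x \<in> M" "\<bar>t - t0\<bar> < r" "d x0 x < r" by auto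
  have "\<bar>s - t0\<bar> < r \<and> d x0 y < r"
    if *: "y \<in> M" "\<bar>s - t\<bar> < min (r - \<bar>t - t0\<bar>) (r - d x0 x)" "d x y < min (r - \<bar>t - t0\<bar>) (r - d x0 x)"
    for s y
  proof
    show "\<bar>s - t0\<bar> < r" using *(2) abs_triangle_ineq[of "s - t" "t - t0"] by linarith
    show "d x0 y < r" using *(1,3) triangle[OF assms tx(2) *(1)] by linarith
  qed
  then show "\<exists>q>0. \<forall>s>0. \<forall>y\<in>M. \<bar>s - t\<bar> < q \<longrightarrow> d x y < q \<longrightarrow>
      (s, y) \<in> {(s, y). 0 < s \<and> y \<in> M \<and> \<bar>s - t0\<bar> < r \<and> d x0 y < r}"
    using tx by (intro exI[of _ "min (r - \<bar>t - t0\<bar>) (r - d x0 x)"]) simp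
qed auto

lemma eventually_nhdsin_spacetime:
  assumes "0 < t" "x \<in> M"
  shows "eventually P (nhdsin (spacetime M d) (t, x)) \<longleftrightarrow>
    (\<exists>r>0. \<forall>s>0. \<forall>y\<in>M. \<bar>s - t\<bar> < r \<longrightarrow> d x y < r \<longrightarrow> P (s, y))" (is "?L \<longleftrightarrow> ?R")
proof
  assume ?L
  then obtain S where "openin (spacetime M d) S" "(t, x) \<in> S" "\<forall>w\<in>S. P w"
    using assms by (auto simp: eventually_nhdsin)
  then have "\<exists>r>0. \<forall>s>0. \<forall>y\<in>M. \<bar>s - t\<bar> < r \<longrightarrow> d x y < r \<longrightarrow> (s, y) \<in> S"
    unfolding openin_spacetime by blast
  then show ?R using \<open>\<forall>w\<in>S. P w\<close> by blast
next
  assume ?R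
  then obtain r where r: "r > 0"
    "\<And>s y. s>0 \<Longrightarrow> y\<in>M \<Longrightarrow> \<bar>s - t\<bar> < r \<Longrightarrow> d x y < r \<Longrightarrow> P (s, y)" by metis
  show ?L unfolding eventually_nhdsin
    using openin_spacetime_cylinder[OF assms(2), of t r] r assms
    by (intro disjI2 exI[of _ "{(s, y). 0 < s \<and> y \<in> M \<and> \<bar>s - t\<bar> < r \<and> d x y < r}"]) auto
qed

lemma nhdsin_spacetime_neq_bot: "0 < t \<Longrightarrow> x \<in> M \<Longrightarrow> nhdsin (spacetime M d) (t, x) \<noteq> bot"
  unfolding trivial_limit_def eventually_nhdsin_spacetime by (auto intro!: bexI[of _ x])

text \<open>The puncture is expressed by \<open>0 < d x y\<close>, so that difference quotients have
  positive denominators.\<close>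

lemma eventually_atin_mtopology:
  assumes "x \<in> M"
  shows "eventually P (atin mtopology x) \<longleftrightarrow> (\<exists>r>0. \<forall>y\<in>M. 0 < d x y \<longrightarrow> d x y < r \<longrightarrow> P y)"
    (is "?L \<longleftrightarrow> ?R")
proof
  assume ?L
  then obtain S where "openin mtopology S" "x \<in> S" "\<forall>w\<in>S - {x}. P w"
    using assms by (auto simp: eventually_atin)
  then obtain r where "r > 0" "mball x r \<subseteq> S" by (auto simp: openin_mtopology)
  then show ?R using \<open>\<forall>w\<in>S - {x}. P w\<close> assms by (intro exI[of _ r]) (auto simp: subset_iff)
next
  assume ?R
  then obtain r where "r > 0" "\<forall>y\<in>M. 0 < d x y \<longrightarrow> d x y < r \<longrightarrow> P y" by blast
  then show ?L unfolding eventually_atin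
    using assms by (intro disjI2 exI[of _ "mball x r"]) auto
qed

text \<open>Separates the isolated points, where \<open>slope_with\<close> is 0 by convention, from
  the others, where a \<open>Limsup\<close> of nonnegative quotients is nonnegative because the
  filter is proper.\<close>

lemma atin_mtopology_eq_bot_iff:
  assumes "x \<in> M"
  shows "atin mtopology x = bot \<longleftrightarrow> openin mtopology {x}"
proof
  assume "atin mtopology x = bot"
  then have "eventually (\<lambda>_. False) (atin mtopology x)" by simp
  then obtain r where r: "r > 0" "\<forall>y\<in>M. 0 < d x y \<longrightarrow> d x y < r \<longrightarrow> False"
    unfolding eventually_atin_mtopology[OF assms] by blast
  have "mball x r \<subseteq> {x}"
  proof
    fix y assume "y \<in> mball x r"
    then show "y \<in> {x}" using r(2) mdist_pos_less[of x y] assms by (metis in_mball singleton_iff)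
  qed
  then show "openin mtopology {x}" using assms r(1) by (auto simp: openin_mtopology)
next
  assume "openin mtopology {x}"
  then have "eventually (\<lambda>_. False) (atin mtopology x)"
    unfolding eventually_atin by auto
  then show "atin mtopology x = bot" by (simp add: trivial_limit_def)
qed

section \<open>Slopes as optimal local Lipschitz constants\<close>

text \<open>The bound on the quotients passes to the \<open>Limsup\<close>, which thus lies in
  \<open>[0, K]\<close>; being finite, it survives \<open>real_of_ereal\<close>. At an isolated
  point the default value 0 satisfies both inequalities since \<open>0 \<le> K\<close>.\<close>

lemma slope_with_le:
  assumes "x \<in> M" "0 \<le> K" "\<And>a. 0 \<le> \<phi> a"
    and "\<exists>r>0. \<forall>y\<in>M. 0 < d x y \<longrightarrow> d x y < r \<longrightarrow> \<phi> (u (t, y) - u (t, x)) \<le> K * d x y"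
  shows "0 \<le> slope_with \<phi> M d u (t, x)" "slope_with \<phi> M d u (t, x) \<le> K"
proof -
  let ?L = "Limsup (atin mtopology x) (\<lambda>y. ereal (\<phi> (u (t, y) - u (t, x)) / d x y))"
  have "0 \<le> slope_with \<phi> M d u (t, x) \<and> slope_with \<phi> M d u (t, x) \<le> K"
  proof (cases "openin mtopology {x}")
    case True
    then show ?thesis using assms by (simp add: slope_with_def)
  next
    case False
    have 1: "?L \<le> ereal K"
    proof (rule Limsup_bounded)
      show "\<forall>\<^sub>F y in atin mtopology x. ereal (\<phi> (u (t, y) - u (t, x)) / d x y) \<le> ereal K"
        unfolding eventually_atin_mtopology[OF assms(1)] using assms(4)
        by (auto simp: divide_le_eq)
    qed
    have 2: "0 \<le> ?L"
      by (rule le_Limsup)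
        (use False assms in \<open>auto simp: atin_mtopology_eq_bot_iff intro!: always_eventually divide_nonneg_nonneg\<close>)
    show ?thesis using 1 2 False
      by (cases ?L) (auto simp: slope_with_def)
  qed
  then show "0 \<le> slope_with \<phi> M d u (t, x)" "slope_with \<phi> M d u (t, x) \<le> K" by auto
qed

text \<open>The a priori bound with \<open>K0\<close> makes the \<open>Limsup\<close> finite. An
  infinite one would be turned into 0 by \<open>real_of_ereal\<close>, and a small slope would then
  say nothing about the quotients.\<close>

lemma slope_with_lessD:
  assumes "x \<in> M" "\<And>a. 0 \<le> \<phi> a" "\<phi> 0 = 0"
    and bound: "\<exists>r>0. \<forall>y\<in>M. 0 < d x y \<longrightarrow> d x y < r \<longrightarrow> \<phi> (u (t, y) - u (t, x)) \<le> K0 * d x y"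
    and less: "slope_with \<phi> M d u (t, x) < K"
  shows "\<exists>r>0. \<forall>y\<in>M. d x y < r \<longrightarrow> \<phi> (u (t, y) - u (t, x)) \<le> K * d x y"
proof -
  let ?L = "Limsup (atin mtopology x) (\<lambda>y. ereal (\<phi> (u (t, y) - u (t, x)) / d x y))"
  have "\<forall>\<^sub>F y in atin mtopology x. \<phi> (u (t, y) - u (t, x)) \<le> K * d x y"
  proof (cases "openin mtopology {x}")
    case True
    then have "atin mtopology x = bot" using atin_mtopology_eq_bot_iff assms(1) by blast
    then show ?thesis by simp
  next
    case False
    have 1: "?L \<le> ereal K0"
    proof (rule Limsup_bounded)
      show "\<forall>\<^sub>F y in atin mtopology x. ereal (\<phi> (u (t, y) - u (t, x)) / d x y) \<le> ereal K0"
        unfolding eventually_atin_mtopology[OF assms(1)] using bound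
        by (auto simp: divide_le_eq)
    qed
    have 2: "0 \<le> ?L"
      by (rule le_Limsup)
        (use False assms in \<open>auto simp: atin_mtopology_eq_bot_iff intro!: always_eventually divide_nonneg_nonneg\<close>)
    have "?L < ereal K" using 1 2 False less
      by (cases ?L) (auto simp: slope_with_def)
    from Limsup_lessD[OF this] show ?thesis
      unfolding eventually_atin_mtopology[OF assms(1)] by (fastforce simp: divide_less_eq)
  qed
  then obtain r where "r > 0" "\<forall>y\<in>M. 0 < d x y \<longrightarrow> d x y < r \<longrightarrow> \<phi> (u (t, y) - u (t, x)) \<le> K * d x y"
    unfolding eventually_atin_mtopology[OF assms(1)] by blast
  moreover have "\<phi> (u (t, y) - u (t, x)) \<le> K * d x y" if "y \<in> M" "\<not> 0 < d x y" for y
    using that assms by auto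
  ultimately show ?thesis by metis
qed

text \<open>Contraposition of \<open>slope_with_le\<close>. It supplies points in an almost steepest
  direction arbitrarily close to \<open>x\<close>.\<close>

lemma slope_with_lessE:
  assumes "x \<in> M" "\<And>a. 0 \<le> \<phi> a" "0 \<le> K" "K < slope_with \<phi> M d u (t, x)" "0 < r"
  obtains y where "y \<in> M" "0 < d x y" "d x y < r" "K * d x y < \<phi> (u (t, y) - u (t, x))"
proof (rule ccontr)
  assume "\<not> thesis"
  then have "\<forall>y\<in>M. 0 < d x y \<longrightarrow> d x y < r \<longrightarrow> \<phi> (u (t, y) - u (t, x)) \<le> K * d x y"
    using that by force
  then have "slope_with \<phi> M d u (t, x) \<le> K"
    by (intro slope_with_le(2) assms exI[of _ r] conjI)
  then show False using assms(4) by simp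
qed

text \<open>Otherwise some \<open>K' < K\<close> lies strictly above the slope and bounds all nearby
  quotients, against the points supplied by \<open>ge\<close>.\<close>

lemma slope_with_ge:
  assumes "x \<in> M" "\<And>a. 0 \<le> \<phi> a" "\<phi> 0 = 0"
    and "\<exists>r>0. \<forall>y\<in>M. 0 < d x y \<longrightarrow> d x y < r \<longrightarrow> \<phi> (u (t, y) - u (t, x)) \<le> K0 * d x y"
    and ge: "\<And>r. 0 < r \<Longrightarrow> \<exists>y\<in>M. 0 < d x y \<and> d x y < r \<and> K * d x y \<le> \<phi> (u (t, y) - u (t, x))"
  shows "K \<le> slope_with \<phi> M d u (t, x)"
proof (rule ccontr)
  assume "\<not> K \<le> slope_with \<phi> M d u (t, x)"
  then obtain K' where K': "slope_with \<phi> M d u (t, x) < K'" "K' < K"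
    by (meson dense not_le)
  obtain r where r: "r > 0" "\<forall>y\<in>M. d x y < r \<longrightarrow> \<phi> (u (t, y) - u (t, x)) \<le> K' * d x y"
    using slope_with_lessD[of x \<phi> u t K0 K'] assms K' by blast
  obtain y where y: "y \<in> M" "0 < d x y" "d x y < r" "K * d x y \<le> \<phi> (u (t, y) - u (t, x))"
    using ge r(1) by blast
  have "K' * d x y < K * d x y" using K' y(2) by simp
  moreover have "\<phi> (u (t, y) - u (t, x)) \<le> K' * d x y" using r(2) y by blast
  ultimately show False using y(4) by simp
qed

section \<open>Finiteness of the slopes of locally Lipschitz functions\<close>

lemma locally_lipschitzE:
  assumes "locally_lipschitz M d u" "0 < t" "x \<in> M"
  obtains L r where "0 \<le> L" "0 < r"
    "\<And>s y s' y'. 0 < s \<Longrightarrow> y \<in> M \<Longrightarrow> \<bar>s - t\<bar> < r \<Longrightarrow> d x y < r \<Longrightarrow>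
       0 < s' \<Longrightarrow> y' \<in> M \<Longrightarrow> \<bar>s' - t\<bar> < r \<Longrightarrow> d x y' < r \<Longrightarrow>
       \<bar>u (s, y) - u (s', y')\<bar> \<le> L * (\<bar>s - s'\<bar> + d y y')"
proof -
  obtain U L where U: "openin (spacetime M d) U" "(t, x) \<in> U"
    "\<forall>(t, x)\<in>U. \<forall>(s, y)\<in>U. \<bar>u (t, x) - u (s, y)\<bar> \<le> L * (\<bar>t - s\<bar> + d x y)"
    using assms unfolding locally_lipschitz_def by blast
  from U(1,2) obtain r where r: "r > 0"
    "\<And>s y. s>0 \<Longrightarrow> y\<in>M \<Longrightarrow> \<bar>s - t\<bar> < r \<Longrightarrow> d x y < r \<Longrightarrow> (s, y) \<in> U"
    unfolding openin_spacetime by metis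
  show ?thesis
  \<comment> \<open>The definition allows a negative constant, hence \<open>max L 0\<close>.\<close>
  proof (rule that[of "max L 0" r])
    fix s y s' y'
    assume a: "0 < s" "y \<in> M" "\<bar>s - t\<bar> < r" "d x y < r" "0 < s'" "y' \<in> M" "\<bar>s' - t\<bar> < r" "d x y' < r"
    have "(s, y) \<in> U" "(s', y') \<in> U" using a r(2) by auto
    then have "\<bar>u (s, y) - u (s', y')\<bar> \<le> L * (\<bar>s - s'\<bar> + d y y')" using U(3) by blast
    also have "\<dots> \<le> max L 0 * (\<bar>s - s'\<bar> + d y y')"
      by (intro mult_right_mono) auto
    finally show "\<bar>u (s, y) - u (s', y')\<bar> \<le> max L 0 * (\<bar>s - s'\<bar> + d y y')" .
  qed (use r in auto)
qed

text \<open>One constant serves for all centres in a cylinder, which is what the envelope of the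
  slope requires. The condition \<open>\<phi> a \<le> \<bar>a\<bar>\<close> covers the slope and
  both one-sided slopes at once.\<close>

lemma locally_lipschitz_slope_bound:
  assumes "locally_lipschitz M d u" "0 < t" "x \<in> M" "\<And>a. \<phi> a \<le> \<bar>a\<bar>"
  obtains L r where "0 \<le> L" "0 < r" "\<forall>s>0. \<forall>z\<in>M. \<bar>s - t\<bar> < r \<longrightarrow> d x z < r \<longrightarrow>
    (\<exists>r>0. \<forall>y\<in>M. 0 < d z y \<longrightarrow> d z y < r \<longrightarrow> \<phi> (u (s, y) - u (s, z)) \<le> L * d z y)"
proof -
  obtain L r where Lr: "0 \<le> L" "0 < r"
    "\<And>s y s' y'. 0 < s \<Longrightarrow> y \<in> M \<Longrightarrow> \<bar>s - t\<bar> < r \<Longrightarrow> d x y < r \<Longrightarrow>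
       0 < s' \<Longrightarrow> y' \<in> M \<Longrightarrow> \<bar>s' - t\<bar> < r \<Longrightarrow> d x y' < r \<Longrightarrow>
       \<bar>u (s, y) - u (s', y')\<bar> \<le> L * (\<bar>s - s'\<bar> + d y y')"
    using locally_lipschitzE[OF assms(1-3)] by metis
  have "\<exists>q>0. \<forall>y\<in>M. 0 < d z y \<longrightarrow> d z y < q \<longrightarrow> \<phi> (u (s, y) - u (s, z)) \<le> L * d z y"
    if z: "s > 0" "z \<in> M" "\<bar>s - t\<bar> < r" "d x z < r" for s z
  \<comment> \<open>With this radius the triangle inequality keeps \<open>y\<close> in the cylinder
    where the Lipschitz estimate holds.\<close>
  proof (intro exI[of _ "r - d x z"] conjI ballI impI)
    show "0 < r - d x z" using z by simp
    fix y assume y: "y \<in> M" "0 < d z y" "d z y < r - d x z"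
    have "d x y < r" using triangle[of x z y] y z assms(3) by simp
    then show "\<phi> (u (s, y) - u (s, z)) \<le> L * d z y"
      using Lr(3)[of s y s z] z y assms(4)[of "u (s, y) - u (s, z)"] by (simp add: commute)
  qed
  then show ?thesis using that Lr(1,2) by blast
qed

lemma slope_bound_at:
  assumes "locally_lipschitz M d u" "0 < t" "x \<in> M" "\<And>a. \<phi> a \<le> \<bar>a\<bar>"
  obtains L where "0 \<le> L"
    "\<exists>r>0. \<forall>y\<in>M. 0 < d x y \<longrightarrow> d x y < r \<longrightarrow> \<phi> (u (t, y) - u (t, x)) \<le> L * d x y"
proof -
  obtain L r where *: "0 \<le> L" "0 < r" "\<forall>s>0. \<forall>z\<in>M. \<bar>s - t\<bar> < r \<longrightarrow> d x z < r \<longrightarrow>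
    (\<exists>r>0. \<forall>y\<in>M. 0 < d z y \<longrightarrow> d z y < r \<longrightarrow> \<phi> (u (s, y) - u (s, z)) \<le> L * d z y)"
    using locally_lipschitz_slope_bound[OF assms] by blast
  show ?thesis using *(1,2) *(3)[rule_format, of t x] assms(2,3) by (intro that[of L]) auto
qed

lemma slope_nonneg:
  assumes "locally_lipschitz M d u" "0 < t" "x \<in> M"
  shows "0 \<le> slope M d u (t, x)"
proof -
  obtain L where "0 \<le> L"
    "\<exists>r>0. \<forall>y\<in>M. 0 < d x y \<longrightarrow> d x y < r \<longrightarrow> \<bar>u (t, y) - u (t, x)\<bar> \<le> L * d x y"
    by (rule slope_bound_at[OF assms, of "\<lambda>a. \<bar>a\<bar>"]) auto
  then show ?thesis unfolding slope_def by (intro slope_with_le(1)[of x L] assms) auto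
qed

text \<open>Nearby slopes are bounded by one local Lipschitz constant. Hence
  \<open>real_of_ereal\<close> loses nothing when the envelope enters the viscosity
  inequality.\<close>

lemma usc_env_slope_finite:
  assumes "locally_lipschitz M d u" "0 < t" "x \<in> M"
  shows "0 \<le> usc_env (spacetime M d) (slope M d u) (t, x)"
    "usc_env (spacetime M d) (slope M d u) (t, x) < \<infinity>"
proof -
  obtain L r where *: "0 \<le> L" "0 < r" "\<forall>s>0. \<forall>z\<in>M. \<bar>s - t\<bar> < r \<longrightarrow> d x z < r \<longrightarrow>
    (\<exists>r>0. \<forall>y\<in>M. 0 < d z y \<longrightarrow> d z y < r \<longrightarrow> \<bar>u (s, y) - u (s, z)\<bar> \<le> L * d z y)"
    using locally_lipschitz_slope_bound[OF assms, of "\<lambda>a. \<bar>a\<bar>"] by auto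
  have le: "slope M d u (s, z) \<le> L" if "s > 0" "z \<in> M" "\<bar>s - t\<bar> < r" "d x z < r" for s z
    unfolding slope_def by (rule slope_with_le) (use that * in auto)
  have "usc_env (spacetime M d) (slope M d u) (t, x) \<le> ereal L"
    unfolding usc_env_def
    by (rule Limsup_bounded) (use le *(2) assms in \<open>auto simp: eventually_nhdsin_spacetime\<close>)
  then show "usc_env (spacetime M d) (slope M d u) (t, x) < \<infinity>" by (auto simp: less_top[symmetric])
  show "0 \<le> usc_env (spacetime M d) (slope M d u) (t, x)"
    unfolding usc_env_def
    by (rule le_Limsup)
      (use slope_nonneg[OF assms(1)] assms nhdsin_spacetime_neq_bot
        in \<open>auto simp: eventually_nhdsin_spacetime intro: exI[of _ 1]\<close>)
qed

section \<open>Upper semicontinuous envelopes\<close>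

lemma usc_env_lessD:
  assumes "0 < t" "x \<in> M" "usc_env (spacetime M d) f (t, x) < ereal b"
  shows "\<exists>r>0. \<forall>s>0. \<forall>y\<in>M. \<bar>s - t\<bar> < r \<longrightarrow> d x y < r \<longrightarrow> f (s, y) < b"
  using Limsup_lessD[OF assms(3)[unfolded usc_env_def]] assms(1,2)
  by (simp add: eventually_nhdsin_spacetime)

lemma usc_env_ge: "0 < t \<Longrightarrow> x \<in> M \<Longrightarrow> ereal (f (t, x)) \<le> usc_env (spacetime M d) f (t, x)"
proof (rule ccontr)
  assume "0 < t" "x \<in> M" "\<not> ereal (f (t, x)) \<le> usc_env (spacetime M d) f (t, x)"
  then obtain r where "r>0" "\<forall>s>0. \<forall>y\<in>M. \<bar>s - t\<bar> < r \<longrightarrow> d x y < r \<longrightarrow> f (s, y) < f (t, x)"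
    using usc_env_lessD[of t x f "f (t, x)"] by (auto simp: not_le)
  then show False using \<open>0 < t\<close> \<open>x \<in> M\<close> by fastforce
qed

lemma usc_env_le:
  assumes "0 < t" "x \<in> M" "\<exists>r>0. \<forall>s>0. \<forall>y\<in>M. \<bar>s - t\<bar> < r \<longrightarrow> d x y < r \<longrightarrow> f (s, y) \<le> b"
  shows "usc_env (spacetime M d) f (t, x) \<le> ereal b"
  unfolding usc_env_def
  by (rule Limsup_bounded) (use assms in \<open>auto simp: eventually_nhdsin_spacetime\<close>)

text \<open>An open cylinder on which \<open>f < b\<close> is a neighbourhood of each of its points,
  so the envelope is at most \<open>b\<close> on all of it. This is upper semicontinuity of the
  envelope, in the form used for Ekeland's principle.\<close>

lemma usc_env_usc:
  assumes "0 < t" "x \<in> M" "usc_env (spacetime M d) f (t, x) < ereal b"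
    and fin: "\<forall>z\<in>{0<..} \<times> M. \<bar>usc_env (spacetime M d) f z\<bar> \<noteq> \<infinity>"
  shows "\<exists>r>0. \<forall>s>0. \<forall>y\<in>M. \<bar>s - t\<bar> < r \<longrightarrow> d x y < r \<longrightarrow>
           real_of_ereal (usc_env (spacetime M d) f (s, y)) \<le> b"
proof -
  obtain r where r: "r > 0" "\<And>s y. s>0 \<Longrightarrow> y\<in>M \<Longrightarrow> \<bar>s - t\<bar> < r \<Longrightarrow> d x y < r \<Longrightarrow> f (s, y) < b"
    using usc_env_lessD[OF assms(1-3)] by metis
  have "real_of_ereal (usc_env (spacetime M d) f (s, y)) \<le> b"
    if a: "s > 0" "y \<in> M" "\<bar>s - t\<bar> < r" "d x y < r" for s y
  proof -
    let ?q = "min (r - \<bar>s - t\<bar>) (r - d x y)"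
    have "f (s', y') \<le> b" if *: "s' > 0" "y' \<in> M" "\<bar>s' - s\<bar> < ?q" "d y y' < ?q" for s' y'
    proof -
      have "\<bar>s' - t\<bar> < r" using *(3) abs_triangle_ineq[of "s' - s" "s - t"] by linarith
      moreover have "d x y' < r" using *(2,4) a triangle[of x y y'] assms(2) by simp
      ultimately show ?thesis using r(2)[of s' y'] * by simp
    qed
    then have "usc_env (spacetime M d) f (s, y) \<le> ereal b"
      using a by (intro usc_env_le exI[of _ ?q]) auto
    then show ?thesis using fin[rule_format, of "(s, y)"] a
      by (cases "usc_env (spacetime M d) f (s, y)") auto
  qed
  then show ?thesis using r(1) by blast
qed

text \<open>Lets the upper semilimit stand for its own envelope in the limit problem.\<close>

lemma usc_env_eq_of_usc:
  assumes "usc (spacetime M d) f" "0 < t" "x \<in> M"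
  shows "usc_env (spacetime M d) f (t, x) = ereal (f (t, x))"
proof (rule antisym)
  show "usc_env (spacetime M d) f (t, x) \<le> ereal (f (t, x))"
  proof (rule ereal_le_epsilon2)
    fix e :: real assume "0 < e"
    have "openin (spacetime M d) {z \<in> {0<..} \<times> M. f z < f (t, x) + e}"
      using assms(1) by (simp add: usc_def)
    then have "\<exists>r>0. \<forall>s>0. \<forall>y\<in>M. \<bar>s - t\<bar> < r \<longrightarrow> d x y < r \<longrightarrow> (s, y) \<in> {z \<in> {0<..} \<times> M. f z < f (t, x) + e}"
      using assms(2,3) \<open>0 < e\<close> unfolding openin_spacetime by auto
    then have "usc_env (spacetime M d) f (t, x) \<le> ereal (f (t, x) + e)"
      using assms by (intro usc_env_le) force+
    then show "usc_env (spacetime M d) f (t, x) \<le> ereal (f (t, x)) + ereal e" by simp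
  qed
qed (use usc_env_ge assms in auto)

end

section \<open>Ekeland's variational principle\<close>

text \<open>A pseudometric suffices, so the perturbation below can act on the space variable only.\<close>

lemma ekeland_pseudometric:
  fixes F :: "'b \<Rightarrow> real" and \<delta> :: "'b \<Rightarrow> 'b \<Rightarrow> real"
  assumes z0: "z0 \<in> Q" and eps: "0 < \<epsilon>" and bdd: "\<And>z. z \<in> Q \<Longrightarrow> F z \<le> B"
    and nonneg: "\<And>z w. 0 \<le> \<delta> z w" and refl: "\<And>z. z \<in> Q \<Longrightarrow> \<delta> z z = 0"
    and tri: "\<And>x y z. x \<in> Q \<Longrightarrow> y \<in> Q \<Longrightarrow> z \<in> Q \<Longrightarrow> \<delta> x z \<le> \<delta> x y + \<delta> y z"
    and comp: "\<And>\<sigma>. (\<And>k. \<sigma> k \<in> Q) \<Longrightarrow> (\<And>k. F (\<sigma> k) \<le> F (\<sigma> (Suc k))) \<Longrightarrow>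
      (\<And>e. 0 < e \<Longrightarrow> \<exists>N. \<forall>m\<ge>N. \<forall>n\<ge>m. \<delta> (\<sigma> m) (\<sigma> n) < e) \<Longrightarrow>
      \<exists>z\<in>Q. (\<forall>k. F (\<sigma> k) \<le> F z) \<and> (\<lambda>k. \<delta> (\<sigma> k) z) \<longlonglongrightarrow> 0"
  shows "\<exists>z\<in>Q. F z0 \<le> F z \<and> (\<forall>w\<in>Q. F w \<le> F z + \<epsilon> * \<delta> z w)"
proof -
  \<comment> \<open>\<open>S z\<close> is the set of points above \<open>z\<close> in Ekeland's
    order: the gain in \<open>F\<close> pays for the displacement. Transitivity is the triangle
    inequality, and a maximal element is sought.\<close>
  define S where "S z = {w \<in> Q. F z + \<epsilon> * \<delta> z w \<le> F w}" for z
  have S_trans: "v \<in> S z" if "z \<in> Q" "w \<in> S z" "v \<in> S w" for z w v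
  proof -
    have "w \<in> Q" "v \<in> Q" using that by (auto simp: S_def)
    then have "\<epsilon> * \<delta> z v \<le> \<epsilon> * \<delta> z w + \<epsilon> * \<delta> w v"
      using tri[of z w v] that(1) eps by (simp flip: distrib_left)
    then show ?thesis using that by (simp add: S_def)
  qed
  have S_refl: "z \<in> S z" if "z \<in> Q" for z using that refl by (simp add: S_def)
  \<comment> \<open>Greedy choice: each term is above its predecessor and within
    \<open>(1/2)^k\<close> of the supremum of \<open>F\<close> over the predecessor's set.\<close>
  have "\<exists>\<sigma>. \<forall>k. (\<sigma> k \<in> Q \<and> (k = 0 \<longrightarrow> \<sigma> k = z0)) \<and>
     (\<sigma> (Suc k) \<in> S (\<sigma> k) \<and> (\<forall>w\<in>S (\<sigma> k). F w \<le> F (\<sigma> (Suc k)) + (1/2)^k))"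
  proof (rule dependent_nat_choice)
    show "\<exists>z. z \<in> Q \<and> (0 = (0::nat) \<longrightarrow> z = z0)" using z0 by blast
    fix z and k :: nat assume "z \<in> Q \<and> (k = 0 \<longrightarrow> z = z0)"
    then have z: "z \<in> Q" by simp
    have bd: "bdd_above (F ` S z)" using bdd by (intro bdd_aboveI[of _ B]) (auto simp: S_def)
    have "F ` S z \<noteq> {}" using S_refl[OF z] by blast
    moreover have "Sup (F ` S z) - (1/2)^k < Sup (F ` S z)" by simp
    ultimately obtain y where y: "y \<in> S z" "Sup (F ` S z) - (1/2)^k < F y"
      using less_cSupE[of "Sup (F ` S z) - (1/2)^k" "F ` S z"] by blast
    have "F w \<le> F y + (1/2)^k" if "w \<in> S z" for w
      using cSup_upper[OF imageI[OF that, of F] bd] y(2) by linarith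
    moreover have "y \<in> Q" using y(1) by (simp add: S_def)
    ultimately show "\<exists>y. (y \<in> Q \<and> (Suc k = 0 \<longrightarrow> y = z0)) \<and>
        (y \<in> S z \<and> (\<forall>w\<in>S z. F w \<le> F y + (1/2)^k))"
      using y(1) by blast
  qed
  then obtain \<sigma> where \<sigma>: "\<And>k. \<sigma> k \<in> Q" "\<sigma> 0 = z0" "\<And>k. \<sigma> (Suc k) \<in> S (\<sigma> k)"
    "\<And>k w. w \<in> S (\<sigma> k) \<Longrightarrow> F w \<le> F (\<sigma> (Suc k)) + (1/2)^k" by metis
  have S_le: "\<sigma> n \<in> S (\<sigma> m)" if "m \<le> n" for m n
    using that
  proof (induction n rule: dec_induct)
    case base
    then show ?case using S_refl[OF \<sigma>(1)] .
  next
    case (step n)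
    then show ?case using S_trans[OF \<sigma>(1) _ \<sigma>(3)] by blast
  qed
  have mono: "F (\<sigma> m) \<le> F (\<sigma> n)" if "m \<le> n" for m n
  proof -
    have "F (\<sigma> m) + \<epsilon> * \<delta> (\<sigma> m) (\<sigma> n) \<le> F (\<sigma> n)" using S_le[OF that] by (simp add: S_def)
    moreover have "0 \<le> \<epsilon> * \<delta> (\<sigma> m) (\<sigma> n)" using eps nonneg by simp
    ultimately show ?thesis by linarith
  qed
  have "incseq (\<lambda>k. F (\<sigma> k))" using mono by (simp add: incseq_def)
  then obtain l where "(\<lambda>k. F (\<sigma> k)) \<longlonglongrightarrow> l"
    using bdd[OF \<sigma>(1)] by (elim incseq_convergent) blast+
  then have cau: "Cauchy (\<lambda>k. F (\<sigma> k))" by (rule LIMSEQ_imp_Cauchy)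
  \<comment> \<open>Displacements along the sequence are paid for by increments of \<open>F\<close>,
    whose values converge, being monotone and bounded.\<close>
  have "\<exists>N. \<forall>m\<ge>N. \<forall>n\<ge>m. \<delta> (\<sigma> m) (\<sigma> n) < e" if "0 < e" for e
  proof -
    obtain N where N: "\<And>m n. m \<ge> N \<Longrightarrow> n \<ge> N \<Longrightarrow> dist (F (\<sigma> m)) (F (\<sigma> n)) < \<epsilon> * e"
      using metric_CauchyD[OF cau, of "\<epsilon> * e"] \<open>0 < e\<close> eps by auto
    have "\<delta> (\<sigma> m) (\<sigma> n) < e" if "m \<ge> N" "n \<ge> m" for m n
    proof -
      have "\<epsilon> * \<delta> (\<sigma> m) (\<sigma> n) \<le> F (\<sigma> n) - F (\<sigma> m)" using S_le[OF that(2)] by (simp add: S_def)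
      also have "\<dots> < \<epsilon> * e" using N[of m n] that by (simp add: dist_real_def)
      finally show ?thesis using eps by simp
    qed
    then show ?thesis by blast
  qed
  then obtain z where z: "z \<in> Q" "\<And>k. F (\<sigma> k) \<le> F z" "(\<lambda>k. \<delta> (\<sigma> k) z) \<longlonglongrightarrow> 0"
    using comp[of \<sigma>] \<sigma>(1) mono by (metis le_SucI le_refl)
  \<comment> \<open>Only the distances to \<open>z\<close> are known to converge, so
    \<open>\<sigma> n\<close> is inserted by the triangle inequality and \<open>n\<close> tends to
    infinity.\<close>
  have zS: "z \<in> S (\<sigma> k)" for k
  proof -
    have "F (\<sigma> k) + \<epsilon> * \<delta> (\<sigma> k) z - \<epsilon> * \<delta> (\<sigma> n) z \<le> F z" if "n \<ge> k" for n
    proof -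
      have "\<epsilon> * \<delta> (\<sigma> k) z \<le> \<epsilon> * \<delta> (\<sigma> k) (\<sigma> n) + \<epsilon> * \<delta> (\<sigma> n) z"
        using tri[of "\<sigma> k" "\<sigma> n" z] \<sigma>(1) z(1) eps by (simp flip: distrib_left)
      moreover have "F (\<sigma> k) + \<epsilon> * \<delta> (\<sigma> k) (\<sigma> n) \<le> F (\<sigma> n)" using S_le[OF that] by (simp add: S_def)
      ultimately show ?thesis using z(2)[of n] by linarith
    qed
    moreover have "(\<lambda>n. F (\<sigma> k) + \<epsilon> * \<delta> (\<sigma> k) z - \<epsilon> * \<delta> (\<sigma> n) z) \<longlonglongrightarrow>
        F (\<sigma> k) + \<epsilon> * \<delta> (\<sigma> k) z - \<epsilon> * 0"
      by (intro tendsto_intros z(3))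
    ultimately have "F (\<sigma> k) + \<epsilon> * \<delta> (\<sigma> k) z - \<epsilon> * 0 \<le> F z"
      by (intro LIMSEQ_le_const2) auto
    then show ?thesis using z(1) by (simp add: S_def)
  qed
  \<comment> \<open>A point above \<open>z\<close> is above every \<open>\<sigma> k\<close>, so the
    greedy choice leaves it a gain of at most \<open>(1/2)^k\<close>; any other point fails the
    inequality defining \<open>S z\<close>.\<close>
  have "F w \<le> F z + \<epsilon> * \<delta> z w" if "w \<in> Q" for w
  proof (cases "w \<in> S z")
    case True
    have "F w \<le> F z + (1/2)^k" for k :: nat
      using \<sigma>(4)[OF S_trans[OF \<sigma>(1) zS True], of k] z(2)[of "Suc k"] by linarith
    moreover have "(\<lambda>k. F z + (1/2)^k) \<longlonglongrightarrow> F z + 0"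
      by (intro tendsto_intros LIMSEQ_power_zero) auto
    ultimately have "F w \<le> F z + 0" by (intro LIMSEQ_le_const) auto
    then show ?thesis using eps nonneg[of z w] by (simp add: add_increasing2)
  next
    case False
    then show ?thesis using that by (simp add: S_def)
  qed
  then show ?thesis using z(1,2) \<sigma>(2) by metis
qed

section \<open>Complete geodesic spaces\<close>

text \<open>Bisection of \<open>[0, l]\<close>: the estimate adds up over adjacent intervals, and it
  holds on a short interval around \<open>s\<close> by splitting that interval at \<open>s\<close>,
  since the hypothesis only compares values with the one at the centre.\<close>

lemma lipschitz_of_locally_lipschitz_at:
  fixes g :: "real \<Rightarrow> real"
  assumes "0 \<le> l"
    and local: "\<And>s. 0 \<le> s \<Longrightarrow> s \<le> l \<Longrightarrow>
      \<exists>r>0. \<forall>s'\<in>{0..l}. \<bar>s' - s\<bar> < r \<longrightarrow> \<bar>g s' - g s\<bar> \<le> K * \<bar>s' - s\<bar>"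
  shows "\<bar>g l - g 0\<bar> \<le> K * l"
proof -
  \<comment> \<open>The local case of Bolzano's induction admits intervals that leave
    \<open>[0, l]\<close>; the two guards discard them.\<close>
  define P where "P a b \<longleftrightarrow> (0 \<le> a \<longrightarrow> b \<le> l \<longrightarrow> \<bar>g b - g a\<bar> \<le> K * (b - a))" for a b
  have "P 0 l"
    using assms(1)
  proof (induction rule: Bolzano)
    case (trans a b c)
    show ?case unfolding P_def
    proof (intro impI)
      assume "0 \<le> a" "c \<le> l"
      then have "\<bar>g b - g a\<bar> \<le> K * (b - a)" "\<bar>g c - g b\<bar> \<le> K * (c - b)"
        using trans by (auto simp: P_def)
      then have "\<bar>g c - g a\<bar> \<le> K * (b - a) + K * (c - b)"
        using abs_triangle_ineq[of "g c - g b" "g b - g a"] by linarith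
      then show "\<bar>g c - g a\<bar> \<le> K * (c - a)" by (simp add: algebra_simps)
    qed
  next
    case (local s)
    then obtain r where r: "r > 0" "\<And>s'. s'\<in>{0..l} \<Longrightarrow> \<bar>s' - s\<bar> < r \<Longrightarrow> \<bar>g s' - g s\<bar> \<le> K * \<bar>s' - s\<bar>"
      using assms(2) by metis
    have "\<bar>g b - g a\<bar> \<le> K * (b - a)" if "a \<le> s" "s \<le> b" "b - a < r" "0 \<le> a" "b \<le> l" for a b
    proof -
      have "\<bar>g b - g s\<bar> \<le> K * (b - s)" using r(2)[of b] that by simp
      moreover have "\<bar>g a - g s\<bar> \<le> K * (s - a)" using r(2)[of a] that by simp
      ultimately have "\<bar>g b - g a\<bar> \<le> K * (b - s) + K * (s - a)" by linarith
      then show ?thesis by (simp add: algebra_simps)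
    qed
    then show ?case using r(1) unfolding P_def by blast
  qed
  then show ?thesis using assms(1) by (simp add: P_def)
qed

text \<open>Locale form of \<open>complete_geodesic_space\<close>: its results can be applied to
  every space of the sequence and to the limit by interpretation.\<close>

locale geodesic_space = Metric_space +
  assumes complete: mcomplete
    and geodesic: "\<And>x y. x \<in> M \<Longrightarrow> y \<in> M \<Longrightarrow> \<exists>\<gamma>::real \<Rightarrow> 'a. \<gamma> 0 = x \<and> \<gamma> (d x y) = y \<and>
      \<gamma> ` {0..d x y} \<subseteq> M \<and> (\<forall>r\<in>{0..d x y}. \<forall>s\<in>{0..d x y}. d (\<gamma> r) (\<gamma> s) = \<bar>r - s\<bar>)"

lemma complete_geodesic_space_iff: "complete_geodesic_space M d \<longleftrightarrow> geodesic_space M d"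
  by (auto simp: complete_geodesic_space_def geodesic_space_def geodesic_space_axioms_def)

context geodesic_space
begin

text \<open>Restricting the function to a geodesic parametrised by arc length turns the claim into
  the one-dimensional estimate. Points of the geodesic are no farther from \<open>x\<close> than
  \<open>y\<close> is, so local control on that ball suffices.\<close>

lemma lipschitz_along_geodesic:
  assumes "x \<in> M" "y \<in> M"
    and local: "\<And>z. z \<in> M \<Longrightarrow> d x z \<le> d x y \<Longrightarrow>
      \<exists>r>0. \<forall>w\<in>M. d z w < r \<longrightarrow> \<bar>f w - f z\<bar> \<le> K * d z w"
  shows "\<bar>f y - f x\<bar> \<le> K * d x y"
proof -
  obtain \<gamma> :: "real \<Rightarrow> 'a" where \<gamma>: "\<gamma> 0 = x" "\<gamma> (d x y) = y" "\<gamma> ` {0..d x y} \<subseteq> M"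
    "\<And>r s. r\<in>{0..d x y} \<Longrightarrow> s\<in>{0..d x y} \<Longrightarrow> d (\<gamma> r) (\<gamma> s) = \<bar>r - s\<bar>"
    using geodesic[OF assms(1,2)] by metis
  have "\<bar>f (\<gamma> (d x y)) - f (\<gamma> 0)\<bar> \<le> K * d x y"
  proof (rule lipschitz_of_locally_lipschitz_at[where g = "\<lambda>s. f (\<gamma> s)"])
    fix s assume s: "0 \<le> s" "s \<le> d x y"
    have "\<gamma> s \<in> M" using \<gamma>(3) s by auto
    moreover have "d x (\<gamma> s) \<le> d x y" using \<gamma>(4)[of 0 s] \<gamma>(1) s by simp
    ultimately obtain r where r: "r > 0" "\<And>w. w\<in>M \<Longrightarrow> d (\<gamma> s) w < r \<Longrightarrow> \<bar>f w - f (\<gamma> s)\<bar> \<le> K * d (\<gamma> s) w"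
      using local by metis
    have "\<bar>f (\<gamma> s') - f (\<gamma> s)\<bar> \<le> K * \<bar>s' - s\<bar>" if "s' \<in> {0..d x y}" "\<bar>s' - s\<bar> < r" for s'
    proof -
      have "d (\<gamma> s) (\<gamma> s') = \<bar>s' - s\<bar>" using \<gamma>(4)[of s s'] s that by (simp add: abs_minus_commute)
      moreover have "\<gamma> s' \<in> M" using \<gamma>(3) that by auto
      ultimately show ?thesis using r(2)[of "\<gamma> s'"] that by simp
    qed
    then show "\<exists>r>0. \<forall>s'\<in>{0..d x y}. \<bar>s' - s\<bar> < r \<longrightarrow> \<bar>f (\<gamma> s') - f (\<gamma> s)\<bar> \<le> K * \<bar>s' - s\<bar>"
      using r(1) by blast
  qed simp
  then show ?thesis using \<gamma> by simp
qed

text \<open>The slope acts as an upper gradient: the strict bound by \<open>K\<close> gives a local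
  Lipschitz estimate around each point, which is integrated along a geodesic.\<close>

lemma slope_lipschitz:
  assumes "locally_lipschitz M d u" "0 < t" "x \<in> M" "y \<in> M"
    and "\<And>z. z \<in> M \<Longrightarrow> d x z \<le> d x y \<Longrightarrow> slope M d u (t, z) < K"
  shows "\<bar>u (t, y) - u (t, x)\<bar> \<le> K * d x y"
proof (rule lipschitz_along_geodesic[where f = "\<lambda>x. u (t, x)"])
  fix z assume z: "z \<in> M" "d x z \<le> d x y"
  obtain L where "0 \<le> L"
    "\<exists>r>0. \<forall>w\<in>M. 0 < d z w \<longrightarrow> d z w < r \<longrightarrow> \<bar>u (t, w) - u (t, z)\<bar> \<le> L * d z w"
    by (rule slope_bound_at[OF assms(1,2) z(1), of "\<lambda>a. \<bar>a\<bar>"]) auto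
  then show "\<exists>r>0. \<forall>w\<in>M. d z w < r \<longrightarrow> \<bar>u (t, w) - u (t, z)\<bar> \<le> K * d z w"
    using slope_with_lessD[of z "\<lambda>a. \<bar>a\<bar>" u t L K] assms(5)[OF z] z(1) by (simp add: slope_def)
qed (use assms in auto)

end

section \<open>Distance test functions\<close>

lemma H_lower_antimono: "a \<le> b \<Longrightarrow> H_lower H b t x r p \<le> H_lower H a t x r p"
  unfolding H_lower_def by (intro INF_superset_mono) auto

context Metric_space
begin

section \<open>Criteria for continuity and Lipschitz bounds of explicit functions\<close>

lemma abs_mdist_diff_le: "x \<in> M \<Longrightarrow> y \<in> M \<Longrightarrow> z \<in> M \<Longrightarrow> \<bar>d x z - d y z\<bar> \<le> d x y"
  using mdist_reverse_triangle[of x z y] by (simp add: commute)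

lemma continuous_map_spacetimeI:
  assumes "\<And>t x e. 0 < t \<Longrightarrow> x \<in> M \<Longrightarrow> 0 < e \<Longrightarrow>
    \<exists>r>0. \<forall>s>0. \<forall>y\<in>M. \<bar>s - t\<bar> < r \<longrightarrow> d x y < r \<longrightarrow> \<bar>f (s, y) - f (t, x)\<bar> < e"
  shows "continuous_map (spacetime M d) euclideanreal f"
  unfolding continuous_map_def
proof (intro conjI allI impI)
  fix U :: "real set" assume "openin euclideanreal U"
  then have U: "open U" by simp
  show "openin (spacetime M d) {z \<in> topspace (spacetime M d). f z \<in> U}"
    unfolding openin_spacetime
  proof (intro conjI allI impI)
    fix t x assume "(t, x) \<in> {z \<in> topspace (spacetime M d). f z \<in> U}"
    then have tx: "0 < t" "x \<in> M" "f (t, x) \<in> U" by auto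
    then obtain e where e: "e > 0" "\<And>a. \<bar>a - f (t, x)\<bar> < e \<Longrightarrow> a \<in> U"
      using U unfolding open_dist dist_real_def by metis
    obtain r where "r > 0"
      "\<forall>s>0. \<forall>y\<in>M. \<bar>s - t\<bar> < r \<longrightarrow> d x y < r \<longrightarrow> \<bar>f (s, y) - f (t, x)\<bar> < e"
      using assms[OF tx(1,2) e(1)] by blast
    then show "\<exists>r>0. \<forall>s>0. \<forall>y\<in>M. \<bar>s - t\<bar> < r \<longrightarrow> d x y < r \<longrightarrow>
        (s, y) \<in> {z \<in> topspace (spacetime M d). f z \<in> U}"
      using e(2) by (intro exI[of _ r]) simp
  qed auto
qed auto

lemma continuous_map_spacetimeD:
  assumes "continuous_map (spacetime M d) euclideanreal f" "0 < t" "x \<in> M" "0 < e"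
  shows "\<exists>r>0. \<forall>s>0. \<forall>y\<in>M. \<bar>s - t\<bar> < r \<longrightarrow> d x y < r \<longrightarrow> \<bar>f (s, y) - f (t, x)\<bar> < e"
proof -
  have "openin (spacetime M d) {z \<in> topspace (spacetime M d). f z \<in> ball (f (t, x)) e}"
    using assms(1) unfolding continuous_map_def by (metis open_ball open_openin)
  then have "\<exists>r>0. \<forall>s>0. \<forall>y\<in>M. \<bar>s - t\<bar> < r \<longrightarrow> d x y < r \<longrightarrow>
      (s, y) \<in> {z \<in> topspace (spacetime M d). f z \<in> ball (f (t, x)) e}"
    using assms(2-4) unfolding openin_spacetime by simp
  then show ?thesis by (simp add: dist_real_def abs_minus_commute)
qed

lemma locally_lipschitzI:
  assumes "\<And>t x. 0 < t \<Longrightarrow> x \<in> M \<Longrightarrow> \<exists>L. \<forall>s s' y y'. y \<in> M \<longrightarrow> y' \<in> M \<longrightarrow> \<bar>s - t\<bar> < 1 \<longrightarrow> \<bar>s' - t\<bar> < 1 \<longrightarrow>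
     d x y < 1 \<longrightarrow> d x y' < 1 \<longrightarrow> \<bar>u (s, y) - u (s', y')\<bar> \<le> L * (\<bar>s - s'\<bar> + d y y')"
  shows "locally_lipschitz M d u"
  unfolding locally_lipschitz_def
proof
  fix z :: "real \<times> 'a" assume "z \<in> {0<..} \<times> M"
  then obtain t x where z: "z = (t, x)" "0 < t" "x \<in> M" by auto
  from assms[OF this(2,3)] obtain L where
    "\<forall>s s' y y'. y \<in> M \<longrightarrow> y' \<in> M \<longrightarrow> \<bar>s - t\<bar> < 1 \<longrightarrow> \<bar>s' - t\<bar> < 1 \<longrightarrow>
     d x y < 1 \<longrightarrow> d x y' < 1 \<longrightarrow> \<bar>u (s, y) - u (s', y')\<bar> \<le> L * (\<bar>s - s'\<bar> + d y y')" by blast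
  then show "\<exists>U L. openin (spacetime M d) U \<and> z \<in> U \<and>
        (\<forall>(t, x)\<in>U. \<forall>(s, y)\<in>U. \<bar>u (t, x) - u (s, y)\<bar> \<le> L * (\<bar>t - s\<bar> + d x y))"
    using z openin_spacetime_cylinder[OF z(3), of t 1]
    by (intro exI[of _ "{(s, y). 0 < s \<and> y \<in> M \<and> \<bar>s - t\<bar> < 1 \<and> d x y < 1}"] exI[of _ L]) auto
qed

lemma sq_mdist_diff_le:
  assumes "x \<in> M" "x' \<in> M" "y \<in> M"
  shows "\<bar>(d x y)\<^sup>2 - (d x' y)\<^sup>2\<bar> \<le> d x x' * (d x y + d x' y)"
proof -
  have "\<bar>(d x y)\<^sup>2 - (d x' y)\<^sup>2\<bar> = \<bar>d x y - d x' y\<bar> * (d x y + d x' y)"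
    by (simp add: power2_eq_square square_diff_square_factored abs_mult)
  also have "\<dots> \<le> d x x' * (d x y + d x' y)"
    by (intro mult_right_mono abs_mdist_diff_le assms) auto
  finally show ?thesis .
qed

lemma locally_lipschitz_sq_mdist:
  assumes "y0 \<in> M" "0 \<le> c"
  shows "locally_lipschitz M d (\<lambda>(t, x). c * (d x y0)\<^sup>2)"
proof (rule locally_lipschitzI)
  fix t :: real and x assume x: "x \<in> M"
  have "\<bar>c * (d y y0)\<^sup>2 - c * (d y' y0)\<^sup>2\<bar> \<le> (c * (2 * d x y0 + 2)) * (\<bar>s - s'\<bar> + d y y')"
    if "y \<in> M" "y' \<in> M" "d x y < 1" "d x y' < 1" for s s' y y'
  proof -
    have "d y y0 \<le> d x y0 + 1" "d y' y0 \<le> d x y0 + 1"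
      using triangle[of y x y0] triangle[of y' x y0] that x assms by (simp_all add: commute)
    then have "(d y y')  * (d y y0 + d y' y0) \<le> (\<bar>s - s'\<bar> + d y y') * (2 * d x y0 + 2)"
      by (intro mult_mono) auto
    then have "\<bar>(d y y0)\<^sup>2 - (d y' y0)\<^sup>2\<bar> \<le> (\<bar>s - s'\<bar> + d y y') * (2 * d x y0 + 2)"
      using sq_mdist_diff_le[OF that(1,2) assms(1)] by linarith
    from mult_left_mono[OF this assms(2)]
    have "c * \<bar>(d y y0)\<^sup>2 - (d y' y0)\<^sup>2\<bar> \<le> (c * (2 * d x y0 + 2)) * (\<bar>s - s'\<bar> + d y y')"
      by (simp only: mult.assoc mult.commute[of "2 * d x y0 + 2"])
    then show ?thesis
      using assms(2) by (simp add: abs_mult flip: right_diff_distrib)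
  qed
  then show "\<exists>L. \<forall>s s' y y'. y \<in> M \<longrightarrow> y' \<in> M \<longrightarrow> \<bar>s - t\<bar> < 1 \<longrightarrow> \<bar>s' - t\<bar> < 1 \<longrightarrow>
     d x y < 1 \<longrightarrow> d x y' < 1 \<longrightarrow> \<bar>(\<lambda>(t, x). c * (d x y0)\<^sup>2) (s, y) -
       (\<lambda>(t, x). c * (d x y0)\<^sup>2) (s', y')\<bar> \<le> L * (\<bar>s - s'\<bar> + d y y')"
    by (intro exI[of _ "c * (2 * d x y0 + 2)"]) simp
qed

end

context geodesic_space
begin

text \<open>Factoring the difference of squares bounds the slope by \<open>2 * c * d x y\<close>;
  moving from \<open>x\<close> along a geodesic towards \<open>y\<close> attains it with decreasing
  values. As \<open>\<phi> (- \<bar>a\<bar>) = \<bar>a\<bar>\<close>, the full and the descending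
  slope are both covered, which makes the squared distance \<open>C1_minus\<close>.\<close>

lemma slope_with_sq_mdist:
  assumes "y \<in> M" "0 \<le> c" "x \<in> M" "\<And>a. 0 \<le> \<phi> a" "\<And>a. \<phi> a \<le> \<bar>a\<bar>" "\<And>a. \<phi> (- \<bar>a\<bar>) = \<bar>a\<bar>"
  shows "slope_with \<phi> M d (\<lambda>(t, x). c * (d x y)\<^sup>2) (t, x) = 2 * c * d x y"
proof (rule antisym)
  let ?u = "\<lambda>(t::real, x). c * (d x y)\<^sup>2"
  have bound: "\<exists>r>0. \<forall>z\<in>M. 0 < d x z \<longrightarrow> d x z < r \<longrightarrow> \<phi> (?u (t, z) - ?u (t, x)) \<le> K * d x z"
    if "2 * c * d x y < K" for K
  proof -
    \<comment> \<open>On this scale the second-order term \<open>c * d x z\<close> fits into the gap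
      below \<open>K\<close>; the \<open>+ 1\<close> allows \<open>c = 0\<close>.\<close>
    define r where "r = (K - 2 * c * d x y) / (c + 1)"
    have "r > 0" using that assms(2) by (simp add: r_def)
    moreover have "\<phi> (?u (t, z) - ?u (t, x)) \<le> K * d x z" if z: "z \<in> M" "d x z < r" for z
    proof -
      have "d z y \<le> d x y + d x z" using triangle[of z x y] z assms by (simp add: commute)
      have "\<phi> (?u (t, z) - ?u (t, x)) \<le> \<bar>c * (d z y)\<^sup>2 - c * (d x y)\<^sup>2\<bar>"
        using assms(5) by simp
      also have "\<dots> = c * \<bar>(d x y)\<^sup>2 - (d z y)\<^sup>2\<bar>"
        using assms(2) by (simp add: abs_mult abs_minus_commute flip: right_diff_distrib)
      also have "\<dots> \<le> c * (d x z * (d x y + d z y))"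
        by (intro mult_left_mono sq_mdist_diff_le assms z)
      also have "\<dots> \<le> c * (d x z * (2 * d x y + d x z))"
        using \<open>d z y \<le> d x y + d x z\<close> assms(2) by (intro mult_left_mono) auto
      also have "\<dots> = (2 * c * d x y + c * d x z) * d x z" by (simp add: algebra_simps)
      also have "\<dots> \<le> K * d x z"
      proof (intro mult_right_mono)
        have "(c + 1) * d x z \<le> (c + 1) * r" using z assms(2) by (intro mult_left_mono) auto
        then have "(c + 1) * d x z \<le> K - 2 * c * d x y" using assms(2) by (simp add: r_def)
        moreover have "c * d x z \<le> (c + 1) * d x z" by (simp add: distrib_right)
        ultimately show "2 * c * d x y + c * d x z \<le> K" by linarith
      qed simp
      finally show ?thesis .
    qed
    ultimately show ?thesis by blast
  qed
  have "\<phi> 0 = 0" using assms(6)[of 0] by simp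
  show "slope_with \<phi> M d ?u (t, x) \<le> 2 * c * d x y"
  proof (rule dense_ge)
    fix K assume K: "2 * c * d x y < K"
    have "0 \<le> 2 * c * d x y" using assms(2) by simp
    then have "0 \<le> K" using K by linarith
    then show "slope_with \<phi> M d ?u (t, x) \<le> K"
      by (intro slope_with_le(2) bound assms(3,4) K)
  qed
  show "2 * c * d x y \<le> slope_with \<phi> M d ?u (t, x)"
  \<comment> \<open>In the first case the claim is nonnegativity; in the second there is a proper
    direction towards \<open>y\<close>.\<close>
  proof (cases "c = 0 \<or> d x y = 0")
    case True
    then have zero: "2 * c * d x y = 0" by (elim disjE) simp_all
    have "0 \<le> slope_with \<phi> M d ?u (t, x)"
      using zero by (intro slope_with_le(1)[of x 1 \<phi> ?u t] bound assms(3,4)) auto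
    then show ?thesis unfolding zero .
  next
    case False
    then have pos: "c > 0" "d x y > 0" using assms(2) by (auto simp: less_le)
    obtain \<gamma> :: "real \<Rightarrow> 'a" where \<gamma>: "\<gamma> 0 = x" "\<gamma> (d x y) = y" "\<gamma> ` {0..d x y} \<subseteq> M"
      "\<And>r s. r\<in>{0..d x y} \<Longrightarrow> s\<in>{0..d x y} \<Longrightarrow> d (\<gamma> r) (\<gamma> s) = \<bar>r - s\<bar>"
      using geodesic[OF assms(3,1)] by blast
    show ?thesis
    proof (rule dense_le)
      fix K assume K: "K < 2 * c * d x y"
      show "K \<le> slope_with \<phi> M d ?u (t, x)"
      proof (rule slope_with_ge[OF assms(3,4) \<open>\<phi> 0 = 0\<close> bound[of "2 * c * d x y + 1"]])
        fix r :: real assume r: "r > 0"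
        \<comment> \<open>The last bound keeps the loss \<open>c * s\<close> in the descent rate
          within the gap \<open>2 * c * d x y - K\<close>; the others place the point on the
          geodesic and closer to \<open>x\<close> than \<open>r\<close>.\<close>
        define s where "s = min (r / 2) (min (d x y) ((2 * c * d x y - K) / c))"
        have s: "0 < s" "s < r" "s \<le> d x y" "s \<le> (2 * c * d x y - K) / c"
        proof -
          have "s \<le> r / 2" unfolding s_def by (rule min.cobounded1)
          then show "s < r" using r by linarith
          have "0 < (2 * c * d x y - K) / c" using pos K by simp
          then show "0 < s" using r pos by (simp add: s_def)
        qed (simp_all add: s_def)
        have ds: "d x (\<gamma> s) = s" "d (\<gamma> s) y = d x y - s"
          using \<gamma>(4)[of 0 s] \<gamma>(4)[of s "d x y"] \<gamma>(1,2) s by auto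
        have "c * s \<le> 2 * c * d x y - K" using s(4) pos by (simp add: pos_le_divide_eq mult.commute)
        then have "K * s \<le> (2 * c * d x y - c * s) * s" using s(1) by (intro mult_right_mono) auto
        also have "\<dots> = c * (d x y)\<^sup>2 - c * (d x y - s)\<^sup>2"
          by (simp add: power2_eq_square algebra_simps)
        finally have le: "K * s \<le> c * (d x y)\<^sup>2 - c * (d x y - s)\<^sup>2" .
        have "c * (d x y - s)\<^sup>2 \<le> c * (d x y)\<^sup>2"
          using s pos by (intro mult_left_mono power_mono) auto
        then have "\<phi> (?u (t, \<gamma> s) - ?u (t, x)) = c * (d x y)\<^sup>2 - c * (d x y - s)\<^sup>2"
          using assms(6)[of "c * (d x y - s)\<^sup>2 - c * (d x y)\<^sup>2"] ds by simp
        moreover have "\<gamma> s \<in> M" using \<gamma>(3) s by auto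
        ultimately show "\<exists>z\<in>M. 0 < d x z \<and> d x z < r \<and> K * d x z \<le> \<phi> (?u (t, z) - ?u (t, x))"
          using le s(1,2) by (intro bexI[of _ "\<gamma> s"]) (simp_all only: ds(1) simp_thms)
      qed simp
    qed
  qed
qed

end

section \<open>Cones and paraboloids in space, quadratic in time\<close>

context Metric_space
begin

lemma locally_lipschitz_continuous:
  assumes "locally_lipschitz M d u" "0 < t" "x \<in> M" "0 < e"
  shows "\<exists>r>0. \<forall>s>0. \<forall>y\<in>M. \<bar>s - t\<bar> < r \<longrightarrow> d x y < r \<longrightarrow> \<bar>u (s, y) - u (t, x)\<bar> < e"
proof -
  obtain L r where Lr: "0 \<le> L" "0 < r"
    "\<And>s y s' y'. 0 < s \<Longrightarrow> y \<in> M \<Longrightarrow> \<bar>s - t\<bar> < r \<Longrightarrow> d x y < r \<Longrightarrow>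
       0 < s' \<Longrightarrow> y' \<in> M \<Longrightarrow> \<bar>s' - t\<bar> < r \<Longrightarrow> d x y' < r \<Longrightarrow>
       \<bar>u (s, y) - u (s', y')\<bar> \<le> L * (\<bar>s - s'\<bar> + d y y')"
    using locally_lipschitzE[OF assms(1-3)] by metis
  define q where "q = min r (e / (2 * (L + 1)))"
  have q: "0 < q" "q \<le> r" "q \<le> e / (2 * (L + 1))"
    using Lr assms(4) by (auto simp: q_def)
  have "\<bar>u (s, y) - u (t, x)\<bar> < e" if "s > 0" "y \<in> M" "\<bar>s - t\<bar> < q" "d x y < q" for s y
  proof -
    have "\<bar>u (s, y) - u (t, x)\<bar> \<le> L * (\<bar>s - t\<bar> + d y x)"
      using Lr(2) q(2) that assms(2,3) by (intro Lr(3)) auto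
    also have "\<dots> \<le> L * (q + q)"
      using that Lr(1) by (intro mult_left_mono add_mono) (auto simp: commute)
    also have "\<dots> < (L + 1) * (q + q)" using q(1) by simp
    also have "\<dots> = q * (2 * (L + 1))" by (simp add: algebra_simps)
    also have "\<dots> \<le> e" using q(3) Lr(1) by (simp add: pos_le_divide_eq)
    finally show ?thesis .
  qed
  then show ?thesis using q(1) by blast
qed

lemma C1_in_timeI:
  assumes "\<And>t x. 0 < t \<Longrightarrow> x \<in> M \<Longrightarrow> ((\<lambda>s. u (s, x)) has_field_derivative g t) (at t)"
    and "\<And>t. isCont g t"
  shows "C1_in_time M d u"
  unfolding C1_in_time_def
proof (intro conjI allI impI ballI)
  show "(\<lambda>s. u (s, x)) field_differentiable at t" if "0 < t" "x \<in> M" for t x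
    using assms(1)[OF that] field_differentiable_def by blast
  have td: "time_deriv u (t, x) = g t" if "0 < t" "x \<in> M" for t x
    using assms(1)[OF that] by (simp add: time_deriv_def DERIV_imp_deriv)
  show "continuous_map (spacetime M d) euclideanreal (time_deriv u)"
  proof (rule continuous_map_spacetimeI)
    fix t x e :: real and y assume "0 < t" "y \<in> M" "0 < e"
    obtain r where "r > 0" "\<And>s. \<bar>s - t\<bar> < r \<Longrightarrow> \<bar>g s - g t\<bar> < e"
      using assms(2)[of t] \<open>0 < e\<close> unfolding continuous_at_eps_delta dist_real_def by metis
    then show "\<exists>r>0. \<forall>s>0. \<forall>z\<in>M. \<bar>s - t\<bar> < r \<longrightarrow> d y z < r \<longrightarrow> \<bar>time_deriv u (s, z) - time_deriv u (t, y)\<bar> < e"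
      using td \<open>0 < t\<close> \<open>y \<in> M\<close> by (intro exI[of _ r]) simp
  qed
qed

lemma time_deriv_add:
  assumes "C1_in_time M d u" "C1_in_time M d v" "0 < t" "x \<in> M"
  shows "time_deriv (\<lambda>z. u z + v z) (t, x) = time_deriv u (t, x) + time_deriv v (t, x)"
  using assms by (auto simp: time_deriv_def C1_in_time_def intro!: deriv_add)

lemma mult_mdist_diff_le:
  assumes "0 \<le> \<beta>" "x \<in> M" "y \<in> M" "z \<in> M"
  shows "\<bar>\<beta> * d x z - \<beta> * d y z\<bar> \<le> \<beta> * d x y"
proof -
  have "\<bar>\<beta> * d x z - \<beta> * d y z\<bar> = \<beta> * \<bar>d x z - d y z\<bar>"
    using assms(1) by (simp add: abs_mult flip: right_diff_distrib)
  also have "\<dots> \<le> \<beta> * d x y"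
    using assms by (intro mult_left_mono abs_mdist_diff_le)
  finally show ?thesis .
qed

lemma locally_lipschitz_cone:
  fixes t0 \<tau> \<alpha> :: real
  assumes "x0 \<in> M" "x1 \<in> M" "0 \<le> \<beta>" "0 \<le> \<epsilon>"
  shows "locally_lipschitz M d (\<lambda>(t, x). \<tau> * (t - t0) + \<alpha> * (t - t0)\<^sup>2 + \<beta> * d x x0 + \<epsilon> * d x x1)"
proof (rule locally_lipschitzI)
  fix t :: real and x assume x: "x \<in> M"
  \<comment> \<open>The coefficient of \<open>\<bar>\<alpha>\<bar>\<close> bounds
    \<open>\<bar>s + s' - 2 * t0\<bar>\<close>, the second factor in the difference of the squares,
    for times within 1 of \<open>t\<close>.\<close>
  define L where "L = \<bar>\<tau>\<bar> + \<bar>\<alpha>\<bar> * (2 * \<bar>t - t0\<bar> + 2) + \<beta> + \<epsilon>"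
  have "\<bar>(\<tau> * (s - t0) + \<alpha> * (s - t0)\<^sup>2 + \<beta> * d y x0 + \<epsilon> * d y x1) -
      (\<tau> * (s' - t0) + \<alpha> * (s' - t0)\<^sup>2 + \<beta> * d y' x0 + \<epsilon> * d y' x1)\<bar> \<le> L * (\<bar>s - s'\<bar> + d y y')"
    if "y \<in> M" "y' \<in> M" "\<bar>s - t\<bar> < 1" "\<bar>s' - t\<bar> < 1" for s s' y y'
  proof -
    have 1: "\<bar>\<tau> * (s - t0) - \<tau> * (s' - t0)\<bar> = \<bar>\<tau>\<bar> * \<bar>s - s'\<bar>"
      by (simp flip: abs_mult right_diff_distrib)
    have "\<bar>\<alpha> * (s - t0)\<^sup>2 - \<alpha> * (s' - t0)\<^sup>2\<bar> = \<bar>\<alpha> * ((s - s') * (s + s' - 2 * t0))\<bar>"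
      by (simp add: power2_eq_square algebra_simps)
    also have "\<dots> = (\<bar>\<alpha>\<bar> * \<bar>s + s' - 2 * t0\<bar>) * \<bar>s - s'\<bar>" by (simp add: abs_mult)
    also have "\<dots> \<le> (\<bar>\<alpha>\<bar> * (2 * \<bar>t - t0\<bar> + 2)) * \<bar>s - s'\<bar>"
    proof (intro mult_left_mono mult_right_mono)
      show "\<bar>s + s' - 2 * t0\<bar> \<le> 2 * \<bar>t - t0\<bar> + 2" 
        using that(3,4) by (smt (verit))
    qed auto
    finally have 2: "\<bar>\<alpha> * (s - t0)\<^sup>2 - \<alpha> * (s' - t0)\<^sup>2\<bar> \<le> (\<bar>\<alpha>\<bar> * (2 * \<bar>t - t0\<bar> + 2)) * \<bar>s - s'\<bar>" .
    have 3: "\<bar>\<beta> * d y x0 - \<beta> * d y' x0\<bar> \<le> \<beta> * d y y'"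
      by (intro mult_mdist_diff_le assms that)
    have 4: "\<bar>\<epsilon> * d y x1 - \<epsilon> * d y' x1\<bar> \<le> \<epsilon> * d y y'"
      by (intro mult_mdist_diff_le assms that)
    have le: "\<bar>(a + b + c + e) - (a' + b' + c' + e')\<bar> \<le> A + B + C + E"
      if "\<bar>a - a'\<bar> \<le> A" "\<bar>b - b'\<bar> \<le> B" "\<bar>c - c'\<bar> \<le> C" "\<bar>e - e'\<bar> \<le> E"
      for a a' b b' c c' e e' A B C E :: real
      using that by linarith
    note le[OF eq_refl[OF 1] 2 3 4]
    also have "\<bar>\<tau>\<bar> * \<bar>s - s'\<bar> + (\<bar>\<alpha>\<bar> * (2 * \<bar>t - t0\<bar> + 2)) * \<bar>s - s'\<bar>
        + \<beta> * d y y' + \<epsilon> * d y y' \<le> L * (\<bar>s - s'\<bar> + d y y')"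
    proof -
      have "L * (\<bar>s - s'\<bar> + d y y') = \<bar>\<tau>\<bar> * \<bar>s - s'\<bar> + (\<bar>\<alpha>\<bar> * (2 * \<bar>t - t0\<bar> + 2)) * \<bar>s - s'\<bar>
          + \<beta> * d y y' + \<epsilon> * d y y' + ((\<beta> + \<epsilon>) * \<bar>s - s'\<bar>
          + (\<bar>\<tau>\<bar> + \<bar>\<alpha>\<bar> * (2 * \<bar>t - t0\<bar> + 2)) * d y y')"
        unfolding L_def by (simp only: distrib_left distrib_right ac_simps)
      moreover have "0 \<le> (\<beta> + \<epsilon>) * \<bar>s - s'\<bar>" using assms by simp
      moreover have "0 \<le> (\<bar>\<tau>\<bar> + \<bar>\<alpha>\<bar> * (2 * \<bar>t - t0\<bar> + 2)) * d y y'" by simp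
      ultimately show ?thesis by (simp only: le_add_same_cancel1 add_nonneg_nonneg)
    qed
    finally show ?thesis .
  qed
  then show "\<exists>L. \<forall>s s' y y'. y \<in> M \<longrightarrow> y' \<in> M \<longrightarrow> \<bar>s - t\<bar> < 1 \<longrightarrow> \<bar>s' - t\<bar> < 1 \<longrightarrow>
     d x y < 1 \<longrightarrow> d x y' < 1 \<longrightarrow>
     \<bar>(\<lambda>(t, x). \<tau> * (t - t0) + \<alpha> * (t - t0)\<^sup>2 + \<beta> * d x x0 + \<epsilon> * d x x1) (s, y) -
      (\<lambda>(t, x). \<tau> * (t - t0) + \<alpha> * (t - t0)\<^sup>2 + \<beta> * d x x0 + \<epsilon> * d x x1) (s', y')\<bar>
       \<le> L * (\<bar>s - s'\<bar> + d y y')"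
    by (intro exI[of _ L]) simp
qed

lemma locally_lipschitz_add:
  assumes "locally_lipschitz M d u" "locally_lipschitz M d v"
  shows "locally_lipschitz M d (\<lambda>z. u z + v z)"
  unfolding locally_lipschitz_def
proof
  fix z :: "real \<times> 'a" assume z: "z \<in> {0<..} \<times> M"
  obtain U L where U: "openin (spacetime M d) U" "z \<in> U"
    "\<forall>(t, x)\<in>U. \<forall>(s, y)\<in>U. \<bar>u (t, x) - u (s, y)\<bar> \<le> L * (\<bar>t - s\<bar> + d x y)"
    using assms(1) z unfolding locally_lipschitz_def by blast
  obtain V K where V: "openin (spacetime M d) V" "z \<in> V"
    "\<forall>(t, x)\<in>V. \<forall>(s, y)\<in>V. \<bar>v (t, x) - v (s, y)\<bar> \<le> K * (\<bar>t - s\<bar> + d x y)"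
    using assms(2) z unfolding locally_lipschitz_def by blast
  have "\<bar>(u (t, x) + v (t, x)) - (u (s, y) + v (s, y))\<bar> \<le> (L + K) * (\<bar>t - s\<bar> + d x y)"
    if "(t, x) \<in> U \<inter> V" "(s, y) \<in> U \<inter> V" for t x s y
  proof -
    have "\<bar>u (t, x) - u (s, y)\<bar> \<le> L * (\<bar>t - s\<bar> + d x y)" using U(3) that by blast
    moreover have "\<bar>v (t, x) - v (s, y)\<bar> \<le> K * (\<bar>t - s\<bar> + d x y)" using V(3) that by blast
    ultimately show ?thesis unfolding distrib_right[of L K] by linarith
  qed
  then show "\<exists>U L. openin (spacetime M d) U \<and> z \<in> U \<and> (\<forall>(t, x)\<in>U. \<forall>(s, y)\<in>U.
      \<bar>(u (t, x) + v (t, x)) - (u (s, y) + v (s, y))\<bar> \<le> L * (\<bar>t - s\<bar> + d x y))"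
    using U(1,2) V(1,2) by (intro exI[of _ "U \<inter> V"] exI[of _ "L + K"]) auto
qed

lemma locally_lipschitz_paraboloid:
  fixes t0 \<tau> \<alpha> D :: real
  assumes "x0 \<in> M" "y0 \<in> M" "0 \<le> \<beta>" "0 \<le> c"
  shows "locally_lipschitz M d
    (\<lambda>(t, x). \<tau> * (t - t0) + \<alpha> * (t - t0)\<^sup>2 + \<beta> * d x x0 + c * ((d x y0)\<^sup>2 - D))"
proof -
  have const: "locally_lipschitz M d (\<lambda>(t, x). b)" for b
    by (rule locally_lipschitzI) (auto intro!: exI[of _ 0])
  \<comment> \<open>A cone whose second vertex carries weight 0, a squared distance and a
    constant.\<close>
  have eq: "(\<lambda>(t, x). \<tau> * (t - t0) + \<alpha> * (t - t0)\<^sup>2 + \<beta> * d x x0 + c * ((d x y0)\<^sup>2 - D)) =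
    (\<lambda>z. (\<lambda>(t, x). \<tau> * (t - t0) + \<alpha> * (t - t0)\<^sup>2 + \<beta> * d x x0 + 0 * d x x0) z +
         ((\<lambda>(t, x). c * (d x y0)\<^sup>2) z + (\<lambda>(t, x). - (c * D)) z))"
    by (auto simp: fun_eq_iff algebra_simps)
  show ?thesis unfolding eq
    by (intro locally_lipschitz_add locally_lipschitz_cone locally_lipschitz_sq_mdist const assms order_refl)
qed

text \<open>The time terms cancel in spatial differences and distances are 1-Lipschitz, so the bound
  holds for the slope at every point before the envelope is taken.\<close>

lemma usc_env_slope_cone_le:
  fixes t0 \<tau> \<alpha> :: real
  assumes "x0 \<in> M" "x1 \<in> M" "0 \<le> \<beta>" "0 \<le> \<epsilon>" "0 < t" "x \<in> M"
  defines "\<psi> \<equiv> \<lambda>(t, x). \<tau> * (t - t0) + \<alpha> * (t - t0)\<^sup>2 + \<beta> * d x x0 + \<epsilon> * d x x1"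
  shows "real_of_ereal (usc_env (spacetime M d) (slope M d \<psi>) (t, x)) \<le> \<beta> + \<epsilon>"
proof -
  have "slope M d \<psi> (s, y) \<le> \<beta> + \<epsilon>" if "y \<in> M" for s y
    unfolding slope_def
  proof (rule slope_with_le(2))
    have "\<bar>\<psi> (s, z) - \<psi> (s, y)\<bar> \<le> (\<beta> + \<epsilon>) * d y z" if z: "z \<in> M" for z
    proof -
      have "\<bar>\<beta> * d y x0 - \<beta> * d z x0\<bar> \<le> \<beta> * d y z" "\<bar>\<epsilon> * d y x1 - \<epsilon> * d z x1\<bar> \<le> \<epsilon> * d y z"
        using \<open>y \<in> M\<close> z assms by (intro mult_mdist_diff_le; simp)+
      then show ?thesis unfolding \<psi>_def prod.case distrib_right by linarith
    qed
    then show "\<exists>r>0. \<forall>z\<in>M. 0 < d y z \<longrightarrow> d y z < r \<longrightarrow> \<bar>\<psi> (s, z) - \<psi> (s, y)\<bar> \<le> (\<beta> + \<epsilon>) * d y z"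
      by (intro exI[of _ 1]) simp
  qed (use that assms in auto)
  then have "usc_env (spacetime M d) (slope M d \<psi>) (t, x) \<le> ereal (\<beta> + \<epsilon>)"
    using assms(5,6) by (intro usc_env_le exI[of _ 1]) auto
  moreover have "0 \<le> usc_env (spacetime M d) (slope M d \<psi>) (t, x)"
    unfolding \<psi>_def by (intro usc_env_slope_finite locally_lipschitz_cone assms)
  ultimately show ?thesis
    by (cases "usc_env (spacetime M d) (slope M d \<psi>) (t, x)") auto
qed

end

context geodesic_space
begin

text \<open>The squared distance is the part with continuous, descending slope. Everything else,
  including the distance to \<open>x1\<close> meant for the Ekeland perturbation, goes into
  \<open>\<psi>2\<close>, on which no one-sided slope condition is imposed.\<close>

lemma sub_test_cone:
  fixes t0 \<tau> \<alpha> :: real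
  assumes "x0 \<in> M" "x1 \<in> M" "y0 \<in> M" "0 \<le> \<beta>" "0 \<le> \<epsilon>" "0 \<le> c"
  defines "\<psi>1 \<equiv> \<lambda>(t, x). c * (d x y0)\<^sup>2"
    and "\<psi>2 \<equiv> \<lambda>(t, x). \<tau> * (t - t0) + \<alpha> * (t - t0)\<^sup>2 + \<beta> * d x x0 + \<epsilon> * d x x1"
  shows "sub_test M d \<psi>1 \<psi>2"
    and "x \<in> M \<Longrightarrow> slope M d \<psi>1 (t, x) = 2 * c * d x y0"
    and "time_deriv (\<lambda>z. \<psi>1 z + \<psi>2 z) (t, x) = \<tau> + 2 * \<alpha> * (t - t0)"
proof -
  have s: "slope M d \<psi>1 (t, x) = 2 * c * d x y0" "slope_minus M d \<psi>1 (t, x) = 2 * c * d x y0"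
    if "x \<in> M" for t x
    unfolding \<psi>1_def slope_def slope_minus_def
    by (rule slope_with_sq_mdist; use assms that in auto)+
  then show "x \<in> M \<Longrightarrow> slope M d \<psi>1 (t, x) = 2 * c * d x y0" by blast
  have ll: "locally_lipschitz M d \<psi>1" "locally_lipschitz M d \<psi>2"
    unfolding \<psi>1_def \<psi>2_def
    by (intro locally_lipschitz_sq_mdist locally_lipschitz_cone assms)+
  have "C1_in_time M d \<psi>1"
    by (rule C1_in_timeI[of _ "\<lambda>_. 0"]) (auto simp: \<psi>1_def)
  moreover have "C1_in_time M d \<psi>2"
    by (rule C1_in_timeI[of _ "\<lambda>t. \<tau> + 2 * \<alpha> * (t - t0)"])
      (auto simp: \<psi>2_def intro!: derivative_eq_intros continuous_intros)
  moreover have "continuous_map (spacetime M d) euclideanreal (slope M d \<psi>1)"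
  proof (rule continuous_map_spacetimeI)
    fix t :: real and x and e :: real assume a: "0 < t" "x \<in> M" "0 < e"
    have "\<bar>slope M d \<psi>1 (s, y) - slope M d \<psi>1 (t, x)\<bar> < e"
      if y: "y \<in> M" "d x y < e / (2 * c + 1)" for s y
    proof -
      have "\<bar>2 * c * d x y0 - 2 * c * d y y0\<bar> \<le> 2 * c * d x y"
        using a y assms by (intro mult_mdist_diff_le) auto
      also have "\<dots> \<le> (2 * c + 1) * d x y" by (intro mult_right_mono) auto
      also have "\<dots> < e" using y(2) assms(6) by (simp add: pos_less_divide_eq mult.commute)
      finally show ?thesis using s(1) a(2) y(1) by (simp add: abs_minus_commute)
    qed
    then show "\<exists>r>0. \<forall>s>0. \<forall>y\<in>M. \<bar>s - t\<bar> < r \<longrightarrow> d x y < r \<longrightarrow>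
        \<bar>slope M d \<psi>1 (s, y) - slope M d \<psi>1 (t, x)\<bar> < e"
      using a assms(6) by (intro exI[of _ "e / (2 * c + 1)"]) auto
  qed
  ultimately show "sub_test M d \<psi>1 \<psi>2"
    using ll s by (auto simp: sub_test_def C1_minus_def)
  have "((\<lambda>s. \<psi>1 (s, x) + \<psi>2 (s, x)) has_field_derivative (\<tau> + 2 * \<alpha> * (t - t0))) (at t)"
    unfolding \<psi>1_def \<psi>2_def by (auto intro!: derivative_eq_intros)
  then show "time_deriv (\<lambda>z. \<psi>1 z + \<psi>2 z) (t, x) = \<tau> + 2 * \<alpha> * (t - t0)"
    by (simp add: time_deriv_def DERIV_imp_deriv)
qed

section \<open>Maxima of perturbed subsolutions\<close>

text \<open>Closed time intervals are compact, so the perturbation may involve space only. An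
  increasing sequence that is Cauchy in space has a spatial limit by completeness and a limit in
  time along a subsequence; upper semicontinuity bounds its values by the one at the limit.\<close>

lemma ekeland_cylinder:
  fixes F :: "real \<times> 'a \<Rightarrow> real" and t0 \<rho> :: real
  assumes x0: "x0 \<in> M" and eps: "0 < \<epsilon>"
  defines "Q \<equiv> {(t, x). \<bar>t - t0\<bar> \<le> \<rho> \<and> x \<in> M \<and> d x x0 \<le> \<rho>}"
  assumes z1: "z1 \<in> Q" and bdd: "\<And>z. z \<in> Q \<Longrightarrow> F z \<le> B"
    and usc: "\<And>t x e. (t, x) \<in> Q \<Longrightarrow> 0 < e \<Longrightarrow>
      \<exists>r>0. \<forall>s y. (s, y) \<in> Q \<longrightarrow> \<bar>s - t\<bar> < r \<longrightarrow> d x y < r \<longrightarrow> F (s, y) \<le> F (t, x) + e"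
  obtains t x where "(t, x) \<in> Q" "F z1 \<le> F (t, x)" "\<And>s y. (s, y) \<in> Q \<Longrightarrow> F (s, y) \<le> F (t, x) + \<epsilon> * d x y"
proof -
  have "\<exists>z\<in>Q. F z1 \<le> F z \<and> (\<forall>w\<in>Q. F w \<le> F z + \<epsilon> * d (snd z) (snd w))"
  proof (rule ekeland_pseudometric[OF z1 eps bdd])
    fix \<sigma> :: "nat \<Rightarrow> real \<times> 'a"
    assume \<sigma>: "\<And>k. \<sigma> k \<in> Q" and mono: "\<And>k. F (\<sigma> k) \<le> F (\<sigma> (Suc k))"
      and cau: "\<And>e. 0 < e \<Longrightarrow> \<exists>N. \<forall>m\<ge>N. \<forall>n\<ge>m. d (snd (\<sigma> m)) (snd (\<sigma> n)) < e"
    have \<sigma>M: "snd (\<sigma> k) \<in> M" "d (snd (\<sigma> k)) x0 \<le> \<rho>" "fst (\<sigma> k) \<in> cball t0 \<rho>" for k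
      using \<sigma>[of k] by (auto simp: Q_def split_beta dist_real_def abs_minus_commute)
    have "MCauchy (\<lambda>k. snd (\<sigma> k))"
      unfolding MCauchy_def
    proof (intro conjI allI impI)
      fix e :: real assume "0 < e"
      then obtain N where N: "\<And>m n. m \<ge> N \<Longrightarrow> n \<ge> m \<Longrightarrow> d (snd (\<sigma> m)) (snd (\<sigma> n)) < e"
        using cau by blast
      have "d (snd (\<sigma> m)) (snd (\<sigma> n)) < e" if "N \<le> m" "N \<le> n" for m n
        using N[of m n] N[of n m] that commute[of "snd (\<sigma> m)" "snd (\<sigma> n)"] by (cases "m \<le> n") auto
      then show "\<exists>N. \<forall>n n'. N \<le> n \<longrightarrow> N \<le> n' \<longrightarrow> d (snd (\<sigma> n)) (snd (\<sigma> n')) < e" by blast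
    qed (use \<sigma>M in auto)
    then obtain x where "limitin mtopology (\<lambda>k. snd (\<sigma> k)) x sequentially"
      using complete unfolding mcomplete_def by blast
    then have x: "x \<in> M" "\<And>e. 0 < e \<Longrightarrow> \<forall>\<^sub>F k in sequentially. d (snd (\<sigma> k)) x < e"
      unfolding limitin_metric by (auto elim: eventually_mono)
    have lim: "(\<lambda>k. d (snd (\<sigma> k)) x) \<longlonglongrightarrow> 0"
      using x(2) by (auto simp: tendsto_iff)
    obtain t h where th: "t \<in> cball t0 \<rho>" "strict_mono (h :: nat \<Rightarrow> nat)"
      "((\<lambda>k. fst (\<sigma> k)) \<circ> h) \<longlonglongrightarrow> t"
      using compact_cball[of t0 \<rho>] \<sigma>M(3) unfolding compact_def by metis
    have limh: "(\<lambda>k. d (snd (\<sigma> (h k))) x) \<longlonglongrightarrow> 0"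
      using LIMSEQ_subseq_LIMSEQ[OF lim th(2)] by (simp add: o_def)
    have "d x x0 \<le> d (snd (\<sigma> k)) x + \<rho>" for k
      using triangle[of x "snd (\<sigma> k)" x0] x(1) \<sigma>M(1,2)[of k] x0 commute[of x "snd (\<sigma> k)"] by simp
    moreover have "(\<lambda>k. d (snd (\<sigma> k)) x + \<rho>) \<longlonglongrightarrow> 0 + \<rho>" by (intro tendsto_intros lim)
    ultimately have "d x x0 \<le> 0 + \<rho>" by (intro LIMSEQ_le_const) auto
    then have Q: "(t, x) \<in> Q" using th(1) x(1) by (auto simp: Q_def dist_real_def abs_minus_commute)
    have "F (\<sigma> k) \<le> F (t, x)" for k
    proof (rule field_le_epsilon)
      fix e :: real assume "0 < e"
      then obtain r where r: "r > 0"
        "\<And>s y. (s, y) \<in> Q \<Longrightarrow> \<bar>s - t\<bar> < r \<Longrightarrow> d x y < r \<Longrightarrow> F (s, y) \<le> F (t, x) + e"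
        using usc[OF Q] by blast
      have "\<forall>\<^sub>F j in sequentially. \<bar>fst (\<sigma> (h j)) - t\<bar> < r"
        using tendstoD[OF th(3) r(1)] by (simp add: dist_real_def)
      moreover have "\<forall>\<^sub>F j in sequentially. d (snd (\<sigma> (h j))) x < r"
        using tendstoD[OF limh r(1)] by simp
      ultimately have "\<forall>\<^sub>F j in sequentially. j \<ge> k \<and> \<bar>fst (\<sigma> (h j)) - t\<bar> < r \<and> d (snd (\<sigma> (h j))) x < r"
        using eventually_ge_at_top[of k] by eventually_elim simp
      then obtain j where j: "j \<ge> k" "\<bar>fst (\<sigma> (h j)) - t\<bar> < r" "d (snd (\<sigma> (h j))) x < r"
        by (auto simp: eventually_sequentially)
      \<comment> \<open>Here \<open>k \<le> j \<le> h j\<close>.\<close>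
      have "F (\<sigma> k) \<le> F (\<sigma> (h j))"
        by (rule lift_Suc_mono_le[of "\<lambda>k. F (\<sigma> k)", OF mono order.trans[OF j(1) seq_suble[OF th(2)]]])
      also have "F (\<sigma> (h j)) \<le> F (t, x) + e"
        using r(2)[of "fst (\<sigma> (h j))" "snd (\<sigma> (h j))"] \<sigma>[of "h j"] j(2,3)
        by (simp add: commute[of x])
      finally show "F (\<sigma> k) \<le> F (t, x) + e" .
    qed
    then show "\<exists>z\<in>Q. (\<forall>k. F (\<sigma> k) \<le> F z) \<and> (\<lambda>k. d (snd (\<sigma> k)) (snd z)) \<longlonglongrightarrow> 0"
      using Q lim by (intro bexI[of _ "(t, x)"]) auto
  qed (auto simp: Q_def intro: triangle)
  then obtain z where "z \<in> Q" "F z1 \<le> F z" "\<forall>w\<in>Q. F w \<le> F z + \<epsilon> * d (snd z) (snd w)" by blast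
  then show ?thesis using that[of "fst z" "snd z"] by force
qed

text \<open>Ekeland's principle on the closed cylinder gives a near-maximum of
  \<open>G - \<Phi>\<close> that becomes exact once a multiple of the distance is added to the test
  function. By \<open>interior\<close> it lies inside the cylinder, so the viscosity inequality
  applies there; the slack \<open>e\<close> turns the infimum in \<open>H_lower\<close> into an
  actual slope \<open>p\<close>.\<close>

lemma subsolution_perturbed_maximum:
  fixes u :: "real \<times> 'a \<Rightarrow> real" and t0 \<rho> \<tau> \<alpha> D :: real
  assumes sub: "metric_viscosity_subsolution M d H u"
    and pts: "x0 \<in> M" "y0 \<in> M" and \<rho>: "\<rho> < t0"
    and coeff: "0 \<le> c" "0 \<le> \<beta>" "0 < \<epsilon>" "0 < e"
    and G_def: "G = (\<lambda>z. real_of_ereal (usc_env (spacetime M d) u z))"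
    and \<Phi>_def: "\<Phi> = (\<lambda>(t, x). \<tau> * (t - t0) + \<alpha> * (t - t0)\<^sup>2 + \<beta> * d x x0 + c * ((d x y0)\<^sup>2 - D))"
    and bound: "\<And>t x. \<bar>t - t0\<bar> \<le> \<rho> \<Longrightarrow> x \<in> M \<Longrightarrow> d x x0 \<le> \<rho> \<Longrightarrow> G (t, x) - \<Phi> (t, x) \<le> B"
    and start: "\<bar>t1 - t0\<bar> \<le> \<rho>" "x1 \<in> M" "d x1 x0 \<le> \<rho>"
    and interior: "\<And>t x. \<bar>t - t0\<bar> \<le> \<rho> \<Longrightarrow> x \<in> M \<Longrightarrow> d x x0 \<le> \<rho> \<Longrightarrow>
      G (t1, x1) - \<Phi> (t1, x1) \<le> G (t, x) - \<Phi> (t, x) \<Longrightarrow> \<bar>t - t0\<bar> < \<rho> \<and> d x x0 < \<rho>"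
  obtains t x p where "\<bar>t - t0\<bar> < \<rho>" "x \<in> M" "d x x0 < \<rho>"
    "G (t1, x1) - \<Phi> (t1, x1) \<le> G (t, x) - \<Phi> (t, x)"
    "0 \<le> p" "\<bar>p - 2 * c * d x y0\<bar> \<le> \<beta> + \<epsilon>" "H t x (G (t, x)) p < - (\<tau> + 2 * \<alpha> * (t - t0)) + e"
proof -
  let ?Q = "{(t, x). \<bar>t - t0\<bar> \<le> \<rho> \<and> x \<in> M \<and> d x x0 \<le> \<rho>}"
  let ?F = "\<lambda>z. G z - \<Phi> z"
  define \<psi>1 where "\<psi>1 = (\<lambda>(t::real, x). c * (d x y0)\<^sup>2)"
  have fin: "\<forall>z\<in>{0<..} \<times> M. \<bar>usc_env (spacetime M d) u z\<bar> \<noteq> \<infinity>"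
    using sub by (simp add: metric_viscosity_subsolution_def)
  have lip: "locally_lipschitz M d \<Phi>"
    unfolding \<Phi>_def by (intro locally_lipschitz_paraboloid pts coeff)
  have pos: "0 < t" if "\<bar>t - t0\<bar> \<le> \<rho>" for t using that \<rho> by linarith
  have usc: "\<exists>r>0. \<forall>s y. (s, y) \<in> ?Q \<longrightarrow> \<bar>s - t\<bar> < r \<longrightarrow> d x y < r \<longrightarrow> ?F (s, y) \<le> ?F (t, x) + e"
    if tx: "(t, x) \<in> ?Q" and "0 < e" for t x e
  proof -
    have t: "0 < t" "x \<in> M" using tx pos by auto
    have "usc_env (spacetime M d) u (t, x) = ereal (G (t, x))"
      using fin t unfolding G_def by (simp add: ereal_real')
    then have "usc_env (spacetime M d) u (t, x) < ereal (G (t, x) + e / 2)" using \<open>0 < e\<close> by simp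
    then obtain r1 where r1: "r1 > 0"
      "\<And>s y. s>0 \<Longrightarrow> y\<in>M \<Longrightarrow> \<bar>s - t\<bar> < r1 \<Longrightarrow> d x y < r1 \<Longrightarrow> G (s, y) \<le> G (t, x) + e / 2"
      using usc_env_usc[OF t _ fin] unfolding G_def by blast
    obtain r2 where r2: "r2 > 0"
      "\<And>s y. s>0 \<Longrightarrow> y\<in>M \<Longrightarrow> \<bar>s - t\<bar> < r2 \<Longrightarrow> d x y < r2 \<Longrightarrow> \<bar>\<Phi> (s, y) - \<Phi> (t, x)\<bar> < e / 2"
      using locally_lipschitz_continuous[OF lip t, of "e / 2"] \<open>0 < e\<close> by auto
    have "?F (s, y) \<le> ?F (t, x) + e"
      if "(s, y) \<in> ?Q" "\<bar>s - t\<bar> < min r1 r2" "d x y < min r1 r2" for s y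
    proof -
      have sy: "s > 0" "y \<in> M" using that(1) pos by auto
      have "G (s, y) \<le> G (t, x) + e / 2" using sy that by (intro r1(2)) auto
      moreover have "\<bar>\<Phi> (s, y) - \<Phi> (t, x)\<bar> < e / 2" using sy that by (intro r2(2)) auto
      ultimately show ?thesis by linarith
    qed
    then show ?thesis using r1(1) r2(1) by (intro exI[of _ "min r1 r2"]) simp
  qed
  obtain t x where tx: "(t, x) \<in> ?Q" "?F (t1, x1) \<le> ?F (t, x)"
    "\<And>s y. (s, y) \<in> ?Q \<Longrightarrow> ?F (s, y) \<le> ?F (t, x) + \<epsilon> * d x y"
    by (rule ekeland_cylinder[OF pts(1) coeff(3), of "(t1, x1)" t0 \<rho> ?F B])
      (use start bound usc in auto)
  have int: "\<bar>t - t0\<bar> < \<rho>" "d x x0 < \<rho>" "x \<in> M" using interior[of t x] tx by auto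
  have t: "0 < t" using pos int by simp
  \<comment> \<open>The Ekeland distance is centred at the contact point \<open>x\<close>, where it
    vanishes.\<close>
  define \<psi>2 where "\<psi>2 = (\<lambda>(t, y). \<tau> * (t - t0) + \<alpha> * (t - t0)\<^sup>2 + \<beta> * d y x0 + \<epsilon> * d y x)"
  have \<epsilon>: "0 \<le> \<epsilon>" using coeff by simp
  note cone = pts(1) int(3) pts(2) coeff(2) \<epsilon> coeff(1)
  have st: "sub_test M d \<psi>1 \<psi>2" "slope M d \<psi>1 (t, x) = 2 * c * d x y0"
    "time_deriv (\<lambda>z. \<psi>1 z + \<psi>2 z) (t, x) = \<tau> + 2 * \<alpha> * (t - t0)"
    using sub_test_cone[OF cone] int(3) unfolding \<psi>1_def \<psi>2_def by blast+
  have "local_max_at (spacetime M d) (\<lambda>z. G z - (\<psi>1 z + \<psi>2 z)) (t, x)"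
    unfolding local_max_at_def
  proof (intro exI conjI ballI)
    show "openin (spacetime M d) {(s, y). 0 < s \<and> y \<in> M \<and> \<bar>s - t0\<bar> < \<rho> \<and> d x0 y < \<rho>}"
      by (rule openin_spacetime_cylinder[OF pts(1)])
    show "(t, x) \<in> {(s, y). 0 < s \<and> y \<in> M \<and> \<bar>s - t0\<bar> < \<rho> \<and> d x0 y < \<rho>}"
      using int t by (simp add: commute)
    fix w assume "w \<in> {(s, y). 0 < s \<and> y \<in> M \<and> \<bar>s - t0\<bar> < \<rho> \<and> d x0 y < \<rho>}"
    then obtain s y where w: "w = (s, y)" "y \<in> M" "(s, y) \<in> ?Q" by (auto simp: commute)
    have "\<psi>1 z + \<psi>2 z = \<Phi> z + c * D + \<epsilon> * d (snd z) x" for z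
      by (cases z) (simp add: \<Phi>_def \<psi>1_def \<psi>2_def right_diff_distrib)
    then show "G w - (\<psi>1 w + \<psi>2 w) \<le> G (t, x) - (\<psi>1 (t, x) + \<psi>2 (t, x))"
      using tx(3)[OF w(3)] w int(3) by (simp add: commute[of y x])
  qed
  then have ineq: "ereal (time_deriv (\<lambda>z. \<psi>1 z + \<psi>2 z) (t, x)) +
      H_lower H (real_of_ereal (usc_env (spacetime M d) (slope M d \<psi>2) (t, x)))
        t x (G (t, x)) (slope M d \<psi>1 (t, x)) \<le> 0"
    using sub st(1) t int(3) unfolding metric_viscosity_subsolution_def G_def by blast
  \<comment> \<open>A larger radius in \<open>H_lower\<close> gives a smaller infimum, so the
    envelope may be replaced by its bound \<open>\<beta> + \<epsilon>\<close>.\<close>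
  have "real_of_ereal (usc_env (spacetime M d) (slope M d \<psi>2) (t, x)) \<le> \<beta> + \<epsilon>"
    unfolding \<psi>2_def by (intro usc_env_slope_cone_le pts int(3) coeff \<epsilon> t)
  then have "H_lower H (\<beta> + \<epsilon>) t x (G (t, x)) (2 * c * d x y0) \<le>
      H_lower H (real_of_ereal (usc_env (spacetime M d) (slope M d \<psi>2) (t, x)))
        t x (G (t, x)) (slope M d \<psi>1 (t, x))"
    unfolding st(2) by (rule H_lower_antimono)
  then have "ereal (\<tau> + 2 * \<alpha> * (t - t0)) + H_lower H (\<beta> + \<epsilon>) t x (G (t, x)) (2 * c * d x y0) \<le> 0"
    using ineq unfolding st(3) by (meson add_left_mono order.trans)
  then have "H_lower H (\<beta> + \<epsilon>) t x (G (t, x)) (2 * c * d x y0) \<le> ereal (- (\<tau> + 2 * \<alpha> * (t - t0)))"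
    by (cases "H_lower H (\<beta> + \<epsilon>) t x (G (t, x)) (2 * c * d x y0)") auto
  also have "\<dots> < ereal (- (\<tau> + 2 * \<alpha> * (t - t0)) + e)" using coeff(4) by simp
  finally obtain p where "0 \<le> p" "\<bar>p - 2 * c * d x y0\<bar> \<le> \<beta> + \<epsilon>"
    "H t x (G (t, x)) p < - (\<tau> + 2 * \<alpha> * (t - t0)) + e"
    unfolding H_lower_def INF_less_iff by auto
  then show ?thesis using that int tx(2) by blast
qed

end

section \<open>Replacing a test function by a touching paraboloid\<close>

context Metric_space
begin

text \<open>By continuity of \<open>g\<close> its upper limit at the point is its value. Used to
  pass a paraboloid bound from a function to its envelope.\<close>

lemma usc_env_le_of_le_locally_lipschitz:
  assumes "locally_lipschitz M d g" "0 < t" "x \<in> M"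
    and "\<exists>r>0. \<forall>s>0. \<forall>y\<in>M. \<bar>s - t\<bar> < r \<longrightarrow> d x y < r \<longrightarrow> f (s, y) \<le> g (s, y) + b"
  shows "usc_env (spacetime M d) f (t, x) \<le> ereal (g (t, x) + b)"
proof (rule ereal_le_epsilon2)
  fix e :: real assume "0 < e"
  obtain r1 where r1: "r1 > 0" "\<And>s y. s>0 \<Longrightarrow> y\<in>M \<Longrightarrow> \<bar>s - t\<bar> < r1 \<Longrightarrow> d x y < r1 \<Longrightarrow> f (s, y) \<le> g (s, y) + b"
    using assms(4) by blast
  obtain r2 where r2: "r2 > 0" "\<And>s y. s>0 \<Longrightarrow> y\<in>M \<Longrightarrow> \<bar>s - t\<bar> < r2 \<Longrightarrow> d x y < r2 \<Longrightarrow> \<bar>g (s, y) - g (t, x)\<bar> < e"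
    using locally_lipschitz_continuous[OF assms(1-3) \<open>0 < e\<close>] by blast
  have "f (s, y) \<le> g (t, x) + b + e"
    if "s > 0" "y \<in> M" "\<bar>s - t\<bar> < min r1 r2" "d x y < min r1 r2" for s y
    using r1(2)[of s y] r2(2)[of s y] that by (simp add: abs_less_iff)
  then have "usc_env (spacetime M d) f (t, x) \<le> ereal (g (t, x) + b + e)"
    using assms(2,3) r1(1) r2(1) by (intro usc_env_le exI[of _ "min r1 r2"]) auto
  then show "usc_env (spacetime M d) f (t, x) \<le> ereal (g (t, x) + b) + ereal e" by simp
qed

text \<open>Mean value inequality in time for \<open>u\<close> minus its linear part. Joint
  continuity of the time derivative makes the remainder uniform in nearby \<open>x\<close>.\<close>

lemma C1_in_time_taylor:
  assumes u: "C1_in_time M d u" and "0 < t0" "x0 \<in> M" "0 < e"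
  shows "\<exists>r>0. \<forall>t>0. \<forall>x\<in>M. \<bar>t - t0\<bar> < r \<longrightarrow> d x0 x < r \<longrightarrow>
    \<bar>u (t, x) - u (t0, x) - time_deriv u (t0, x0) * (t - t0)\<bar> \<le> e * \<bar>t - t0\<bar>"
proof -
  let ?\<tau> = "time_deriv u (t0, x0)"
  obtain r where r: "r > 0" "\<And>s y. s>0 \<Longrightarrow> y\<in>M \<Longrightarrow> \<bar>s - t0\<bar> < r \<Longrightarrow> d x0 y < r \<Longrightarrow>
      \<bar>time_deriv u (s, y) - ?\<tau>\<bar> < e"
    using continuous_map_spacetimeD[of "time_deriv u" t0 x0 e] assms by (auto simp: C1_in_time_def)
  have "\<bar>u (t, x) - u (t0, x) - ?\<tau> * (t - t0)\<bar> \<le> e * \<bar>t - t0\<bar>"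
    if tx: "t > 0" "x \<in> M" "\<bar>t - t0\<bar> < r" "d x0 x < r" for t x
  proof -
    let ?S = "{0<..} \<inter> ball t0 r"
    let ?g = "\<lambda>s. u (s, x) - ?\<tau> * s"
    have "norm (?g t - ?g t0) \<le> e * norm (t - t0)"
    proof (rule field_differentiable_bound)
      show "convex ?S" by (intro convex_Int) auto
      fix s assume s: "s \<in> ?S"
      then have "(\<lambda>s. u (s, x)) field_differentiable (at s)"
        using u tx(2) by (auto simp: C1_in_time_def)
      then have "((\<lambda>s. u (s, x)) has_field_derivative time_deriv u (s, x)) (at s)"
        by (simp add: time_deriv_def field_differentiable_derivI)
      then have "(?g has_field_derivative (time_deriv u (s, x) - ?\<tau>)) (at s)"
        by (auto intro!: derivative_eq_intros)
      then show "(?g has_field_derivative (time_deriv u (s, x) - ?\<tau>)) (at s within ?S)"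
        by (rule has_field_derivative_at_within)
      show "norm (time_deriv u (s, x) - ?\<tau>) \<le> e"
        using r(2)[of s x] s tx by (auto simp: dist_real_def abs_minus_commute)
    qed (use tx assms(2) r(1) in \<open>auto simp: dist_real_def abs_minus_commute\<close>)
    then show ?thesis by (simp add: algebra_simps)
  qed
  then show ?thesis using r(1) by blast
qed

end

text \<open>The viscosity inequality only sees \<open>\<psi>\<^sub>1\<close> through its slope, so \<open>\<psi>\<^sub>1\<close> may be replaced by a
  squared distance to a point \<open>y\<close> in the direction of steepest descent, and \<open>\<psi>\<^sub>2\<close> by a cone. Unlike
  arbitrary test functions, these make sense on every \<open>X\<^sub>n\<close>.\<close>

lemma (in geodesic_space) sub_test_touching_paraboloid:
  fixes t0 \<epsilon> r0 :: real
  assumes test: "sub_test M d \<psi>1 \<psi>2" and z0: "0 < t0" "x0 \<in> M"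
    and max: "local_max_at (spacetime M d) (\<lambda>z. G z - (\<psi>1 z + \<psi>2 z)) (t0, x0)"
    and \<epsilon>: "0 < \<epsilon>" and r0: "0 < r0"
  defines "p \<equiv> slope M d \<psi>1 (t0, x0)"
    and "a \<equiv> real_of_ereal (usc_env (spacetime M d) (slope M d \<psi>2) (t0, x0))"
    and "\<tau> \<equiv> time_deriv (\<lambda>z. \<psi>1 z + \<psi>2 z) (t0, x0)"
  obtains r c y where "0 < r" "r < r0" "r < t0" "y \<in> M" "d x0 y \<le> r" "0 \<le> c" "2 * c * r \<le> p + \<epsilon>"
    "\<bar>2 * c * d x0 y - p\<bar> \<le> \<epsilon>"
    "\<And>t x. \<bar>t - t0\<bar> \<le> r \<Longrightarrow> x \<in> M \<Longrightarrow> d x x0 \<le> r \<Longrightarrow>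
       G (t, x) \<le> G (t0, x0) + 3 * \<epsilon> * r + \<tau> * (t - t0) + \<epsilon> / r * (t - t0)\<^sup>2
         + (a + 2 * \<epsilon>) * d x x0 + c * ((d x y)\<^sup>2 - (d x0 y)\<^sup>2)"
proof -
  have ll: "locally_lipschitz M d \<psi>1" "locally_lipschitz M d \<psi>2"
    and C1: "C1_in_time M d \<psi>1" "C1_in_time M d \<psi>2"
    and cont: "continuous_map (spacetime M d) euclideanreal (slope M d \<psi>1)"
    and minus: "slope_minus M d \<psi>1 (t0, x0) = p"
    using test z0 by (auto simp: sub_test_def C1_minus_def p_def)
  have p: "0 \<le> p" unfolding p_def by (rule slope_nonneg[OF ll(1) z0])
  have \<tau>: "\<tau> = time_deriv \<psi>1 (t0, x0) + time_deriv \<psi>2 (t0, x0)"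
    unfolding \<tau>_def by (rule time_deriv_add[OF C1 z0])
  obtain U where "openin (spacetime M d) U" "(t0, x0) \<in> U"
    "\<And>w. w \<in> U \<Longrightarrow> G w - (\<psi>1 w + \<psi>2 w) \<le> G (t0, x0) - (\<psi>1 (t0, x0) + \<psi>2 (t0, x0))"
    using max unfolding local_max_at_def by blast
  then obtain r1 where r1: "r1 > 0" "\<And>t x. t > 0 \<Longrightarrow> x \<in> M \<Longrightarrow> \<bar>t - t0\<bar> < r1 \<Longrightarrow> d x0 x < r1 \<Longrightarrow>
      G (t, x) - (\<psi>1 (t, x) + \<psi>2 (t, x)) \<le> G (t0, x0) - (\<psi>1 (t0, x0) + \<psi>2 (t0, x0))"
    unfolding openin_spacetime by metis
  obtain r2 where r2: "r2 > 0" "\<And>t x. t > 0 \<Longrightarrow> x \<in> M \<Longrightarrow> \<bar>t - t0\<bar> < r2 \<Longrightarrow> d x0 x < r2 \<Longrightarrow>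
      \<bar>slope M d \<psi>1 (t, x) - p\<bar> < \<epsilon>"
    using continuous_map_spacetimeD[OF cont z0 \<epsilon>] unfolding p_def by blast
  have "usc_env (spacetime M d) (slope M d \<psi>2) (t0, x0) < ereal (a + \<epsilon>)"
    using usc_env_slope_finite[OF ll(2) z0] \<epsilon> unfolding a_def
    by (cases "usc_env (spacetime M d) (slope M d \<psi>2) (t0, x0)") auto
  from usc_env_lessD[OF z0 this] obtain r3 where r3: "r3 > 0"
    "\<And>t x. t > 0 \<Longrightarrow> x \<in> M \<Longrightarrow> \<bar>t - t0\<bar> < r3 \<Longrightarrow> d x0 x < r3 \<Longrightarrow> slope M d \<psi>2 (t, x) < a + \<epsilon>"
    by blast
  obtain r4 where r4: "r4 > 0" "\<And>t x. t > 0 \<Longrightarrow> x \<in> M \<Longrightarrow> \<bar>t - t0\<bar> < r4 \<Longrightarrow> d x0 x < r4 \<Longrightarrow>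
      \<bar>\<psi>1 (t, x) - \<psi>1 (t0, x) - time_deriv \<psi>1 (t0, x0) * (t - t0)\<bar> \<le> \<epsilon> / 2 * \<bar>t - t0\<bar>"
    using C1_in_time_taylor[OF C1(1) z0, of "\<epsilon> / 2"] \<epsilon> by auto
  obtain r5 where r5: "r5 > 0" "\<And>t x. t > 0 \<Longrightarrow> x \<in> M \<Longrightarrow> \<bar>t - t0\<bar> < r5 \<Longrightarrow> d x0 x < r5 \<Longrightarrow>
      \<bar>\<psi>2 (t, x) - \<psi>2 (t0, x) - time_deriv \<psi>2 (t0, x0) * (t - t0)\<bar> \<le> \<epsilon> / 2 * \<bar>t - t0\<bar>"
    using C1_in_time_taylor[OF C1(2) z0, of "\<epsilon> / 2"] \<epsilon> by auto
  \<comment> \<open>Common radius for the maximum, both slope bounds and both expansions, not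
    exceeding \<open>r0\<close> and \<open>t0\<close>.\<close>
  define R where "R = min (min (min r1 r2) (min r3 r4)) (min (min r5 r0) t0)"
  have R: "0 < R" "R \<le> r1" "R \<le> r2" "R \<le> r3" "R \<le> r4" "R \<le> r5" "R \<le> r0" "R \<le> t0"
    using r1(1) r2(1) r3(1) r4(1) r5(1) r0 z0(1) by (simp_all add: R_def min_le_iff_disj)

  \<comment> \<open>First the spatial estimate for \<open>\<psi>1\<close> at the fixed time
    \<open>t0\<close>. If \<open>p = 0\<close>, the choice \<open>c = 0\<close> suffices, as nearby
    slopes are below \<open>\<epsilon>\<close>.\<close>
  have "\<exists>r c y. 0 < r \<and> 3 * r < R \<and> y \<in> M \<and> d x0 y \<le> r \<and> 0 \<le> c \<and> 2 * c * r \<le> p + \<epsilon> \<and>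
    \<bar>2 * c * d x0 y - p\<bar> \<le> \<epsilon> \<and>
    (\<forall>x\<in>M. d x0 x \<le> r \<longrightarrow> \<psi>1 (t0, x) \<le>
       \<psi>1 (t0, x0) + 2 * \<epsilon> * r + \<epsilon> * d x0 x + c * ((d x y)\<^sup>2 - (d x0 y)\<^sup>2))"
  proof (cases "p = 0")
    case True
    have "\<psi>1 (t0, x) \<le> \<psi>1 (t0, x0) + 2 * \<epsilon> * (R / 4) + \<epsilon> * d x0 x"
      if x: "x \<in> M" "d x0 x \<le> R / 4" for x
    proof -
      have "\<bar>\<psi>1 (t0, x) - \<psi>1 (t0, x0)\<bar> \<le> \<epsilon> * d x0 x"
      proof (rule slope_lipschitz[OF ll(1) z0 x(1)])
        fix z assume z: "z \<in> M" "d x0 z \<le> d x0 x"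
        then have "\<bar>slope M d \<psi>1 (t0, z) - p\<bar> < \<epsilon>" using r2(1) R(1,3) x z0 by (intro r2(2)) auto
        then show "slope M d \<psi>1 (t0, z) < \<epsilon>" using True by simp
      qed
      moreover have "0 \<le> 2 * \<epsilon> * (R / 4)" using \<epsilon> R(1) by simp
      ultimately show ?thesis by linarith
    qed
    then show ?thesis using R(1) z0 \<epsilon> True
      by (intro exI[of _ "R / 4"] exI[of _ 0] exI[of _ x0]) auto
  next
    case False
    \<comment> \<open>\<open>K\<close> is \<open>p - \<epsilon>\<close> cut off at 0, still below
      the descending slope because \<open>p > 0\<close>.\<close>
    define K where "K = max 0 (p - \<epsilon>)"
    have K: "0 \<le> K" "K < slope_with (\<lambda>a. max (- a) 0) M d \<psi>1 (t0, x0)" "p - \<epsilon> \<le> K"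
      using p False \<epsilon> minus by (auto simp: K_def slope_minus_def)
    obtain y where y: "y \<in> M" "0 < d x0 y" "d x0 y < R / 4"
      "K * d x0 y < max (- (\<psi>1 (t0, y) - \<psi>1 (t0, x0))) 0"
      by (rule slope_with_lessE[OF z0(2) _ K(1,2), of "R / 4"]) (use R(1) in auto)
    define r where "r = d x0 y"
    \<comment> \<open>With this \<open>c\<close> the squared distance has slope
      \<open>p + \<epsilon>\<close> at distance \<open>r\<close> from \<open>y\<close>.\<close>
    define c where "c = (p + \<epsilon>) / (2 * r)"
    have r: "0 < r" "r < R / 4" using y by (auto simp: r_def)
    have "0 \<le> K * r" using K(1) r by simp
    then have "K * r < \<psi>1 (t0, x0) - \<psi>1 (t0, y)" using y(4) unfolding r_def by linarith
    moreover have "(p - \<epsilon>) * r \<le> K * r" using K(3) r by (intro mult_right_mono) auto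
    ultimately have descent: "\<psi>1 (t0, y) \<le> \<psi>1 (t0, x0) - (p - \<epsilon>) * r" by linarith
    have "\<psi>1 (t0, x) \<le> \<psi>1 (t0, x0) + 2 * \<epsilon> * r + \<epsilon> * d x0 x + c * ((d x y)\<^sup>2 - (d x0 y)\<^sup>2)"
      if x: "x \<in> M" "d x0 x \<le> r" for x
    proof -
      \<comment> \<open>Points no farther from \<open>y\<close> than \<open>x\<close> is are then
        within \<open>3 * r < R\<close> of \<open>x0\<close>, where the slope bound is
        available.\<close>
      have dxy: "d y x \<le> 2 * r" using triangle[of y x0 x] x y z0 by (simp add: r_def commute)
      have "\<bar>\<psi>1 (t0, x) - \<psi>1 (t0, y)\<bar> \<le> (p + \<epsilon>) * d y x"
      proof (rule slope_lipschitz[OF ll(1) z0(1) y(1) x(1)])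
        fix z assume z: "z \<in> M" "d y z \<le> d y x"
        have "d x0 z \<le> r + d y z" using triangle[of x0 y z] z y z0 by (simp add: r_def)
        then have "d x0 z < R" using z(2) dxy r by linarith
        then have "\<bar>slope M d \<psi>1 (t0, z) - p\<bar> < \<epsilon>" using r2(1) R(1,3) z z0 by (intro r2(2)) auto
        then show "slope M d \<psi>1 (t0, z) < p + \<epsilon>" by linarith
      qed
      \<comment> \<open>AM-GM, with equality at distance \<open>r\<close> and hence at \<open>x0\<close>\<close>
      also have "(p + \<epsilon>) * d y x \<le> (p + \<epsilon>) * ((d x y)\<^sup>2 / (2 * r) + r / 2)"
      proof (rule mult_left_mono)
        have "0 \<le> (d x y - r)\<^sup>2 / (2 * r)" using r by simp
        also have "\<dots> = (d x y)\<^sup>2 / (2 * r) + r / 2 - d x y"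
          using r by (simp add: power2_eq_square field_simps)
        finally show "d y x \<le> (d x y)\<^sup>2 / (2 * r) + r / 2" by (simp add: commute)
      qed (use p \<epsilon> in simp)
      also have "\<dots> = c * ((d x y)\<^sup>2 - (d x0 y)\<^sup>2) + (p + \<epsilon>) * r"
        using r by (simp add: c_def r_def[symmetric] power2_eq_square field_simps)
      finally have "\<psi>1 (t0, x) \<le> \<psi>1 (t0, x0) - (p - \<epsilon>) * r + c * ((d x y)\<^sup>2 - (d x0 y)\<^sup>2) + (p + \<epsilon>) * r"
        using descent by linarith
      \<comment> \<open>Slope \<open>p - \<epsilon>\<close> on the way down to \<open>y\<close> and
        \<open>p + \<epsilon>\<close> on the way back leave a loss of only
        \<open>2 * \<epsilon> * r\<close>.\<close>
      moreover have "(p + \<epsilon>) * r - (p - \<epsilon>) * r = 2 * \<epsilon> * r" by (simp add: algebra_simps)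
      moreover have "0 \<le> \<epsilon> * d x0 x" using \<epsilon> by simp
      ultimately show ?thesis by linarith
    qed
    moreover have "2 * c * r = p + \<epsilon>" "0 \<le> c" using r p \<epsilon> by (auto simp: c_def)
    ultimately show ?thesis using r y(1) R \<epsilon>
      by (intro exI[of _ r] exI[of _ c] exI[of _ y]) (auto simp: r_def[symmetric])
  qed
  then obtain r c y where r: "0 < r" "3 * r < R" and y: "y \<in> M" "d x0 y \<le> r"
    and c: "0 \<le> c" "2 * c * r \<le> p + \<epsilon>" "\<bar>2 * c * d x0 y - p\<bar> \<le> \<epsilon>"
    and \<psi>1: "\<And>x. x \<in> M \<Longrightarrow> d x0 x \<le> r \<Longrightarrow> \<psi>1 (t0, x) \<le>
       \<psi>1 (t0, x0) + 2 * \<epsilon> * r + \<epsilon> * d x0 x + c * ((d x y)\<^sup>2 - (d x0 y)\<^sup>2)" by blast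
  show ?thesis
  proof (rule that[of r y c])
    fix t x assume tx: "\<bar>t - t0\<bar> \<le> r" "x \<in> M" "d x x0 \<le> r"
    have rR: "r < R" using r by simp
    then have t: "0 < t" using R(8) tx(1) by linarith
    have dx: "d x0 x \<le> r" "d x0 x < R" "\<bar>t - t0\<bar> < R" using tx rR by (auto simp: commute)
    have *: "G (t, x) - (\<psi>1 (t, x) + \<psi>2 (t, x)) \<le> G (t0, x0) - (\<psi>1 (t0, x0) + \<psi>2 (t0, x0))"
      using t tx dx R by (intro r1(2)) auto
    have **: "\<bar>\<psi>1 (t, x) - \<psi>1 (t0, x) - time_deriv \<psi>1 (t0, x0) * (t - t0)\<bar> \<le> \<epsilon> / 2 * \<bar>t - t0\<bar>"
      using t tx dx R by (intro r4(2)) auto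
    have ***: "\<bar>\<psi>2 (t, x) - \<psi>2 (t0, x) - time_deriv \<psi>2 (t0, x0) * (t - t0)\<bar> \<le> \<epsilon> / 2 * \<bar>t - t0\<bar>"
      using t tx dx R by (intro r5(2)) auto
    \<comment> \<open>Slopes of \<open>\<psi>2\<close> near the contact point stay below its
      envelope there plus \<open>\<epsilon>\<close>, whence the cone.\<close>
    have \<psi>2: "\<bar>\<psi>2 (t0, x) - \<psi>2 (t0, x0)\<bar> \<le> (a + \<epsilon>) * d x0 x"
      using tx(2)
    proof (rule slope_lipschitz[OF ll(2) z0])
      fix z assume "z \<in> M" "d x0 z \<le> d x0 x"
      then show "slope M d \<psi>2 (t0, z) < a + \<epsilon>" using dx(2) r3(1) R z0 by (intro r3(2)) auto
    qed
    \<comment> \<open>AM-GM again: the error linear in \<open>\<bar>t - t0\<bar>\<close> becomes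
      quadratic at the price of \<open>\<epsilon> * r\<close>, which makes the total constant
      \<open>3 * \<epsilon> * r\<close>.\<close>
    have "\<bar>t - t0\<bar> \<le> (t - t0)\<^sup>2 / r + r"
    proof -
      have "0 \<le> (\<bar>t - t0\<bar> - r)\<^sup>2 / r" using r by simp
      also have "\<dots> = (t - t0)\<^sup>2 / r + r - 2 * \<bar>t - t0\<bar>"
        using r by (simp add: power2_diff power2_eq_square[of r] add_divide_distrib diff_divide_distrib)
      finally have "2 * \<bar>t - t0\<bar> \<le> (t - t0)\<^sup>2 / r + r" by simp
      moreover have "\<bar>t - t0\<bar> \<le> 2 * \<bar>t - t0\<bar>" by simp
      ultimately show ?thesis by (rule order.trans[rotated])
    qed
    from mult_left_mono[OF this less_imp_le[OF \<epsilon>]]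
    have "\<epsilon> * \<bar>t - t0\<bar> \<le> \<epsilon> / r * (t - t0)\<^sup>2 + \<epsilon> * r" by (simp add: distrib_left)
    moreover have "\<tau> * (t - t0) = time_deriv \<psi>1 (t0, x0) * (t - t0) + time_deriv \<psi>2 (t0, x0) * (t - t0)"
      unfolding \<tau> by (rule distrib_right)
    moreover have "(a + 2 * \<epsilon>) * d x x0 = (a + \<epsilon>) * d x0 x + \<epsilon> * d x0 x"
      by (simp add: commute[of x x0] distrib_right)
    moreover have "3 * \<epsilon> * r = 2 * \<epsilon> * r + \<epsilon> * r" "\<epsilon> / 2 * \<bar>t - t0\<bar> + \<epsilon> / 2 * \<bar>t - t0\<bar> = \<epsilon> * \<bar>t - t0\<bar>" by simp_all
    moreover have "\<psi>1 (t, x) \<le> \<psi>1 (t0, x) + time_deriv \<psi>1 (t0, x0) * (t - t0) + \<epsilon> / 2 * \<bar>t - t0\<bar>"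
      using abs_le_D1[OF **] by linarith
    moreover have "\<psi>2 (t, x) \<le> \<psi>2 (t0, x) + time_deriv \<psi>2 (t0, x0) * (t - t0) + \<epsilon> / 2 * \<bar>t - t0\<bar>"
      using abs_le_D1[OF ***] by linarith
    moreover have "\<psi>2 (t0, x) \<le> \<psi>2 (t0, x0) + (a + \<epsilon>) * d x0 x" using abs_le_D1[OF \<psi>2] by linarith
    ultimately show "G (t, x) \<le> G (t0, x0) + 3 * \<epsilon> * r + \<tau> * (t - t0) + \<epsilon> / r * (t - t0)\<^sup>2
         + (a + 2 * \<epsilon>) * d x x0 + c * ((d x y)\<^sup>2 - (d x0 y)\<^sup>2)"
      using * \<psi>1[OF tx(2) dx(1)] by linarith
  qed (use r y c R in auto)
qed

section \<open>Supersolutions as negatives of subsolutions\<close>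

lemma usc_env_uminus: "usc_env T (\<lambda>z. - f z) z = - lsc_env T f z"
  unfolding usc_env_def lsc_env_def by (simp add: ereal_Limsup_uminus flip: uminus_ereal.simps)

text \<open>The sign in the third argument is cancelled by evaluating at \<open>- r\<close>, so only
  the exchange of infimum and supremum remains.\<close>

lemma H_lower_uminus:
  "H_lower (\<lambda>t x r p. - H t x (- r) p) a t x (- r) p = - H_upper H a t x r p"
  unfolding H_lower_def H_upper_def by (simp add: ereal_INF_uminus_eq flip: uminus_ereal.simps)

lemma ereal_uminus_add_le_zero_iff: "ereal (- a) + - b \<le> 0 \<longleftrightarrow> 0 \<le> ereal a + b"
  by (cases b) auto

context Metric_space
begin

lemma slope_uminus [simp]:
  "slope M d (\<lambda>z. - u z) = slope M d u"
  "slope_plus M d (\<lambda>z. - u z) = slope_minus M d u"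
  "slope_minus M d (\<lambda>z. - u z) = slope_plus M d u"
proof -
  have "- a - - b = - (a - b)" "- (- a - - b) = a - b" "\<bar>- a - - b\<bar> = \<bar>a - b\<bar>" for a b :: real
    by simp_all
  then show "slope M d (\<lambda>z. - u z) = slope M d u"
    "slope_plus M d (\<lambda>z. - u z) = slope_minus M d u"
    "slope_minus M d (\<lambda>z. - u z) = slope_plus M d u"
    unfolding slope_def slope_plus_def slope_minus_def slope_with_def by presburger+
qed

lemma locally_lipschitz_uminus: "locally_lipschitz M d u \<Longrightarrow> locally_lipschitz M d (\<lambda>z. - u z)"
  unfolding locally_lipschitz_def by (simp add: abs_minus_commute)

lemma time_deriv_uminus:
  assumes "C1_in_time M d u" "0 < t" "x \<in> M"
  shows "time_deriv (\<lambda>z. - u z) (t, x) = - time_deriv u (t, x)"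
  using assms by (auto simp: time_deriv_def C1_in_time_def field_differentiable_derivI
      intro!: DERIV_imp_deriv DERIV_minus)

lemma C1_in_time_uminus:
  assumes "C1_in_time M d u"
  shows "C1_in_time M d (\<lambda>z. - u z)"
proof -
  have "continuous_map (spacetime M d) euclideanreal (\<lambda>z. - time_deriv u z)"
    using assms by (intro continuous_map_minus) (simp add: C1_in_time_def)
  \<comment> \<open>The two functions are compared only on the underlying space of the topology,
    where \<open>u\<close> is differentiable in time.\<close>
  then have "continuous_map (spacetime M d) euclideanreal (time_deriv (\<lambda>z. - u z))"
    by (rule continuous_map_eq) (auto simp: time_deriv_uminus[OF assms])
  then show ?thesis using assms by (auto simp: C1_in_time_def intro: field_differentiable_minus)
qed

lemma sub_test_uminus: "super_test M d \<psi>1 \<psi>2 \<Longrightarrow> sub_test M d (\<lambda>z. - \<psi>1 z) (\<lambda>z. - \<psi>2 z)"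
  and super_test_uminus: "sub_test M d \<psi>1 \<psi>2 \<Longrightarrow> super_test M d (\<lambda>z. - \<psi>1 z) (\<lambda>z. - \<psi>2 z)"
  by (auto simp: super_test_def sub_test_def C1_plus_def C1_minus_def
      intro: locally_lipschitz_uminus C1_in_time_uminus)

lemma time_deriv_test_uminus:
  assumes "C1_in_time M d \<psi>1" "C1_in_time M d \<psi>2" "0 < t" "x \<in> M"
  shows "time_deriv (\<lambda>z. - \<psi>1 z + - \<psi>2 z) (t, x) = - time_deriv (\<lambda>z. \<psi>1 z + \<psi>2 z) (t, x)"
  unfolding time_deriv_add[OF C1_in_time_uminus[OF assms(1)] C1_in_time_uminus[OF assms(2)] assms(3,4)]
    time_deriv_add[OF assms] time_deriv_uminus[OF assms(1,3,4)] time_deriv_uminus[OF assms(2,3,4)]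
  by simp

text \<open>A change of sign exchanges the envelopes of \<open>u\<close>, local minima and maxima,
  ascending and descending slopes, and the two modified Hamiltonians, and leaves the full slope
  unchanged.\<close>

lemma supersolution_iff_subsolution_uminus:
  "metric_viscosity_supersolution M d H u \<longleftrightarrow>
   metric_viscosity_subsolution M d (\<lambda>t x r p. - H t x (- r) p) (\<lambda>z. - u z)" (is "?L \<longleftrightarrow> ?R")
proof -
  let ?T = "spacetime M d"
  have fin: "\<bar>usc_env ?T (\<lambda>z. - u z) z\<bar> = \<bar>lsc_env ?T u z\<bar>" for z
    by (simp add: usc_env_uminus)
  have ext: "local_min_at ?T (\<lambda>z. real_of_ereal (lsc_env ?T u z) - (\<psi>1 z + \<psi>2 z)) w \<longleftrightarrow>
      local_max_at ?T (\<lambda>z. real_of_ereal (usc_env ?T (\<lambda>z. - u z) z) - (- \<psi>1 z + - \<psi>2 z)) w" for \<psi>1 \<psi>2 w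
  proof -
    have "real_of_ereal (usc_env ?T (\<lambda>z. - u z) z) - (- \<psi>1 z + - \<psi>2 z) =
      - (real_of_ereal (lsc_env ?T u z) - (\<psi>1 z + \<psi>2 z))" for z
      by (simp add: usc_env_uminus)
    then show ?thesis unfolding local_min_at_def local_max_at_def by (simp only: neg_le_iff_le)
  qed
  have uminus_real: "real_of_ereal (- b) = - real_of_ereal b" for b by simp
  have ineq: "ereal (time_deriv (\<lambda>z. - \<psi>1 z + - \<psi>2 z) (t, x)) +
            H_lower (\<lambda>t x r p. - H t x (- r) p) (real_of_ereal (usc_env ?T (slope M d (\<lambda>z. - \<psi>2 z)) (t, x)))
              t x (real_of_ereal (usc_env ?T (\<lambda>z. - u z) (t, x))) (slope M d (\<lambda>z. - \<psi>1 z) (t, x)) \<le> 0 \<longleftrightarrow>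
         ereal (time_deriv (\<lambda>z. \<psi>1 z + \<psi>2 z) (t, x)) +
            H_upper H (real_of_ereal (usc_env ?T (slope M d \<psi>2) (t, x)))
              t x (real_of_ereal (lsc_env ?T u (t, x))) (slope M d \<psi>1 (t, x)) \<ge> 0"
    if "C1_in_time M d \<psi>1" "C1_in_time M d \<psi>2" "0 < t" "x \<in> M" for \<psi>1 \<psi>2 t x
    using that by (simp only: time_deriv_test_uminus usc_env_uminus slope_uminus uminus_real
        H_lower_uminus ereal_uminus_add_le_zero_iff)
  show ?thesis
  proof
    assume L: ?L
    have L1: "\<bar>lsc_env ?T u z\<bar> \<noteq> \<infinity>" if "z \<in> {0<..} \<times> M" for z
      using L[unfolded metric_viscosity_supersolution_def] that by (elim conjE) (rule bspec)
    show ?R unfolding metric_viscosity_subsolution_def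
    proof (intro conjI allI impI ballI)
      fix \<psi>1 \<psi>2 t x
      assume a: "sub_test M d \<psi>1 \<psi>2" "0 < (t::real)" "x \<in> M"
        "local_max_at ?T (\<lambda>z. real_of_ereal (usc_env ?T (\<lambda>z. - u z) z) - (\<psi>1 z + \<psi>2 z)) (t, x)"
      have C: "C1_in_time M d (\<lambda>z. - \<psi>1 z)" "C1_in_time M d (\<lambda>z. - \<psi>2 z)"
        using super_test_uminus[OF a(1)] by (auto simp: super_test_def)
      have "local_min_at ?T (\<lambda>z. real_of_ereal (lsc_env ?T u z) - (- \<psi>1 z + - \<psi>2 z)) (t, x)"
        using ext[of "\<lambda>z. - \<psi>1 z" "\<lambda>z. - \<psi>2 z"] a(4) by simp
      then have "ereal (time_deriv (\<lambda>z. - \<psi>1 z + - \<psi>2 z) (t, x)) +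
            H_upper H (real_of_ereal (usc_env ?T (slope M d (\<lambda>z. - \<psi>2 z)) (t, x)))
              t x (real_of_ereal (lsc_env ?T u (t, x))) (slope M d (\<lambda>z. - \<psi>1 z) (t, x)) \<ge> 0"
        using L super_test_uminus[OF a(1)] a(2,3) unfolding metric_viscosity_supersolution_def by blast
      then show "ereal (time_deriv (\<lambda>z. \<psi>1 z + \<psi>2 z) (t, x)) +
            H_lower (\<lambda>t x r p. - H t x (- r) p) (real_of_ereal (usc_env ?T (slope M d \<psi>2) (t, x)))
              t x (real_of_ereal (usc_env ?T (\<lambda>z. - u z) (t, x))) (slope M d \<psi>1 (t, x)) \<le> 0"
        using ineq[OF C a(2,3)] by simp
    qed (simp add: fin L1)
  next
    assume R: ?R
    have R1: "\<bar>lsc_env ?T u z\<bar> \<noteq> \<infinity>" if "z \<in> {0<..} \<times> M" for z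
      using R[unfolded metric_viscosity_subsolution_def fin] that by (elim conjE) (rule bspec)
    show ?L unfolding metric_viscosity_supersolution_def
    proof (intro conjI allI impI ballI)
      fix \<psi>1 \<psi>2 t x
      assume a: "super_test M d \<psi>1 \<psi>2" "0 < (t::real)" "x \<in> M"
        "local_min_at ?T (\<lambda>z. real_of_ereal (lsc_env ?T u z) - (\<psi>1 z + \<psi>2 z)) (t, x)"
      have C: "C1_in_time M d \<psi>1" "C1_in_time M d \<psi>2"
        using a(1) by (auto simp: super_test_def)
      have "ereal (time_deriv (\<lambda>z. - \<psi>1 z + - \<psi>2 z) (t, x)) +
            H_lower (\<lambda>t x r p. - H t x (- r) p) (real_of_ereal (usc_env ?T (slope M d (\<lambda>z. - \<psi>2 z)) (t, x)))
              t x (real_of_ereal (usc_env ?T (\<lambda>z. - u z) (t, x))) (slope M d (\<lambda>z. - \<psi>1 z) (t, x)) \<le> 0"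
        using R sub_test_uminus[OF a(1)] a(2,3) a(4)[unfolded ext]
        unfolding metric_viscosity_subsolution_def by blast
      then show "ereal (time_deriv (\<lambda>z. \<psi>1 z + \<psi>2 z) (t, x)) +
            H_upper H (real_of_ereal (usc_env ?T (slope M d \<psi>2) (t, x)))
              t x (real_of_ereal (lsc_env ?T u (t, x))) (slope M d \<psi>1 (t, x)) \<ge> 0"
        unfolding ineq[OF C a(2,3)] .
    qed (simp add: R1)
  qed
qed

end

section \<open>Converging sequences of spaces\<close>

text \<open>Compactness produces points along a subsequence, while the hypotheses and the semilimits
  refer to full sequences; here \<open>b\<close>, placed at the indices \<open>h k\<close>, is
  completed by \<open>a\<close>.\<close>

lemma tendsto_interleave:
  fixes a :: "nat \<Rightarrow> 'b::metric_space"
  assumes "strict_mono h" "a \<longlonglongrightarrow> l" "b \<longlonglongrightarrow> l"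
  obtains c where "c \<longlonglongrightarrow> l" "\<And>k. c (h k) = b k" "\<And>n. c n = a n \<or> (\<exists>k. n = h k)"
proof -
  have inj: "inj h" using assms(1) by (rule strict_mono_imp_inj_on)
  define c where "c n = (if n \<in> range h then b (inv h n) else a n)" for n
  have ch: "c (h k) = b k" for k using inj by (simp add: c_def)
  have "c \<longlonglongrightarrow> l"
  proof (rule metric_LIMSEQ_I)
    fix e :: real assume "0 < e"
    obtain N1 where N1: "\<And>n. n \<ge> N1 \<Longrightarrow> dist (a n) l < e"
      using metric_LIMSEQ_D[OF assms(2) \<open>0 < e\<close>] by blast
    obtain N2 where N2: "\<And>n. n \<ge> N2 \<Longrightarrow> dist (b n) l < e"
      using metric_LIMSEQ_D[OF assms(3) \<open>0 < e\<close>] by blast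
    have "dist (c n) l < e" if n: "n \<ge> max N1 (h N2)" for n
    proof (cases "n \<in> range h")
      case True
      then obtain k where k: "n = h k" by blast
      then have "N2 \<le> k" using n strict_mono_less_eq[OF assms(1), of N2 k] by simp
      then show ?thesis using k ch N2 by simp
    next
      case False
      then show ?thesis using N1 n by (simp add: c_def)
    qed
    then show "\<exists>no. \<forall>n\<ge>no. dist (c n) l < e" by blast
  qed
  moreover have "c n = a n \<or> (\<exists>k. n = h k)" for n by (auto simp: c_def)
  ultimately show ?thesis using that[of c] ch by blast
qed

lemma frequently_sequentially_strict_mono:
  assumes "\<exists>\<^sub>F n in sequentially. P n"
  shows "\<exists>h :: nat \<Rightarrow> nat. strict_mono h \<and> (\<forall>k. P (h k))"
proof -
  have "infinite {n. P n}"
    using assms by (simp add: frequently_cofinite flip: cofinite_eq_sequentially)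
  then show ?thesis using infinite_enumerate by blast
qed

lemma infdist_attained:
  fixes A :: "'a::metric_space set"
  assumes "compact A" "A \<noteq> {}"
  shows "\<exists>y\<in>A. infdist x A = dist x y"
proof -
  obtain y where y: "y \<in> A" "\<And>z. z \<in> A \<Longrightarrow> dist x y \<le> dist x z"
    using continuous_attains_inf[OF assms continuous_on_dist[OF continuous_on_const continuous_on_id, of A x]]
    by blast
  have "dist x y \<le> infdist x A"
    unfolding infdist_notempty[OF assms(2)] using assms(2) y(2) by (intro cINF_greatest)
  then show ?thesis using infdist_le[OF y(1), of x] y(1) by (intro bexI[of _ y]) auto
qed

text \<open>The partition of \<open>[0, 1]\<close> into a single interval already contributes
  \<open>dist x y\<close> to the length of every admissible curve.\<close>

lemma dist_le_length_dist:
  fixes x y :: "'a::metric_space"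
  shows "ereal (dist x y) \<le> length_dist A x y"
  unfolding length_dist_def
proof (rule INF_greatest)
  fix \<gamma> :: "real \<Rightarrow> 'a"
  assume "\<gamma> \<in> {\<gamma>. path \<gamma> \<and> path_image \<gamma> \<subseteq> A \<and> pathstart \<gamma> = x \<and> pathfinish \<gamma> = y}"
  then have \<gamma>: "\<gamma> 0 = x" "\<gamma> 1 = y" by (auto simp: pathstart_def pathfinish_def)
  have "(1, real) \<in> {(k::nat, s::nat \<Rightarrow> real). s 0 = 0 \<and> s k = 1 \<and> (\<forall>i<k. s i \<le> s (Suc i))}"
    by simp
  then have "(\<lambda>(k, s). ereal (\<Sum>i<k. dist (\<gamma> (s i)) (\<gamma> (s (Suc i))))) (1, real) \<le> curve_length \<gamma>"
    unfolding curve_length_def by (rule SUP_upper)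
  then show "ereal (dist x y) \<le> curve_length \<gamma>" using \<gamma> by simp
qed

text \<open>Index \<open>\<infinity>\<close> is the limit space. With \<open>dist_finite\<close> the
  passage from \<open>length_dist\<close> to the real-valued \<open>intrinsic_metric\<close> is
  faithful.\<close>

locale converging_spaces =
  fixes X :: "enat \<Rightarrow> 'a::metric_space set"
  assumes X_compact: "\<And>n. compact (X n)"
    and X_nonempty: "\<And>n. X n \<noteq> {}"
    and dist_finite: "\<And>n x y. x \<in> X n \<Longrightarrow> y \<in> X n \<Longrightarrow> length_dist (X n) x y < \<infinity>"
    and geodesic_spaces: "\<And>n. complete_geodesic_space (X n) (intrinsic_metric (X n))"
    and hausdorff_conv:
      "(\<lambda>n::nat. max (SUP x\<in>X (enat n). infdist x (X \<infinity>)) (SUP x\<in>X \<infinity>. infdist x (X (enat n))))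
         \<longlonglongrightarrow> 0"
    and dist_conv: "\<And>a b as bs. a \<in> X \<infinity> \<Longrightarrow> b \<in> X \<infinity> \<Longrightarrow>
      as \<in> approx_seqs X a \<Longrightarrow> bs \<in> approx_seqs X b \<Longrightarrow>
      (\<lambda>n. intrinsic_metric (X (enat n)) (as n) (bs n)) \<longlonglongrightarrow> intrinsic_metric (X \<infinity>) a b"
begin

abbreviation D :: "enat \<Rightarrow> 'a \<Rightarrow> 'a \<Rightarrow> real" where "D n \<equiv> intrinsic_metric (X n)"

sublocale S: geodesic_space "X n" "D n" for n
  using geodesic_spaces complete_geodesic_space_iff by blast

lemma dist_le_D: "x \<in> X n \<Longrightarrow> y \<in> X n \<Longrightarrow> dist x y \<le> D n x y"
  using dist_le_length_dist[of x y "X n"] dist_finite[of x n y]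
  by (cases "length_dist (X n) x y") (auto simp: intrinsic_metric_def)

lemma infdist_tendsto_0:
  assumes "strict_mono h" "\<And>k. x k \<in> X (enat (h k))"
  shows "(\<lambda>k. infdist (x k) (X \<infinity>)) \<longlonglongrightarrow> 0"
proof (rule tendsto_sandwich[OF _ _ tendsto_const])
  let ?f = "\<lambda>n::nat. max (SUP x\<in>X (enat n). infdist x (X \<infinity>)) (SUP x\<in>X \<infinity>. infdist x (X (enat n)))"
  show "(\<lambda>k. ?f (h k)) \<longlonglongrightarrow> 0"
    using LIMSEQ_subseq_LIMSEQ[OF hausdorff_conv assms(1)] by (simp add: o_def)
  \<comment> \<open>Compactness bounds the distances above; over an unbounded set the real
    \<open>SUP\<close> would carry no information.\<close>
  have "infdist (x k) (X \<infinity>) \<le> (SUP x\<in>X (enat (h k)). infdist x (X \<infinity>))" for k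
    by (intro cSUP_upper assms(2) bounded_imp_bdd_above compact_imp_bounded
        compact_continuous_image X_compact continuous_intros)
  then show "\<forall>\<^sub>F k in sequentially. infdist (x k) (X \<infinity>) \<le> ?f (h k)"
    by (simp add: max.coboundedI1)
qed (simp add: infdist_nonneg)

text \<open>Nearest points to \<open>x\<close> in each \<open>X (enat n)\<close> converge to
  \<open>x\<close> by the second half of the Hausdorff condition.\<close>

lemma approx_seqs_nonempty:
  assumes "x \<in> X \<infinity>"
  obtains xs where "xs \<in> approx_seqs X x"
proof -
  have "\<exists>y\<in>X (enat n). infdist x (X (enat n)) = dist x y" for n
    by (intro infdist_attained X_compact X_nonempty)
  then obtain xs where xs: "\<And>n. xs n \<in> X (enat n)" "\<And>n. infdist x (X (enat n)) = dist x (xs n)"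
    by metis
  have "(\<lambda>n. dist (xs n) x) \<longlonglongrightarrow> 0"
  proof (rule tendsto_sandwich[OF _ _ tendsto_const hausdorff_conv])
    have "infdist x (X (enat n)) \<le> (SUP x\<in>X \<infinity>. infdist x (X (enat n)))" for n
      by (intro cSUP_upper assms bounded_imp_bdd_above compact_imp_bounded
          compact_continuous_image X_compact continuous_intros)
    then show "\<forall>\<^sub>F n in sequentially. dist (xs n) x \<le>
        max (SUP x\<in>X (enat n). infdist x (X \<infinity>)) (SUP x\<in>X \<infinity>. infdist x (X (enat n)))"
      using xs(2) by (simp add: dist_commute max.coboundedI2)
  qed simp
  then have "xs \<longlonglongrightarrow> x" by (rule tendsto_dist_iff[THEN iffD2])
  then have "xs \<in> approx_seqs X x" using xs(1) by (simp add: approx_seqs_def)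
  then show ?thesis using that by blast
qed

text \<open>The missing terms are taken from any approximating sequence of \<open>x\<close>.\<close>

lemma approx_seqs_subseq:
  assumes "strict_mono h" "x \<in> X \<infinity>" "\<And>k. xk k \<in> X (enat (h k))" "xk \<longlonglongrightarrow> x"
  obtains xs where "xs \<in> approx_seqs X x" "\<And>k. xs (h k) = xk k"
proof -
  obtain as where as: "as \<in> approx_seqs X x" using approx_seqs_nonempty[OF assms(2)] by blast
  then obtain c where c: "c \<longlonglongrightarrow> x" "\<And>k. c (h k) = xk k" "\<And>n. c n = as n \<or> (\<exists>k. n = h k)"
    using tendsto_interleave[OF assms(1) _ assms(4), of as] by (auto simp: approx_seqs_def)
  have "c n \<in> X (enat n)" for n
    using c(2,3) assms(3) as by (metis (mono_tags, lifting) approx_seqs_def mem_Collect_eq)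
  then show ?thesis using that[of c] c by (simp add: approx_seqs_def)
qed

lemma time_seqs_subseq:
  assumes "strict_mono h" "0 < t" "\<And>k. 0 < tk k" "tk \<longlonglongrightarrow> t"
  obtains ts where "ts \<in> time_seqs t" "\<And>k. ts (h k) = tk k"
proof -
  obtain c where c: "c \<longlonglongrightarrow> t" "\<And>k. c (h k) = tk k" "\<And>n. c n = t \<or> (\<exists>k. n = h k)"
    using tendsto_interleave[OF assms(1) tendsto_const assms(4)] by blast
  have "0 < c n" for n using c(2,3) assms(2,3) by metis
  then show ?thesis using that[of c] c by (simp add: time_seqs_def)
qed

text \<open>Replace each \<open>x k\<close> by a nearest point of the compact limit space and
  extract a convergent subsequence; the first half of the Hausdorff condition makes the replacement
  harmless.\<close>

lemma accumulation_point:
  assumes "strict_mono h" "\<And>k. x k \<in> X (enat (h k))"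
  obtains z g where "z \<in> X \<infinity>" "strict_mono (g :: nat \<Rightarrow> nat)" "(x \<circ> g) \<longlonglongrightarrow> z"
proof -
  have "\<exists>y\<in>X \<infinity>. infdist (x k) (X \<infinity>) = dist (x k) y" for k
    by (intro infdist_attained X_compact X_nonempty)
  then obtain y where y: "\<And>k. y k \<in> X \<infinity>" "\<And>k. infdist (x k) (X \<infinity>) = dist (x k) (y k)" by metis
  obtain z g where z: "z \<in> X \<infinity>" "strict_mono (g :: nat \<Rightarrow> nat)" "(y \<circ> g) \<longlonglongrightarrow> z"
    using X_compact[of \<infinity>] y(1) unfolding compact_def by metis
  have "(\<lambda>k. dist (x k) (y k)) \<longlonglongrightarrow> 0"
    using infdist_tendsto_0[of h x] assms y(2) by simp
  then have "(\<lambda>k. dist (x (g k)) (y (g k))) \<longlonglongrightarrow> 0"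
    using LIMSEQ_subseq_LIMSEQ[OF _ z(2)] by (auto simp: o_def)
  moreover have "(\<lambda>k. dist (y (g k)) z) \<longlonglongrightarrow> 0"
    using tendsto_dist_iff[THEN iffD1, OF z(3)] by (simp add: o_def)
  ultimately have "(\<lambda>k. dist (x (g k)) (y (g k)) + dist (y (g k)) z) \<longlonglongrightarrow> 0"
    by (rule tendsto_add_zero)
  then have "(\<lambda>k. dist (x (g k)) z) \<longlonglongrightarrow> 0"
    by (rule Lim_null_comparison[rotated]) (simp add: dist_triangle)
  then have "(x \<circ> g) \<longlonglongrightarrow> z" unfolding o_def by (rule tendsto_dist_iff[THEN iffD2])
  then show ?thesis using that z by blast
qed

text \<open>\<open>dist_conv\<close> speaks of full sequences, so \<open>xk\<close> is first
  completed to one.\<close>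

lemma D_tendsto_subseq:
  assumes "strict_mono h" "x \<in> X \<infinity>" "\<And>k. xk k \<in> X (enat (h k))" "xk \<longlonglongrightarrow> x"
    and "y \<in> X \<infinity>" "ys \<in> approx_seqs X y"
  shows "(\<lambda>k. D (enat (h k)) (xk k) (ys (h k))) \<longlonglongrightarrow> D \<infinity> x y"
proof -
  obtain xs where xs: "xs \<in> approx_seqs X x" "\<And>k. xs (h k) = xk k"
    using approx_seqs_subseq[OF assms(1-4)] by blast
  show ?thesis
    using LIMSEQ_subseq_LIMSEQ[OF dist_conv[OF assms(2,5) xs(1) assms(6)] assms(1)] xs(2)
    by (simp add: o_def)
qed

section \<open>Semilimits and bounds that persist for large \<open>n\<close>\<close>

text \<open>Once times and points are completed to admissible full sequences, lower bounds along a
  subsequence suffice, because a limsup dominates those of its subsequences.\<close>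

lemma upper_semilimit_ge:
  assumes h: "strict_mono h" and "x \<in> X \<infinity>" "\<And>k. xk k \<in> X (enat (h k))" "xk \<longlonglongrightarrow> x"
    and "0 < t" "\<And>k. 0 < tk k" "tk \<longlonglongrightarrow> t"
    and b: "\<And>k. b k \<le> u (h k) (tk k, xk k)" "b \<longlonglongrightarrow> l"
  shows "ereal l \<le> upper_semilimit X u (t, x)"
proof -
  obtain xs where xs: "xs \<in> approx_seqs X x" "\<And>k. xs (h k) = xk k"
    using approx_seqs_subseq[OF assms(1-4)] by blast
  obtain ts where ts: "ts \<in> time_seqs t" "\<And>k. ts (h k) = tk k"
    using time_seqs_subseq[OF h assms(5-7)] by blast
  have "ereal l = limsup (\<lambda>k. ereal (b k))"
    using b(2) by (intro lim_imp_Limsup[symmetric]) auto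
  also have "\<dots> \<le> limsup ((\<lambda>n. ereal (u n (ts n, xs n))) \<circ> h)"
    using b(1) ts(2) xs(2) by (intro Limsup_mono) (simp add: o_def)
  also have "\<dots> \<le> limsup (\<lambda>n. ereal (u n (ts n, xs n)))"
    by (rule limsup_subseq_mono[OF h])
  also have "\<dots> \<le> upper_semilimit X u (t, x)"
    unfolding upper_semilimit_def prod.case
    using SUP_upper[of "(ts, xs)" "time_seqs t \<times> approx_seqs X x"
        "\<lambda>(ts, xs). limsup (\<lambda>n. ereal (u n (ts n, xs n)))"] ts(1) xs(1) by auto
  finally show ?thesis .
qed

lemma upper_semilimit_greaterE:
  assumes "ereal b < upper_semilimit X u (t, x)"
  obtains ts xs where "ts \<in> time_seqs t" "xs \<in> approx_seqs X x"
    "\<exists>\<^sub>F n in sequentially. b < u n (ts n, xs n)"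
proof -
  obtain ts xs where s: "ts \<in> time_seqs t" "xs \<in> approx_seqs X x"
    "ereal b < limsup (\<lambda>n. ereal (u n (ts n, xs n)))"
    using assms by (auto simp: upper_semilimit_def less_SUP_iff)
  have "\<exists>\<^sub>F n in sequentially. b < u n (ts n, xs n)"
  proof (rule ccontr)
    assume "\<not> (\<exists>\<^sub>F n in sequentially. b < u n (ts n, xs n))"
    then have "\<forall>\<^sub>F n in sequentially. ereal (u n (ts n, xs n)) \<le> ereal b"
      by (simp add: not_frequently not_less)
    then have "limsup (\<lambda>n. ereal (u n (ts n, xs n))) \<le> ereal b" by (rule Limsup_bounded)
    then show False using s(3) by simp
  qed
  then show ?thesis using that s by blast
qed

text \<open>Compactness argument: were the bound with the larger constant \<open>b'\<close> violated
  for infinitely many \<open>n\<close>, the violating points would accumulate in the closed limit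
  cylinder. The distances converge, hence so do the paraboloids, and the semilimit at the
  accumulation point would exceed \<open>bound\<close>.\<close>

lemma eventually_paraboloid_bound:
  fixes t0 \<tau> \<alpha> b b' r C :: real
  assumes fin: "\<forall>z\<in>{0<..} \<times> X \<infinity>. \<bar>upper_semilimit X u z\<bar> \<noteq> \<infinity>"
    and pts: "x0 \<in> X \<infinity>" "y0 \<in> X \<infinity>" "xs \<in> approx_seqs X x0" "ys \<in> approx_seqs X y0"
    and r: "r < t0" and "b < b'"
    and bound: "\<And>t x. \<bar>t - t0\<bar> \<le> r \<Longrightarrow> x \<in> X \<infinity> \<Longrightarrow> D \<infinity> x x0 \<le> r \<Longrightarrow>
      real_of_ereal (upper_semilimit X u (t, x)) \<le>
        b + (\<tau> * (t - t0) + \<alpha> * (t - t0)\<^sup>2 + \<beta> * D \<infinity> x x0 + c * ((D \<infinity> x y0)\<^sup>2 - C))"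
  shows "\<forall>\<^sub>F n in sequentially. \<forall>t x. \<bar>t - t0\<bar> \<le> r \<longrightarrow> x \<in> X (enat n) \<longrightarrow> D (enat n) x (xs n) \<le> r \<longrightarrow>
    u n (t, x) \<le> b' + (\<tau> * (t - t0) + \<alpha> * (t - t0)\<^sup>2 + \<beta> * D (enat n) x (xs n)
      + c * ((D (enat n) x (ys n))\<^sup>2 - C))"
proof (rule ccontr)
  let ?P = "\<lambda>n t x. \<tau> * (t - t0) + \<alpha> * (t - t0)\<^sup>2 + \<beta> * D (enat n) x (xs n) + c * ((D (enat n) x (ys n))\<^sup>2 - C)"
  assume not: "\<not> ?thesis"
  define B where "B n \<longleftrightarrow> (\<exists>t x. \<bar>t - t0\<bar> \<le> r \<and> x \<in> X (enat n) \<and> D (enat n) x (xs n) \<le> r \<and>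
      b' + ?P n t x \<le> u n (t, x))" for n
  have "\<exists>\<^sub>F n in sequentially. B n"
    using not unfolding not_eventually B_def by (rule frequently_elim1) force
  from frequently_sequentially_strict_mono[OF this] obtain h :: "nat \<Rightarrow> nat"
    where h: "strict_mono h" "\<And>k. B (h k)" by blast
  from h(2)[unfolded B_def] obtain tk xk where k: "\<And>k. \<bar>tk k - t0\<bar> \<le> r" "\<And>k. xk k \<in> X (enat (h k))"
    "\<And>k. D (enat (h k)) (xk k) (xs (h k)) \<le> r" "\<And>k. b' + ?P (h k) (tk k) (xk k) \<le> u (h k) (tk k, xk k)"
    by metis
  obtain x g where g: "x \<in> X \<infinity>" "strict_mono (g :: nat \<Rightarrow> nat)" "(xk \<circ> g) \<longlonglongrightarrow> x"
    using accumulation_point[OF h(1) k(2)] by blast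
  have "tk (g j) \<in> cball t0 r" for j using k(1)[of "g j"] by (simp add: dist_real_def abs_minus_commute)
  then obtain t f where f: "t \<in> cball t0 r" "strict_mono (f :: nat \<Rightarrow> nat)" "((\<lambda>j. tk (g j)) \<circ> f) \<longlonglongrightarrow> t"
    using compact_cball[of t0 r] unfolding compact_def by metis
  define q where "q = g \<circ> f"
  have q: "strict_mono (h \<circ> q)" using h(1) g(2) f(2) by (simp add: q_def strict_mono_o)
  have tq: "(\<lambda>j. tk (q j)) \<longlonglongrightarrow> t" using f(3) by (simp add: q_def o_def)
  have xq: "(\<lambda>j. xk (q j)) \<longlonglongrightarrow> x"
    using LIMSEQ_subseq_LIMSEQ[OF g(3) f(2)] by (simp add: q_def o_def)
  have t: "\<bar>t - t0\<bar> \<le> r" using f(1) by (simp add: dist_real_def abs_minus_commute)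
  then have "0 < t" using r by linarith
  have Dx: "(\<lambda>j. D (enat (h (q j))) (xk (q j)) (xs (h (q j)))) \<longlonglongrightarrow> D \<infinity> x x0"
    using D_tendsto_subseq[OF q g(1) _ xq pts(1,3)] k(2) by simp
  have Dy: "(\<lambda>j. D (enat (h (q j))) (xk (q j)) (ys (h (q j)))) \<longlonglongrightarrow> D \<infinity> x y0"
    using D_tendsto_subseq[OF q g(1) _ xq pts(2,4)] k(2) by simp
  have "D \<infinity> x x0 \<le> r" using k(3) by (intro LIMSEQ_le_const2[OF Dx]) auto
  have lim: "(\<lambda>j. b' + ?P (h (q j)) (tk (q j)) (xk (q j))) \<longlonglongrightarrow>
      b' + (\<tau> * (t - t0) + \<alpha> * (t - t0)\<^sup>2 + \<beta> * D \<infinity> x x0 + c * ((D \<infinity> x y0)\<^sup>2 - C))"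
    by (intro tendsto_intros tq Dx Dy)
  have "ereal (b' + (\<tau> * (t - t0) + \<alpha> * (t - t0)\<^sup>2 + \<beta> * D \<infinity> x x0 + c * ((D \<infinity> x y0)\<^sup>2 - C)))
      \<le> upper_semilimit X u (t, x)"
  proof (rule upper_semilimit_ge[OF q g(1) _ xq \<open>0 < t\<close> _ tq _ lim])
    show "0 < tk (q j)" for j using k(1)[of "q j"] r by linarith
  qed (simp_all add: k(2,4))
  moreover have "\<bar>upper_semilimit X u (t, x)\<bar> \<noteq> \<infinity>" using fin \<open>0 < t\<close> g(1) by simp
  ultimately have "b' + (\<tau> * (t - t0) + \<alpha> * (t - t0)\<^sup>2 + \<beta> * D \<infinity> x x0 + c * ((D \<infinity> x y0)\<^sup>2 - C))
      \<le> real_of_ereal (upper_semilimit X u (t, x))"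
    by (cases "upper_semilimit X u (t, x)") auto
  then show False using bound[OF t g(1) \<open>D \<infinity> x x0 \<le> r\<close>] \<open>b < b'\<close> by linarith
qed

end

section \<open>Stability of subsolutions\<close>

context converging_spaces
begin

text \<open>Transfers the touching paraboloid to a single space \<open>X (enat n)\<close> with large
  \<open>n\<close> and perturbs it there. All errors vanish with \<open>r\<close> and
  \<open>\<delta>\<close>, except that \<open>q\<close> may differ from the limit slope by the
  opening \<open>\<beta>\<close> of the cone; this becomes the radius in
  \<open>H_lower\<close>.\<close>

lemma exists_approximate_point:
  fixes t0 \<tau> r \<delta> c \<beta> P :: real and N :: nat
  assumes sub: "\<And>n. metric_viscosity_subsolution (X (enat n)) (D (enat n)) (H (enat n)) (u n)"
    and fin: "\<forall>z\<in>{0<..} \<times> X \<infinity>. \<bar>upper_semilimit X u z\<bar> \<noteq> \<infinity>"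
    and pts: "0 < t0" "x0 \<in> X \<infinity>" "y0 \<in> X \<infinity>" and r: "0 < r" "r < t0" "D \<infinity> x0 y0 \<le> r"
    and coeff: "0 \<le> c" "0 \<le> \<beta>" "2 * c * r \<le> P" and \<delta>: "0 < \<delta>" "\<delta> < 1" and \<epsilon>_eq: "\<epsilon> = \<delta>\<^sup>2 / 32"
    and u0: "u0 = real_of_ereal (upper_semilimit X u (t0, x0))"
    and bound: "\<And>t x. \<bar>t - t0\<bar> \<le> r \<Longrightarrow> x \<in> X \<infinity> \<Longrightarrow> D \<infinity> x x0 \<le> r \<Longrightarrow>
      real_of_ereal (upper_semilimit X u (t, x)) \<le> u0 + 3 * \<epsilon> * r + \<tau> * (t - t0) + \<epsilon> / r * (t - t0)\<^sup>2
         + \<beta> * D \<infinity> x x0 + c * ((D \<infinity> x y0)\<^sup>2 - (D \<infinity> x0 y0)\<^sup>2)"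
  obtains n t x w q where "N \<le> n" "0 < t" "\<bar>t - t0\<bar> \<le> r" "x \<in> X (enat n)" "dist x x0 \<le> 2 * r"
    "\<bar>w - u0\<bar> \<le> (\<bar>\<tau>\<bar> + \<beta> + 4 * P + 7) * r" "0 \<le> q"
    "\<bar>q - 2 * c * D \<infinity> x0 y0\<bar> \<le> \<beta> + 2 * \<delta> + 2 * P * \<delta>" "H (enat n) t x w q < - \<tau> + 3 * \<delta>"
proof -
  define C where "C = (D \<infinity> x0 y0)\<^sup>2"
  have "\<delta>\<^sup>2 \<le> \<delta>" using \<delta> by (simp add: power2_eq_square)
  then have \<epsilon>: "0 < \<epsilon>" "\<epsilon> \<le> \<delta>" "6 * \<epsilon> < \<delta>" "\<epsilon> \<le> 1/32"
    using \<delta> unfolding \<epsilon>_eq by auto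
  have \<epsilon>r: "0 < \<epsilon> * r" using \<epsilon> r by simp
  obtain xs where xs: "xs \<in> approx_seqs X x0" using approx_seqs_nonempty[OF pts(2)] by blast
  obtain ys where ys: "ys \<in> approx_seqs X y0" using approx_seqs_nonempty[OF pts(3)] by blast
  have xsX: "xs n \<in> X (enat n)" and ysX: "ys n \<in> X (enat n)" for n
    using xs ys by (auto simp: approx_seqs_def)
  let ?\<Psi> = "\<lambda>n t x. \<tau> * (t - t0) + \<epsilon> / r * (t - t0)\<^sup>2 + \<beta> * D (enat n) x (xs n) + c * ((D (enat n) x (ys n))\<^sup>2 - C)"
  let ?\<Phi> = "\<lambda>n t x. \<tau> * (t - t0) + (\<epsilon> + \<delta>) / r * (t - t0)\<^sup>2 + (\<beta> + \<delta>) * D (enat n) x (xs n) + c * ((D (enat n) x (ys n))\<^sup>2 - C)"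
  \<comment> \<open>The limit bound has constant \<open>3 * \<epsilon> * r\<close>; one further
    \<open>\<epsilon> * r\<close> is the room that compactness requires.\<close>
  have ev1: "\<forall>\<^sub>F n in sequentially. \<forall>t x. \<bar>t - t0\<bar> \<le> r \<longrightarrow> x \<in> X (enat n) \<longrightarrow> D (enat n) x (xs n) \<le> r \<longrightarrow>
      u n (t, x) \<le> (u0 + 4 * \<epsilon> * r) + ?\<Psi> n t x"
  proof (rule eventually_paraboloid_bound[OF fin pts(2,3) xs ys r(2), of "u0 + 3 * \<epsilon> * r"])
    fix t x assume "\<bar>t - t0\<bar> \<le> r" "x \<in> X \<infinity>" "D \<infinity> x x0 \<le> r"
    from bound[OF this] show "real_of_ereal (upper_semilimit X u (t, x)) \<le> u0 + 3 * \<epsilon> * r +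
       (\<tau> * (t - t0) + \<epsilon> / r * (t - t0)\<^sup>2 + \<beta> * D \<infinity> x x0 + c * ((D \<infinity> x y0)\<^sup>2 - C))"
      unfolding C_def by linarith
  qed (use \<epsilon>r in simp)
  \<comment> \<open>Points where the semilimit is almost attained; they start Ekeland's
    procedure.\<close>
  have "ereal (u0 - \<epsilon> * r) < upper_semilimit X u (t0, x0)"
    using fin[rule_format, of "(t0, x0)"] pts \<epsilon>r unfolding u0
    by (cases "upper_semilimit X u (t0, x0)") auto
  then obtain ts zs where ts: "ts \<in> time_seqs t0" and zs: "zs \<in> approx_seqs X x0"
    and freq: "\<exists>\<^sub>F n in sequentially. u0 - \<epsilon> * r < u n (ts n, zs n)"
    by (rule upper_semilimit_greaterE)
  have tlim: "ts \<longlonglongrightarrow> t0" using ts by (simp add: time_seqs_def)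
  have xlim: "(\<lambda>n. D (enat n) (zs n) (xs n)) \<longlonglongrightarrow> 0"
    using dist_conv[OF pts(2,2) zs xs] pts(2) by simp
  have "(\<lambda>n. ?\<Phi> n (ts n) (zs n)) \<longlonglongrightarrow>
      \<tau> * (t0 - t0) + (\<epsilon> + \<delta>) / r * (t0 - t0)\<^sup>2 + (\<beta> + \<delta>) * 0 + c * ((D \<infinity> x0 y0)\<^sup>2 - C)"
    by (intro tendsto_intros tlim xlim dist_conv[OF pts(2,3) zs ys])
  then have "(\<lambda>n. ?\<Phi> n (ts n) (zs n)) \<longlonglongrightarrow> 0" by (simp add: C_def)
  from order_tendstoD(2)[OF this \<epsilon>r]
  have ev2: "\<forall>\<^sub>F n in sequentially. ?\<Phi> n (ts n) (zs n) < \<epsilon> * r" .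
  have ev3: "\<forall>\<^sub>F n in sequentially. \<bar>ts n - t0\<bar> < r / 2"
    using tendstoD[OF tlim, of "r / 2"] r by (simp add: dist_real_def)
  have ev4: "\<forall>\<^sub>F n in sequentially. D (enat n) (zs n) (xs n) < r / 2"
    using order_tendstoD(2)[OF xlim, of "r / 2"] r by simp
  have ev5: "\<forall>\<^sub>F n in sequentially. \<bar>D (enat n) (xs n) (ys n) - D \<infinity> x0 y0\<bar> < \<delta> * r"
    using tendstoD[OF dist_conv[OF pts(2,3) xs ys], of "\<delta> * r"] r \<delta> by (simp add: dist_real_def)
  have ev6: "\<forall>\<^sub>F n in sequentially. dist (xs n) x0 < r"
    using xs r by (auto simp: approx_seqs_def dest: tendstoD)
  \<comment> \<open>The starting property holds for infinitely many \<open>n\<close> and all others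
    eventually, so one \<open>n\<close> satisfies them together.\<close>
  from frequently_ex[OF frequently_eventually_frequently[OF freq eventually_conj[OF ev1 eventually_conj[OF ev2
    eventually_conj[OF ev3 eventually_conj[OF ev4 eventually_conj[OF ev5 eventually_conj[OF ev6
    eventually_ge_at_top[of N]]]]]]]]]
  obtain n where n1: "u0 - \<epsilon> * r < u n (ts n, zs n)"
    and n2: "\<And>t x. \<bar>t - t0\<bar> \<le> r \<Longrightarrow> x \<in> X (enat n) \<Longrightarrow> D (enat n) x (xs n) \<le> r \<Longrightarrow>
      u n (t, x) \<le> (u0 + 4 * \<epsilon> * r) + ?\<Psi> n t x"
    and n3: "?\<Phi> n (ts n) (zs n) < \<epsilon> * r" "\<bar>ts n - t0\<bar> < r / 2" "D (enat n) (zs n) (xs n) < r / 2"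
      "\<bar>D (enat n) (xs n) (ys n) - D \<infinity> x0 y0\<bar> < \<delta> * r" "dist (xs n) x0 < r" "N \<le> n"
    by blast
  define M where "M = X (enat n)"
  define d where "d = D (enat n)"
  interpret d: geodesic_space M d unfolding M_def d_def by unfold_locales
  have X: "xs n \<in> M" "ys n \<in> M" "zs n \<in> M"
    using xsX ysX zs by (auto simp: M_def approx_seqs_def)
  have sub: "metric_viscosity_subsolution M d (H (enat n)) (u n)" using sub by (simp add: M_def d_def)
  define G where "G = (\<lambda>z. real_of_ereal (usc_env (spacetime M d) (u n) z))"
  define \<Psi> where "\<Psi> = (\<lambda>(t, x). \<tau> * (t - t0) + \<epsilon> / r * (t - t0)\<^sup>2 + \<beta> * d x (xs n) + c * ((d x (ys n))\<^sup>2 - C))"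
  define \<Phi> where "\<Phi> = (\<lambda>(t, x). \<tau> * (t - t0) + (\<epsilon> + \<delta>) / r * (t - t0)\<^sup>2 + (\<beta> + \<delta>) * d x (xs n) + c * ((d x (ys n))\<^sup>2 - C))"
  have \<Phi>\<Psi>: "\<Phi> (t, x) = \<Psi> (t, x) + \<delta> / r * (t - t0)\<^sup>2 + \<delta> * d x (xs n)" for t x
    by (simp add: \<Phi>_def \<Psi>_def add_divide_distrib distrib_right)
  have env: "usc_env (spacetime M d) (u n) (t, x) = ereal (G (t, x))" if "0 < t" "x \<in> M" for t x
    using sub that unfolding metric_viscosity_subsolution_def G_def by (simp add: ereal_real')
  have pos: "0 < t" if "\<bar>t - t0\<bar> \<le> r / 2" for t using that r by linarith
  \<comment> \<open>On the half-size cylinder a neighbourhood of radius \<open>r / 2\<close> stays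
    where \<open>n2\<close> holds, so the bound passes to the envelope \<open>G\<close>.\<close>
  have G_le: "G (t, x) \<le> \<Psi> (t, x) + (u0 + 4 * \<epsilon> * r)"
    if tx: "\<bar>t - t0\<bar> \<le> r / 2" "x \<in> M" "d x (xs n) \<le> r / 2" for t x
  proof -
    have "locally_lipschitz M d \<Psi>"
      unfolding \<Psi>_def by (intro d.locally_lipschitz_paraboloid X coeff)
    moreover have "u n (s, y) \<le> \<Psi> (s, y) + (u0 + 4 * \<epsilon> * r)"
      if "y \<in> M" "\<bar>s - t\<bar> < r / 2" "d x y < r / 2" for s y
    proof -
      have "\<bar>s - t0\<bar> \<le> r" using that tx by linarith
      moreover have "d y (xs n) \<le> r"
        using d.triangle[OF that(1) tx(2) X(1)] that(3) tx(3) by (simp add: d.commute[of y x])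
      ultimately show ?thesis using n2[of s y] that(1) by (simp add: \<Psi>_def M_def d_def)
    qed
    ultimately have "usc_env (spacetime M d) (u n) (t, x) \<le> ereal (\<Psi> (t, x) + (u0 + 4 * \<epsilon> * r))"
      using pos[OF tx(1)] tx(2) r(1)
      by (intro d.usc_env_le_of_le_locally_lipschitz exI[of _ "r / 2"]) auto
    then show ?thesis using env[OF pos[OF tx(1)] tx(2)] by simp
  qed
  \<comment> \<open>One \<open>\<epsilon> * r\<close> is lost in the value of \<open>u n\<close>,
    one in \<open>\<Phi>\<close>.\<close>
  have start: "u0 - 2 * \<epsilon> * r < G (ts n, zs n) - \<Phi> (ts n, zs n)"
  proof -
    have "0 < ts n" using ts by (simp add: time_seqs_def)
    then have "u n (ts n, zs n) \<le> G (ts n, zs n)"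
      using d.usc_env_ge[of "ts n" "zs n" "u n"] env[of "ts n" "zs n"] X by simp
    moreover have "\<Phi> (ts n, zs n) < \<epsilon> * r" using n3(1) by (simp add: \<Phi>_def d_def)
    ultimately show ?thesis using n1 by linarith
  qed
  \<comment> \<open>Points at least as good as the start pay a penalty below
    \<open>(4 + 2) * \<epsilon> * r\<close>. As \<open>\<epsilon> = \<delta>\<^sup>2 / 32\<close>,
    dividing by the weight \<open>\<delta>\<close> leaves \<open>6 * \<delta> / 32 * r\<close>,
    small enough to exclude the boundary of the cylinder.\<close>
  have near: "\<bar>t - t0\<bar> < r / 2" "d x (xs n) < r / 2" "d x (xs n) \<le> \<delta> * r"
    if tx: "\<bar>t - t0\<bar> \<le> r / 2" "x \<in> M" "d x (xs n) \<le> r / 2"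
      and ge: "G (ts n, zs n) - \<Phi> (ts n, zs n) \<le> G (t, x) - \<Phi> (t, x)" for t x
  proof -
    have lt: "\<delta> / r * (t - t0)\<^sup>2 + \<delta> * d x (xs n) < 6 * \<epsilon> * r"
      using start ge G_le[OF tx] unfolding \<Phi>\<Psi>[of t x] by linarith
    have "6 * \<epsilon> * r = \<delta> * (6 * \<delta> / 32 * r)" by (simp add: \<epsilon>_eq power2_eq_square)
    moreover have "0 \<le> \<delta> / r * (t - t0)\<^sup>2" "0 \<le> \<delta> * d x (xs n)" using \<delta> r by simp_all
    ultimately have 1: "\<delta> * d x (xs n) < \<delta> * (6 * \<delta> / 32 * r)"
      and 2: "\<delta> / r * (t - t0)\<^sup>2 < \<delta> * (6 * \<delta> / 32 * r)" using lt by linarith+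
    have "d x (xs n) < 6 * \<delta> / 32 * r" using 1 \<delta>(1) by simp
    moreover have "6 * \<delta> / 32 * r \<le> \<delta> * r" "6 * \<delta> / 32 * r \<le> 1 / 2 * r"
      using \<delta> r by (intro mult_right_mono; simp)+
    ultimately show "d x (xs n) < r / 2" "d x (xs n) \<le> \<delta> * r" by simp_all
    have "\<delta> / r * (t - t0)\<^sup>2 = \<delta> * ((t - t0)\<^sup>2 / r)" by simp
    then have "(t - t0)\<^sup>2 / r < 6 * \<delta> / 32 * r" using 2 \<delta>(1) by (simp only: mult_less_cancel_left_pos)
    then have "(t - t0)\<^sup>2 < 6 * \<delta> / 32 * r * r" using r(1) by (simp add: pos_divide_less_eq)
    also have "\<dots> \<le> 1 / 4 * r * r" using \<delta> r by (intro mult_right_mono) auto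
    also have "\<dots> = (r / 2)\<^sup>2" by (simp add: power2_eq_square)
    finally have "\<bar>t - t0\<bar>\<^sup>2 < (r / 2)\<^sup>2" by simp
    then show "\<bar>t - t0\<bar> < r / 2" by (rule power2_less_imp_less) (use r(1) in simp)
  qed
  have coeff': "0 \<le> \<beta> + \<delta>" using coeff \<delta> by simp
  have "r / 2 < t0" using r by simp
  have bd: "G (t, x) - \<Phi> (t, x) \<le> u0 + 4 * \<epsilon> * r"
    if "\<bar>t - t0\<bar> \<le> r / 2" "x \<in> M" "d x (xs n) \<le> r / 2" for t x
  proof -
    have "0 \<le> \<delta> / r * (t - t0)\<^sup>2" "0 \<le> \<delta> * d x (xs n)" using \<delta> r by simp_all
    then show ?thesis using G_le[OF that] unfolding \<Phi>\<Psi> by linarith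
  qed
  obtain t x q where tx: "\<bar>t - t0\<bar> < r / 2" "x \<in> M" "d x (xs n) < r / 2"
    "G (ts n, zs n) - \<Phi> (ts n, zs n) \<le> G (t, x) - \<Phi> (t, x)"
    and q: "0 \<le> q" "\<bar>q - 2 * c * d x (ys n)\<bar> \<le> (\<beta> + \<delta>) + \<delta>"
      "H (enat n) t x (G (t, x)) q < - (\<tau> + 2 * ((\<epsilon> + \<delta>) / r) * (t - t0)) + \<delta>"
    by (rule d.subsolution_perturbed_maximum[OF sub X(1,2) \<open>r / 2 < t0\<close> coeff(1) coeff' \<delta>(1,1) G_def \<Phi>_def bd,
          of "ts n" "zs n"])
      (use n3 near X in \<open>auto simp: d_def\<close>)
  have tx': "\<bar>t - t0\<bar> \<le> r / 2" "d x (xs n) \<le> r / 2" using tx by simp_all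
  have dx: "d x (xs n) \<le> \<delta> * r" by (rule near(3)[OF tx'(1) tx(2) tx'(2) tx(4)])
  have "\<bar>d x (ys n) - d (xs n) (ys n)\<bar> \<le> d x (xs n)" by (rule d.abs_mdist_diff_le[OF tx(2) X(1,2)])
  then have dy: "\<bar>d x (ys n) - D \<infinity> x0 y0\<bar> \<le> 2 * (\<delta> * r)" using dx n3(4) unfolding d_def by linarith
  have \<delta>r: "\<delta> * r \<le> r" using \<delta> r by simp

  \<comment> \<open>The coefficient \<open>c\<close> may be large, but the distance error is of
    order \<open>\<delta> * r\<close>, so only \<open>2 * c * r \<le> P\<close> matters.\<close>
  have "\<bar>2 * c * d x (ys n) - 2 * c * D \<infinity> x0 y0\<bar> = 2 * c * \<bar>d x (ys n) - D \<infinity> x0 y0\<bar>"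
    using coeff(1) by (simp add: abs_mult flip: right_diff_distrib)
  also have "\<dots> \<le> 2 * c * (2 * (\<delta> * r))" using dy coeff(1) by (intro mult_left_mono) auto
  also have "\<dots> = 2 * \<delta> * (2 * c * r)" by simp
  also have "\<dots> \<le> 2 * \<delta> * P" using coeff(3) \<delta> by (intro mult_left_mono) auto
  finally have q': "\<bar>q - 2 * c * D \<infinity> x0 y0\<bar> \<le> \<beta> + 2 * \<delta> + 2 * P * \<delta>"
    using q(2) by (simp add: mult.commute mult.left_commute)

  \<comment> \<open>Time derivative of the quadratic term;
    \<open>\<bar>t - t0\<bar> \<le> r / 2\<close> cancels the factor \<open>1 / r\<close>.\<close>
  have "\<bar>2 * ((\<epsilon> + \<delta>) / r) * (t - t0)\<bar> = 2 * ((\<epsilon> + \<delta>) / r) * \<bar>t - t0\<bar>"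
    using \<epsilon>(1) \<delta>(1) r(1) by (simp add: abs_mult)
  also have "\<dots> \<le> 2 * ((\<epsilon> + \<delta>) / r) * (r / 2)"
    using tx'(1) \<epsilon>(1) \<delta>(1) r(1) by (intro mult_left_mono) auto
  also have "\<dots> = \<epsilon> + \<delta>" using r(1) by simp
  finally have "\<bar>2 * ((\<epsilon> + \<delta>) / r) * (t - t0)\<bar> \<le> 2 * \<delta>" using \<epsilon>(2) by linarith
  then have H: "H (enat n) t x (G (t, x)) q < - \<tau> + 3 * \<delta>" using q(3) by linarith

  \<comment> \<open>\<open>G - \<Phi>\<close> lies between \<open>u0 - 2 * \<epsilon> * r\<close>
    and \<open>u0 + 4 * \<epsilon> * r\<close>, and each term of \<open>\<Phi>\<close> is at most a
    constant times \<open>r\<close>; for the squared distance this is again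
    \<open>2 * c * r \<le> P\<close>.\<close>
  have w: "\<bar>G (t, x) - u0\<bar> \<le> (\<bar>\<tau>\<bar> + \<beta> + 4 * P + 7) * r"
  proof -
    have 1: "\<bar>\<tau> * (t - t0)\<bar> \<le> \<bar>\<tau>\<bar> * r"
      unfolding abs_mult using tx'(1) r(1) by (intro mult_left_mono) auto
    have "(t - t0)\<^sup>2 \<le> (r / 2)\<^sup>2" using power_mono[OF tx'(1) abs_ge_zero, of 2] by simp
    then have "(\<epsilon> + \<delta>) / r * (t - t0)\<^sup>2 \<le> (\<epsilon> + \<delta>) / r * (r / 2)\<^sup>2"
      using \<epsilon>(1) \<delta>(1) r(1) by (intro mult_left_mono) auto
    also have "\<dots> = (\<epsilon> + \<delta>) / 4 * r" using r(1) by (simp add: power2_eq_square)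
    also have "\<dots> \<le> 1 * r" using \<epsilon>(4) \<delta>(2) r(1) by (intro mult_right_mono) auto
    finally have 2: "(\<epsilon> + \<delta>) / r * (t - t0)\<^sup>2 \<le> r" by simp
    have nn2: "0 \<le> (\<epsilon> + \<delta>) / r * (t - t0)\<^sup>2" using \<epsilon>(1) \<delta>(1) r(1) by simp
    have 3: "(\<beta> + \<delta>) * d x (xs n) \<le> (\<beta> + 1) * r"
      using order.trans[OF dx \<delta>r] coeff(2) \<delta> by (intro mult_mono) auto
    have nn3: "0 \<le> (\<beta> + \<delta>) * d x (xs n)" using coeff' by simp
    have "\<bar>(d x (ys n))\<^sup>2 - C\<bar> = \<bar>d x (ys n) - D \<infinity> x0 y0\<bar> * (d x (ys n) + D \<infinity> x0 y0)"
      by (simp add: C_def power2_eq_square square_diff_square_factored abs_mult)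
    also have "\<dots> \<le> (2 * r) * (4 * r)"
    proof (rule mult_mono)
      show "\<bar>d x (ys n) - D \<infinity> x0 y0\<bar> \<le> 2 * r" using dy \<delta>r by linarith
      then show "d x (ys n) + D \<infinity> x0 y0 \<le> 4 * r" using r(3) by linarith
    qed (use r(1) in auto)
    finally have "c * \<bar>(d x (ys n))\<^sup>2 - C\<bar> \<le> c * ((2 * r) * (4 * r))"
      using coeff(1) by (rule mult_left_mono)
    also have "\<dots> = (2 * c * r) * (4 * r)" by simp
    also have "\<dots> \<le> P * (4 * r)" using coeff(3) r(1) by (intro mult_right_mono) auto
    finally have 4: "\<bar>c * ((d x (ys n))\<^sup>2 - C)\<bar> \<le> 4 * P * r" using coeff(1) by (simp add: abs_mult)
    have "4 * \<epsilon> * r \<le> 1 * r" using \<epsilon>(4) r(1) by (intro mult_right_mono) auto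
    moreover have "G (t, x) \<le> u0 + 4 * \<epsilon> * r + \<Phi> (t, x)" using bd[OF tx'(1) tx(2) tx'(2)] by simp
    moreover have "u0 - 2 * \<epsilon> * r + \<Phi> (t, x) \<le> G (t, x)" using start tx(4) by linarith
    moreover have "\<Phi> (t, x) = \<tau> * (t - t0) + (\<epsilon> + \<delta>) / r * (t - t0)\<^sup>2 + (\<beta> + \<delta>) * d x (xs n) + c * ((d x (ys n))\<^sup>2 - C)"
      by (simp add: \<Phi>_def)
    moreover have "(\<bar>\<tau>\<bar> + \<beta> + 4 * P + 7) * r = \<bar>\<tau>\<bar> * r + (\<beta> + 1) * r + 4 * P * r + 6 * r"
      by (simp add: algebra_simps)
    ultimately show ?thesis
      using abs_le_D1[OF 1] abs_le_D2[OF 1] 2 nn2 3 nn3 abs_le_D1[OF 4] abs_le_D2[OF 4] \<epsilon>r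
      by (intro abs_leI) linarith+
  qed
  have "dist x x0 \<le> dist x (xs n) + dist (xs n) x0" by (rule dist_triangle)
  moreover have "dist x (xs n) \<le> d x (xs n)"
    using dist_le_D[of x "enat n" "xs n"] tx(2) X(1) by (simp add: M_def d_def)
  ultimately have "dist x x0 \<le> 2 * r" using n3(5) tx'(2) r(1) by linarith
  moreover have "\<bar>t - t0\<bar> \<le> r" using tx'(1) r(1) by simp
  ultimately show ?thesis using that[OF n3(6) pos[OF tx'(1)]] tx(2) w q(1) q' H by (simp add: M_def)
qed

text \<open>Approximate contact points for accuracies tending to 0 are chosen with increasing
  indices. Their slopes are bounded, so a subsequence converges to some \<open>q\<close> with
  \<open>\<bar>q - p\<bar> \<le> a\<close>; convergence of the Hamiltonians gives the inequality at
  \<open>q\<close>, hence for the infimum \<open>H_lower\<close>.\<close>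

lemma subsolution_upper_semilimit:
  fixes H :: "enat \<Rightarrow> real \<Rightarrow> 'a \<Rightarrow> real \<Rightarrow> real \<Rightarrow> real"
  assumes H_conv: "\<And>t ts x xs r rs p ps. 0 < t \<Longrightarrow> ts \<in> time_seqs t \<Longrightarrow>
      x \<in> X \<infinity> \<Longrightarrow> xs \<in> approx_seqs X x \<Longrightarrow> rs \<longlonglongrightarrow> r \<Longrightarrow>
      (\<forall>n. 0 \<le> ps n) \<Longrightarrow> 0 \<le> p \<Longrightarrow> ps \<longlonglongrightarrow> p \<Longrightarrow>
      (\<lambda>n. H (enat n) (ts n) (xs n) (rs n) (ps n)) \<longlonglongrightarrow> H \<infinity> t x r p"
    and sub: "\<And>n. metric_viscosity_subsolution (X (enat n)) (D (enat n)) (H (enat n)) (u n)"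
    and fin: "\<forall>z\<in>{0<..} \<times> X \<infinity>. \<bar>upper_semilimit X u z\<bar> \<noteq> \<infinity>"
    and usc: "usc (spacetime (X \<infinity>) (D \<infinity>)) (\<lambda>z. real_of_ereal (upper_semilimit X u z))"
  shows "metric_viscosity_subsolution (X \<infinity>) (D \<infinity>) (H \<infinity>) (\<lambda>z. real_of_ereal (upper_semilimit X u z))"
proof -
  define U where "U = (\<lambda>z. real_of_ereal (upper_semilimit X u z))"
  let ?T = "spacetime (X \<infinity>) (D \<infinity>)"
  have env: "usc_env ?T U (t, x) = ereal (U (t, x))" if "0 < t" "x \<in> X \<infinity>" for t x
    using S.usc_env_eq_of_usc[of \<infinity> U t x] usc that unfolding U_def by blast
  show ?thesis unfolding metric_viscosity_subsolution_def U_def[symmetric]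
  proof (intro conjI allI impI ballI)
    fix z :: "real \<times> 'a" assume "z \<in> {0<..} \<times> X \<infinity>"
    then show "\<bar>usc_env ?T U z\<bar> \<noteq> \<infinity>" using env by auto
  next
    fix \<psi>1 \<psi>2 t0 x0
    assume test: "sub_test (X \<infinity>) (D \<infinity>) \<psi>1 \<psi>2" and z0: "0 < (t0::real)" "x0 \<in> X \<infinity>"
      and max: "local_max_at ?T (\<lambda>z. real_of_ereal (usc_env ?T U z) - (\<psi>1 z + \<psi>2 z)) (t0, x0)"
    define p where "p = slope (X \<infinity>) (D \<infinity>) \<psi>1 (t0, x0)"
    define a where "a = real_of_ereal (usc_env ?T (slope (X \<infinity>) (D \<infinity>) \<psi>2) (t0, x0))"
    define \<tau> where "\<tau> = time_deriv (\<lambda>z. \<psi>1 z + \<psi>2 z) (t0, x0)"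
    define u0 where "u0 = U (t0, x0)"
    \<comment> \<open>Bounds the factor of \<open>r\<close> in the value estimate uniformly in
      \<open>\<epsilon> \<le> 1\<close>, with \<open>P = p + 1\<close>.\<close>
    define K where "K = \<bar>\<tau>\<bar> + (a + 2) + 4 * (p + 1) + 7"
    have pa: "0 \<le> p" "0 \<le> a"
      using test z0 S.slope_nonneg S.usc_env_slope_finite
      unfolding p_def a_def sub_test_def by (auto intro: real_of_ereal_pos)
    then have K: "0 < K" by (simp add: K_def)
    have point: "\<exists>n\<ge>N. \<exists>t x w q. 0 < t \<and> \<bar>t - t0\<bar> \<le> \<delta> \<and> x \<in> X (enat n) \<and> dist x x0 \<le> \<delta> \<and>
        \<bar>w - u0\<bar> \<le> \<delta> \<and> 0 \<le> q \<and> \<bar>q - p\<bar> \<le> a + (2 * p + 7) * \<delta> \<and> H (enat n) t x w q \<le> - \<tau> + 3 * \<delta>"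
      if \<delta>: "0 < \<delta>" "\<delta> < 1" for \<delta> and N :: nat
    proof -
      define \<epsilon> where "\<epsilon> = \<delta>\<^sup>2 / 32"
      have "\<delta>\<^sup>2 \<le> \<delta>" using \<delta> by (simp add: power2_eq_square)
      then have \<epsilon>: "0 < \<epsilon>" "3 * \<epsilon> \<le> \<delta>" "\<epsilon> \<le> 1" using \<delta> unfolding \<epsilon>_def by auto
      \<comment> \<open>For \<open>r\<close> below this bound both \<open>K * r\<close> and
        \<open>2 * r\<close> are at most \<open>\<delta>\<close>, so one parameter controls values,
        points and times.\<close>
      have "0 < \<delta> / (K + 2)" using \<delta> K by simp
      then obtain r c y where r: "0 < r" "r < \<delta> / (K + 2)" "r < t0" "y \<in> X \<infinity>" "D \<infinity> x0 y \<le> r"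
        and c: "0 \<le> c" "2 * c * r \<le> p + \<epsilon>" "\<bar>2 * c * D \<infinity> x0 y - p\<bar> \<le> \<epsilon>"
        and bound: "\<And>t x. \<bar>t - t0\<bar> \<le> r \<Longrightarrow> x \<in> X \<infinity> \<Longrightarrow> D \<infinity> x x0 \<le> r \<Longrightarrow>
          real_of_ereal (usc_env ?T U (t, x)) \<le> real_of_ereal (usc_env ?T U (t0, x0)) + 3 * \<epsilon> * r
            + \<tau> * (t - t0) + \<epsilon> / r * (t - t0)\<^sup>2
            + (a + 2 * \<epsilon>) * D \<infinity> x x0 + c * ((D \<infinity> x y)\<^sup>2 - (D \<infinity> x0 y)\<^sup>2)"
        by (rule S.sub_test_touching_paraboloid[OF test z0 max \<epsilon>(1), folded p_def a_def \<tau>_def]) (rule that)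
      have "(K + 2) * r < \<delta>" using r(2) K by (simp add: pos_less_divide_eq mult.commute)
      then have rK: "K * r \<le> \<delta>" "2 * r \<le> \<delta>" "r \<le> \<delta>"
        using mult_pos_pos[OF K r(1)] r(1) unfolding distrib_right by linarith+
      obtain n t x w q where n: "N \<le> n" "0 < t" "\<bar>t - t0\<bar> \<le> r" "x \<in> X (enat n)" "dist x x0 \<le> 2 * r"
        and w: "\<bar>w - u0\<bar> \<le> (\<bar>\<tau>\<bar> + (a + 2 * \<epsilon>) + 4 * (p + 1) + 7) * r" and q: "0 \<le> q"
        "\<bar>q - 2 * c * D \<infinity> x0 y\<bar> \<le> (a + 2 * \<epsilon>) + 2 * \<delta> + 2 * (p + 1) * \<delta>" "H (enat n) t x w q < - \<tau> + 3 * \<delta>"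
      proof (rule exists_approximate_point[OF sub fin z0 r(4,1,3,5) c(1) _ _ \<delta> \<epsilon>_def,
            of "a + 2 * \<epsilon>" "p + 1" u0 \<tau>])
        fix t x assume tx: "\<bar>t - t0\<bar> \<le> r" "x \<in> X \<infinity>" "D \<infinity> x x0 \<le> r"
        then have "0 < t" using r(3) by linarith
        then show "real_of_ereal (upper_semilimit X u (t, x)) \<le> u0 + 3 * \<epsilon> * r + \<tau> * (t - t0)
            + \<epsilon> / r * (t - t0)\<^sup>2 + (a + 2 * \<epsilon>) * D \<infinity> x x0 + c * ((D \<infinity> x y)\<^sup>2 - (D \<infinity> x0 y)\<^sup>2)"
          using bound[OF tx] env[OF _ tx(2)] env[OF z0] by (simp add: u0_def U_def)
      qed (use pa \<epsilon> c in \<open>auto simp: u0_def U_def\<close>)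
      have "(\<bar>\<tau>\<bar> + (a + 2 * \<epsilon>) + 4 * (p + 1) + 7) * r \<le> K * r"
        using \<epsilon>(3) r(1) unfolding K_def by (intro mult_right_mono) auto
      then have "\<bar>w - u0\<bar> \<le> \<delta>" using w rK by linarith
      moreover have "\<bar>q - p\<bar> \<le> a + (2 * p + 7) * \<delta>"
      proof -
        have "(2 * p + 7) * \<delta> = 2 * (p + 1) * \<delta> + 5 * \<delta>" by (simp add: algebra_simps)
        then show ?thesis using q(2) c(3) \<epsilon>(2) \<delta>(1) by linarith
      qed
      ultimately show ?thesis using n q rK by (intro exI[of _ n] exI conjI) (assumption | linarith)+
    qed
    \<comment> \<open>The shift by 2 gives \<open>\<delta> 0 = 1 / 2\<close>, so that
      \<open>\<delta> k < 1\<close> for all \<open>k\<close>.\<close>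
    define \<delta> where "\<delta> k = 1 / real (k + 2)" for k
    have \<delta>: "0 < \<delta> k" "\<delta> k < 1" for k by (simp_all add: \<delta>_def)
    have \<delta>lim: "\<delta> \<longlonglongrightarrow> 0"
      unfolding \<delta>_def by (rule LIMSEQ_ignore_initial_segment[OF lim_1_over_n])
    define A where "A k n \<longleftrightarrow> (\<exists>t x w q. 0 < t \<and> \<bar>t - t0\<bar> \<le> \<delta> k \<and> x \<in> X (enat n) \<and> dist x x0 \<le> \<delta> k \<and>
        \<bar>w - u0\<bar> \<le> \<delta> k \<and> 0 \<le> q \<and> \<bar>q - p\<bar> \<le> a + (2 * p + 7) * \<delta> k \<and> H (enat n) t x w q \<le> - \<tau> + 3 * \<delta> k)" for k n
    have A: "\<exists>n\<ge>N. A k n" for k N unfolding A_def using point[OF \<delta>] .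
    \<comment> \<open>Diagonal choice: the accuracy improves with \<open>k\<close> while the indices
      \<open>h k\<close> increase strictly.\<close>
    have "\<exists>h. \<forall>k. A k (h k) \<and> h k < h (Suc k)"
    proof (rule dependent_nat_choice)
      show "\<exists>n. A 0 n" using A by blast
      show "\<exists>m. A (Suc k) m \<and> n < m" for k n using A[of "Suc n" "Suc k"] Suc_le_lessD by blast
    qed
    then obtain h where h: "strict_mono h" "\<And>k. A k (h k)" by (auto simp: strict_mono_Suc_iff)
    from h(2)[unfolded A_def] obtain tk xk wk qk where
      k: "\<And>k. 0 < tk k" "\<And>k. \<bar>tk k - t0\<bar> \<le> \<delta> k" "\<And>k. xk k \<in> X (enat (h k))" "\<And>k. dist (xk k) x0 \<le> \<delta> k"
        "\<And>k. \<bar>wk k - u0\<bar> \<le> \<delta> k" "\<And>k. 0 \<le> qk k" "\<And>k. \<bar>qk k - p\<bar> \<le> a + (2 * p + 7) * \<delta> k"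
        "\<And>k. H (enat (h k)) (tk k) (xk k) (wk k) (qk k) \<le> - \<tau> + 3 * \<delta> k"
      by metis
    have "qk k \<in> cball p (a + (2 * p + 7))" for k
    proof -
      have "(2 * p + 7) * \<delta> k \<le> (2 * p + 7) * 1" using \<delta>[of k] pa by (intro mult_left_mono) auto
      then show ?thesis using k(7)[of k] by (simp add: dist_real_def abs_minus_commute)
    qed
    then obtain q g where g: "strict_mono (g :: nat \<Rightarrow> nat)" "(qk \<circ> g) \<longlonglongrightarrow> q"
      using compact_cball[of p "a + (2 * p + 7)"] unfolding compact_def by metis
    have \<delta>g: "(\<lambda>j. \<delta> (g j)) \<longlonglongrightarrow> 0" using LIMSEQ_subseq_LIMSEQ[OF \<delta>lim g(1)] by (simp add: o_def)
    have qg: "(\<lambda>j. qk (g j)) \<longlonglongrightarrow> q" using g(2) by (simp add: o_def)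
    have q: "0 \<le> q" using k(6) by (intro LIMSEQ_le_const[OF qg]) auto
    have "(\<lambda>j. a + (2 * p + 7) * \<delta> (g j)) \<longlonglongrightarrow> a + (2 * p + 7) * 0" by (intro tendsto_intros \<delta>g)
    moreover have "(\<lambda>j. \<bar>qk (g j) - p\<bar>) \<longlonglongrightarrow> \<bar>q - p\<bar>" by (intro tendsto_intros qg)
    ultimately have qp: "\<bar>q - p\<bar> \<le> a + (2 * p + 7) * 0" using k(7) by (intro LIMSEQ_le) auto
    have hg: "strict_mono (h \<circ> g)" using h(1) g(1) by (rule strict_mono_o)
    have lims: "(\<lambda>j. tk (g j)) \<longlonglongrightarrow> t0" "(\<lambda>j. xk (g j)) \<longlonglongrightarrow> x0" "(\<lambda>j. wk (g j)) \<longlonglongrightarrow> u0"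
      unfolding tendsto_dist_iff[of _ t0] tendsto_dist_iff[of _ x0] tendsto_dist_iff[of _ u0]
      by (rule Lim_null_comparison[OF _ \<delta>g]; use k(2,4,5) in \<open>simp add: dist_real_def\<close>)+
    \<comment> \<open>Convergence of \<open>H\<close> is assumed along full sequences, so times,
      points, values and slopes are filled in between the chosen indices; the filler
      \<open>q\<close> keeps the slopes nonnegative.\<close>
    obtain ts where ts: "ts \<in> time_seqs t0" "\<And>j. ts ((h \<circ> g) j) = tk (g j)"
      using time_seqs_subseq[OF hg z0(1) _ lims(1)] k(1) by blast
    obtain xs where xs: "xs \<in> approx_seqs X x0" "\<And>j. xs ((h \<circ> g) j) = xk (g j)"
      using approx_seqs_subseq[OF hg z0(2) _ lims(2)] k(3) by auto
    obtain ws where ws: "ws \<longlonglongrightarrow> u0" "\<And>j. ws ((h \<circ> g) j) = wk (g j)"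
      by (rule tendsto_interleave[OF hg tendsto_const lims(3)]) (rule that)
    obtain qs where qs: "qs \<longlonglongrightarrow> q" "\<And>j. qs ((h \<circ> g) j) = qk (g j)" "\<And>n. qs n = q \<or> (\<exists>j. n = (h \<circ> g) j)"
      by (rule tendsto_interleave[OF hg tendsto_const qg]) (rule that)
    have "\<forall>n. 0 \<le> qs n" using qs(2,3) q k(6) by metis
    from LIMSEQ_subseq_LIMSEQ[OF H_conv[OF z0(1) ts(1) z0(2) xs(1) ws(1) this q qs(1)] hg]
    have "(\<lambda>j. H (enat (h (g j))) (tk (g j)) (xk (g j)) (wk (g j)) (qk (g j))) \<longlonglongrightarrow> H \<infinity> t0 x0 u0 q"
      using ts(2) xs(2) ws(2) qs(2) by (simp add: o_def)
    moreover have "(\<lambda>j. - \<tau> + 3 * \<delta> (g j)) \<longlonglongrightarrow> - \<tau> + 3 * 0" by (intro tendsto_intros \<delta>g)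
    ultimately have "H \<infinity> t0 x0 u0 q \<le> - \<tau> + 3 * 0" using k(8) by (intro LIMSEQ_le) auto
    then have "H \<infinity> t0 x0 u0 q \<le> - \<tau>" by simp
    moreover have "H_lower (H \<infinity>) a t0 x0 u0 p \<le> ereal (H \<infinity> t0 x0 u0 q)"
      unfolding H_lower_def using q qp by (intro INF_lower) simp
    ultimately have "H_lower (H \<infinity>) a t0 x0 u0 p \<le> ereal (- \<tau>)" by (meson ereal_less_eq(3) order.trans)
    then have "ereal \<tau> + H_lower (H \<infinity>) a t0 x0 u0 p \<le> 0"
      by (cases "H_lower (H \<infinity>) a t0 x0 u0 p") auto
    then show "ereal (time_deriv (\<lambda>z. \<psi>1 z + \<psi>2 z) (t0, x0)) +
        H_lower (H \<infinity>) (real_of_ereal (usc_env ?T (slope (X \<infinity>) (D \<infinity>) \<psi>2) (t0, x0))) t0 x0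
          (real_of_ereal (usc_env ?T U (t0, x0))) (slope (X \<infinity>) (D \<infinity>) \<psi>1 (t0, x0)) \<le> 0"
      unfolding env[OF z0] by (simp add: p_def a_def \<tau>_def u0_def)
  qed
qed

section \<open>Supersolutions by change of sign\<close>

lemma upper_semilimit_uminus: "upper_semilimit X (\<lambda>n z. - u n z) z = - lower_semilimit X u z"
proof -
  have "limsup (\<lambda>n. ereal (- u n (ts n, xs n))) = - liminf (\<lambda>n. ereal (u n (ts n, xs n)))" for ts xs
    by (simp add: ereal_Limsup_uminus flip: uminus_ereal.simps)
  then show ?thesis
    unfolding upper_semilimit_def lower_semilimit_def
    by (simp add: split_beta ereal_SUP_uminus_eq)
qed

text \<open>The subsolution result is applied to the functions \<open>- u n\<close> and the
  Hamiltonians \<open>- H n t x (- r) p\<close>, which inherit convergence from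
  \<open>H\<close>.\<close>

lemma supersolution_lower_semilimit:
  fixes H :: "enat \<Rightarrow> real \<Rightarrow> 'a \<Rightarrow> real \<Rightarrow> real \<Rightarrow> real"
  assumes H_conv: "\<And>t ts x xs r rs p ps. 0 < t \<Longrightarrow> ts \<in> time_seqs t \<Longrightarrow>
      x \<in> X \<infinity> \<Longrightarrow> xs \<in> approx_seqs X x \<Longrightarrow> rs \<longlonglongrightarrow> r \<Longrightarrow>
      (\<forall>n. 0 \<le> ps n) \<Longrightarrow> 0 \<le> p \<Longrightarrow> ps \<longlonglongrightarrow> p \<Longrightarrow>
      (\<lambda>n. H (enat n) (ts n) (xs n) (rs n) (ps n)) \<longlonglongrightarrow> H \<infinity> t x r p"
    and super: "\<And>n. metric_viscosity_supersolution (X (enat n)) (D (enat n)) (H (enat n)) (u n)"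
    and fin: "\<forall>z\<in>{0<..} \<times> X \<infinity>. \<bar>lower_semilimit X u z\<bar> \<noteq> \<infinity>"
    and lsc: "lsc (spacetime (X \<infinity>) (D \<infinity>)) (\<lambda>z. real_of_ereal (lower_semilimit X u z))"
  shows "metric_viscosity_supersolution (X \<infinity>) (D \<infinity>) (H \<infinity>) (\<lambda>z. real_of_ereal (lower_semilimit X u z))"
proof -
  define H' where "H' n t x r p = - H n t x (- r) p" for n t x r p
  have eq: "(\<lambda>z. real_of_ereal (upper_semilimit X (\<lambda>n z. - u n z) z)) =
      (\<lambda>z. - real_of_ereal (lower_semilimit X u z))"
    by (simp add: upper_semilimit_uminus)
  have "metric_viscosity_subsolution (X \<infinity>) (D \<infinity>) (H' \<infinity>)
      (\<lambda>z. real_of_ereal (upper_semilimit X (\<lambda>n z. - u n z) z))"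
  proof (rule subsolution_upper_semilimit)
    fix t r p :: real and ts rs ps :: "nat \<Rightarrow> real" and x xs
    assume "0 < t" "ts \<in> time_seqs t" "x \<in> X \<infinity>" "xs \<in> approx_seqs X x" "rs \<longlonglongrightarrow> r"
      "\<forall>n. 0 \<le> ps n" "0 \<le> p" "ps \<longlonglongrightarrow> p"
    then show "(\<lambda>n. H' (enat n) (ts n) (xs n) (rs n) (ps n)) \<longlonglongrightarrow> H' \<infinity> t x r p"
      unfolding H'_def by (intro tendsto_minus H_conv)
  next
    show "metric_viscosity_subsolution (X (enat n)) (D (enat n)) (H' (enat n)) (\<lambda>z. - u n z)" for n
      using super[of n] unfolding S.supersolution_iff_subsolution_uminus H'_def .
    show "\<forall>z\<in>{0<..} \<times> X \<infinity>. \<bar>upper_semilimit X (\<lambda>n z. - u n z) z\<bar> \<noteq> \<infinity>"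
      using fin by (simp add: upper_semilimit_uminus)
    show "usc (spacetime (X \<infinity>) (D \<infinity>)) (\<lambda>z. real_of_ereal (upper_semilimit X (\<lambda>n z. - u n z) z))"
      using lsc unfolding eq usc_def lsc_def by (simp add: minus_less_iff)
  qed
  then show ?thesis unfolding S.supersolution_iff_subsolution_uminus eq H'_def .
qed

end

theorem theorem7p3:
  fixes X :: "enat \<Rightarrow> 'a::metric_space set"
    and H :: "enat \<Rightarrow> real \<Rightarrow> 'a \<Rightarrow> real \<Rightarrow> real \<Rightarrow> real"
  assumes proper: "\<And>(x::'a) r. compact (cball x r)"
    and X_compact: "\<And>n. compact (X n)"
    and X_nonempty: "\<And>n. X n \<noteq> {}"
    and dist_finite: "\<And>n x y. x \<in> X n \<Longrightarrow> y \<in> X n \<Longrightarrow> length_dist (X n) x y < \<infinity>"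
    and geodesic: "\<And>n. complete_geodesic_space (X n) (intrinsic_metric (X n))"
    and hausdorff_conv:
      "(\<lambda>n::nat. max (SUP x\<in>X (enat n). infdist x (X \<infinity>)) (SUP x\<in>X \<infinity>. infdist x (X (enat n))))
         \<longlonglongrightarrow> 0"
    and dist_conv: "\<And>a b as bs. a \<in> X \<infinity> \<Longrightarrow> b \<in> X \<infinity> \<Longrightarrow>
      as \<in> approx_seqs X a \<Longrightarrow> bs \<in> approx_seqs X b \<Longrightarrow>
      (\<lambda>n. intrinsic_metric (X (enat n)) (as n) (bs n)) \<longlonglongrightarrow> intrinsic_metric (X \<infinity>) a b"
    and H_conv: "\<And>t ts x xs r rs p ps. 0 < t \<Longrightarrow> ts \<in> time_seqs t \<Longrightarrow>
      x \<in> X \<infinity> \<Longrightarrow> xs \<in> approx_seqs X x \<Longrightarrow> rs \<longlonglongrightarrow> r \<Longrightarrow>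
      (\<forall>n. 0 \<le> ps n) \<Longrightarrow> 0 \<le> p \<Longrightarrow> ps \<longlonglongrightarrow> p \<Longrightarrow>
      (\<lambda>n. H (enat n) (ts n) (xs n) (rs n) (ps n)) \<longlonglongrightarrow> H \<infinity> t x r p"
  shows
    "(\<forall>u :: nat \<Rightarrow> real \<times> 'a \<Rightarrow> real.
        (\<forall>n. metric_viscosity_subsolution
               (X (enat n)) (intrinsic_metric (X (enat n))) (H (enat n)) (u n)) \<longrightarrow>
        (\<forall>z\<in>{0<..} \<times> X \<infinity>. \<bar>upper_semilimit X u z\<bar> \<noteq> \<infinity>) \<longrightarrow>
        usc (spacetime (X \<infinity>) (intrinsic_metric (X \<infinity>)))
          (\<lambda>z. real_of_ereal (upper_semilimit X u z)) \<longrightarrow>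
        metric_viscosity_subsolution (X \<infinity>) (intrinsic_metric (X \<infinity>)) (H \<infinity>)
          (\<lambda>z. real_of_ereal (upper_semilimit X u z))) \<and>
     (\<forall>u :: nat \<Rightarrow> real \<times> 'a \<Rightarrow> real.
        (\<forall>n. metric_viscosity_supersolution
               (X (enat n)) (intrinsic_metric (X (enat n))) (H (enat n)) (u n)) \<longrightarrow>
        (\<forall>z\<in>{0<..} \<times> X \<infinity>. \<bar>lower_semilimit X u z\<bar> \<noteq> \<infinity>) \<longrightarrow>
        lsc (spacetime (X \<infinity>) (intrinsic_metric (X \<infinity>)))
          (\<lambda>z. real_of_ereal (lower_semilimit X u z)) \<longrightarrow>
        metric_viscosity_supersolution (X \<infinity>) (intrinsic_metric (X \<infinity>)) (H \<infinity>)
          (\<lambda>z. real_of_ereal (lower_semilimit X u z)))"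
proof -
  interpret converging_spaces X
    by unfold_locales (use X_compact X_nonempty dist_finite geodesic hausdorff_conv dist_conv in auto)
  show ?thesis
    using subsolution_upper_semilimit[of H, OF H_conv] supersolution_lower_semilimit[of H, OF H_conv]
    by blast
qed

end
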